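(* Let $(B_j)_{j\in\mathbb{N}}$ be a monotonic non-decreasing sequence of complex Banach spaces with continuous injections $B_j\hookrightarrow B_{j+1}$. Let $(\Gamma^{(i)}_j,\Gamma^{(e)}_j)_{j\in\mathbb{N}}$ be a sequence of nested pairs such that the sequence of compact sets $K_j=K(\Gamma^{(i)}_j,\Gamma^{(e)}_j)$ is monotonic non-decreasing. Then the space of monogenic functions $\mathcal{M}\bigl((K_j),(B_j)\bigr)$ is $\mathcal{H}^1$-quasianalytic relatively to $\bigcup_j K_j$, and it is also quasianalytic at every point of $\bigcup_j \operatorname{int}(K_j)$.
   Context: $\widehat{\mathbb{C}}=\mathbb{C}\cup\{\infty\}$ is the Riemann sphere. $\mathcal{H}^1$ is the one-dimensional Hausdorff outer measure on $\mathbb{C}$, extended to $\widehat{\mathbb{C}}$ by $\mathcal{H}^1(A)=\mathcal{H}^1(A\setminus\{\infty\})$. A Jordan curve is the image of a continuous injective map from $\mathbb{R}/\mathbb{Z}$ to $\widehat{\mathbb{C}}$. $\operatorname{int}(K)$ is the interior of $K$ in $\widehat{\mathbb{C}}$. Nested pair: $(\Gamma^{(i)},\Gamma^{(e)})$ is a nested pair if $\Gamma^{(i)}$ and $\Gamma^{(e)}$ are Jordan curves contained in $\mathbb{C}$ such that (1) $\Gamma^{(i)}$ is contained in the closure of the connected component of $\widehat{\mathbb{C}}\setminus\Gamma^{(e)}$ which does not contain $\infty$; (2) $\Gamma^{(i)}$ and $\Gamma^{(e)}$ are rectifiable and $\mathcal{H}^1(\Gamma^{(i)}\cap\Gamma^{(e)})>0$.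 Then $K^{(e)}$ is the closure of the connected component of $\widehat{\mathbb{C}}\setminus\Gamma^{(e)}$ containing $\infty$, $K^{(i)}$ is the closure of the connected component of $\widehat{\mathbb{C}}\setminus\Gamma^{(i)}$ not containing $\infty$, and $K(\Gamma^{(i)},\Gamma^{(e)})=K^{(i)}\cup K^{(e)}$. $\mathcal{C}^1$-holomorphic functions: for $K\subset\widehat{\mathbb{C}}$ compact and $B$ a complex Banach space, $\mathcal{C}^1_{\mathrm{hol}}(K,B)$ is the set of continuous $f:K\to B$ for which there is a continuous $f^{(1)}:K\to B$ such that for all $q\in K$ and $\varepsilon>0$ there is $\delta>0$ such that $q_1,q_2\in K$, $|q_1-q|,|q_2-q|\le\delta$ imply $\|f(q_2)-f(q_1)-(q_2-q_1)f^{(1)}(q)\|\le\varepsilon|q_2-q_1|$ (using the inversion coordinate $1/q$ near $q=\infty$). Monogenic functions: $\mathcal{M}\bigl((K_j),(B_j)\bigr)$ is, as a set, the set of all functions $f$ defined on $\bigcup_j K_j$ such that for every $j\in\mathbb{N}$ the restriction $f_{|K_j}$ belongs to $\mathcal{C}^1_{\mathrm{hol}}(K_j,B_j)$ (it is a Fréchet space, as a projective limit of Banach spaces). Let $K'\subset K\subset\widehat{\mathbb{C}}$ and let $E$ be a linear space of (vector-valued) functions on $K$. A subset $\gamma\subset K$ is a uniqueness set for $E$ if the only function of $E$ vanishing identically on $\gamma$ is $f\equiv0$. $E$ is $\mathcal{H}^1$-quasianalytic relatively to $K'$ if every subset of $K'$ of positive $\mathcal{H}^1$-measure is a uniqueness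 set for $E$. $f$ admits the asymptotic expansion $(a_n)_{n\ge0}$ at a non-isolated point $q_0$ if for every $N\in\mathbb{N}$, $(q-q_0)^{-N}\bigl(f(q)-\sum_{n=0}^N a_n(q-q_0)^n\bigr)\to0$ as $q\to q_0$ in the domain of $f$ (coordinate $1/q$ if $q_0=\infty$); if each function of $E$ admits an asymptotic expansion at $q_0$, $E$ is quasianalytic at $q_0$ if the only function of $E$ with zero asymptotic expansion at $q_0$ is $f\equiv0$. At a point $q_0\in\operatorname{int}(K_j)$, a function of $\mathcal{M}((K_j),(B_j))$ is a $B_j$-valued holomorphic function near $q_0$ and the asymptotic expansion is its Taylor expansion. *)

theory Defs
  imports "HOL-Analysis.Analysis"
begin

section \<open>The Riemann sphere and its two charts\<close>

abbreviation riemann_sphere :: "complex option topology" where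
  "riemann_sphere \<equiv> Alexandroff_compactification euclidean"

text \<open>The coordinate at infinity is \<open>1/q\<close>; the map below is its inverse
  \<open>\<xi> \<mapsto> 1/\<xi>\<close>, defined on all of \<open>\<complex>\<close>. The usual chart is \<open>Some\<close>.\<close>

definition inv_chart :: "complex \<Rightarrow> complex option" where
  "inv_chart \<xi> = (if \<xi> = 0 then None else Some (1 / \<xi>))"


section \<open>One-dimensional Hausdorff outer measure\<close>

text \<open>Boundedness is required since \<open>diameter\<close> is unspecified on unbounded sets.\<close>

definition hausdorff1_premeasure :: "real \<Rightarrow> 'a::metric_space set \<Rightarrow> ennreal" where
  "hausdorff1_premeasure \<delta> A =
     Inf {(\<Sum>n. ennreal (diameter (U n))) | U :: nat \<Rightarrow> 'a set.
            A \<subseteq> (\<Union>n. U n) \<and> (\<forall>n. bounded (U n) \<and> diameter (U n) \<le> \<delta>)}"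

definition hausdorff1 :: "'a::metric_space set \<Rightarrow> ennreal" where
  "hausdorff1 A = (SUP \<delta>\<in>{0<..}. hausdorff1_premeasure \<delta> A)"

definition sphere_hausdorff1 :: "complex option set \<Rightarrow> ennreal" where
  "sphere_hausdorff1 A = hausdorff1 (Some -` A)"


section \<open>Nested pairs of Jordan curves\<close>

definition rectifiable_path :: "(real \<Rightarrow> 'a::metric_space) \<Rightarrow> bool" where
  "rectifiable_path g \<longleftrightarrow>
     path g \<and>
     (\<exists>L. \<forall>n. \<forall>t :: nat \<Rightarrow> real.
        (\<forall>i\<le>n. t i \<in> {0..1}) \<and> (\<forall>i<n. t i \<le> t (Suc i)) \<longrightarrow>
        (\<Sum>i<n. dist (g (t i)) (g (t (Suc i)))) \<le> L)"

definition jordan_curve :: "complex set \<Rightarrow> bool" where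
  "jordan_curve \<Gamma> \<longleftrightarrow>
     (\<exists>g. simple_path g \<and> pathfinish g = pathstart g \<and> path_image g = \<Gamma>)"

definition rectifiable_jordan_curve :: "complex set \<Rightarrow> bool" where
  "rectifiable_jordan_curve \<Gamma> \<longleftrightarrow>
     (\<exists>g. simple_path g \<and> pathfinish g = pathstart g \<and> path_image g = \<Gamma> \<and>
          rectifiable_path g)"

definition outer_component :: "complex set \<Rightarrow> complex option set" where
  "outer_component \<Gamma> =
     connected_component_of_set (subtopology riemann_sphere (- Some ` \<Gamma>)) None"

text \<open>Well defined when \<open>\<Gamma>\<close> is a Jordan curve, by the Jordan curve theorem.\<close>

definition inner_component :: "complex set \<Rightarrow> complex option set" where
  "inner_component \<Gamma> =
     (THE C. C \<in> connected_components_of (subtopology riemann_sphere (- Some ` \<Gamma>)) \<and>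
             None \<notin> C)"

definition nested_pair :: "complex set \<Rightarrow> complex set \<Rightarrow> bool" where
  "nested_pair \<Gamma>i \<Gamma>e \<longleftrightarrow>
     jordan_curve \<Gamma>i \<and> jordan_curve \<Gamma>e \<and>
     Some ` \<Gamma>i \<subseteq> riemann_sphere closure_of inner_component \<Gamma>e \<and>
     rectifiable_jordan_curve \<Gamma>i \<and> rectifiable_jordan_curve \<Gamma>e \<and>
     hausdorff1 (\<Gamma>i \<inter> \<Gamma>e) > 0"

definition nested_compact :: "complex set \<Rightarrow> complex set \<Rightarrow> complex option set" where
  "nested_compact \<Gamma>i \<Gamma>e =
     riemann_sphere closure_of inner_component \<Gamma>i \<union>
     riemann_sphere closure_of outer_component \<Gamma>e"


section \<open>Complex Banach spaces inside an ambient vector space\<close>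

text \<open>A space is given by its carrier \<open>B\<close> and its norm \<open>N\<close>, of which only the values on \<open>B\<close>
  matter. The metric is cut off outside \<open>B\<close> because the locale \<open>Metric_space\<close> asks for
  symmetry and nonnegativity on the whole type.\<close>

definition norm_dist :: "'b::ab_group_add set \<Rightarrow> ('b \<Rightarrow> real) \<Rightarrow> 'b \<Rightarrow> 'b \<Rightarrow> real" where
  "norm_dist B N x y = (if x \<in> B \<and> y \<in> B then N (x - y) else 0)"

abbreviation norm_topology :: "'b::ab_group_add set \<Rightarrow> ('b \<Rightarrow> real) \<Rightarrow> 'b topology" where
  "norm_topology B N \<equiv> Metric_space.mtopology B (norm_dist B N)"

definition complex_banach ::
  "(complex \<Rightarrow> 'b \<Rightarrow> 'b) \<Rightarrow> 'b::ab_group_add set \<Rightarrow> ('b \<Rightarrow> real) \<Rightarrow> bool" where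
  "complex_banach smul B N \<longleftrightarrow>
     module.subspace smul B \<and>
     (\<forall>x\<in>B. N x \<ge> 0) \<and>
     (\<forall>x\<in>B. N x = 0 \<longleftrightarrow> x = 0) \<and>
     (\<forall>c. \<forall>x\<in>B. N (smul c x) = cmod c * N x) \<and>
     (\<forall>x\<in>B. \<forall>y\<in>B. N (x + y) \<le> N x + N y) \<and>
     Metric_space.mcomplete B (norm_dist B N)"

lemma Metric_space_norm_dist:
  assumes "vector_space smul" and "complex_banach smul B N"
  shows "Metric_space B (norm_dist B N)"
proof -
  interpret vector_space smul by fact
  have sub: "subspace B" and nonneg: "\<And>x. x \<in> B \<Longrightarrow> N x \<ge> 0"
    and zero: "\<And>x. x \<in> B \<Longrightarrow> N x = 0 \<longleftrightarrow> x = 0"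
    and smul: "\<And>c x. x \<in> B \<Longrightarrow> N (smul c x) = cmod c * N x"
    and tri: "\<And>x y. x \<in> B \<Longrightarrow> y \<in> B \<Longrightarrow> N (x + y) \<le> N x + N y"
    using assms(2) by (auto simp: complex_banach_def)
  have diff: "x - y \<in> B" if "x \<in> B" "y \<in> B" for x y
    using sub that by (rule subspace_diff)
  show ?thesis
  proof
    fix x y
    show "0 \<le> norm_dist B N x y"
      by (simp add: norm_dist_def nonneg diff)
    show "norm_dist B N x y = norm_dist B N y x"
      using smul[of "x - y" "-1"] diff by (auto simp: norm_dist_def scale_minus_left)
  next
    fix x y assume "x \<in> B" "y \<in> B"
    then show "norm_dist B N x y = 0 \<longleftrightarrow> x = y"
      by (simp add: norm_dist_def zero diff)
  next
    fix x y z assume "x \<in> B" "y \<in> B" "z \<in> B"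
    then show "norm_dist B N x z \<le> norm_dist B N x y + norm_dist B N y z"
      using tri[of "x - y" "y - z"] by (simp add: norm_dist_def diff)
  qed
qed


section \<open>\<open>C\<^sup>1\<close>-holomorphic and monogenic functions\<close>

definition C1hol_in_chart ::
  "(complex \<Rightarrow> 'b \<Rightarrow> 'b) \<Rightarrow> 'b::ab_group_add set \<Rightarrow> ('b \<Rightarrow> real) \<Rightarrow>
   complex set \<Rightarrow> (complex \<Rightarrow> 'b) \<Rightarrow> bool" where
  "C1hol_in_chart smul B N S g \<longleftrightarrow>
     continuous_map (top_of_set S) (norm_topology B N) g \<and>
     (\<exists>g'. continuous_map (top_of_set S) (norm_topology B N) g' \<and>
        (\<forall>q\<in>S. \<forall>\<epsilon>>0. \<exists>\<delta>>0. \<forall>q1\<in>S. \<forall>q2\<in>S.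
           cmod (q1 - q) \<le> \<delta> \<and> cmod (q2 - q) \<le> \<delta> \<longrightarrow>
           N (g q2 - g q1 - smul (q2 - q1) (g' q)) \<le> \<epsilon> * cmod (q2 - q1)))"

text \<open>The condition is imposed in both charts. On the overlap the two conditions are equivalent,
  the two derivatives being related by the chain rule. Functions on \<open>K\<close> are represented by
  elements of \<open>extensional K\<close>.\<close>

definition C1hol ::
  "(complex \<Rightarrow> 'b \<Rightarrow> 'b) \<Rightarrow> complex option set \<Rightarrow> 'b::ab_group_add set \<Rightarrow> ('b \<Rightarrow> real) \<Rightarrow>
   (complex option \<Rightarrow> 'b) set" where
  "C1hol smul K B N =
     {f \<in> extensional K.
        C1hol_in_chart smul B N (Some -` K) (f \<circ> Some) \<and>
        C1hol_in_chart smul B N (inv_chart -` K) (f \<circ> inv_chart)}"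

definition monogenic ::
  "(complex \<Rightarrow> 'b \<Rightarrow> 'b) \<Rightarrow> (nat \<Rightarrow> complex option set) \<Rightarrow> (nat \<Rightarrow> 'b::ab_group_add set) \<Rightarrow>
   (nat \<Rightarrow> 'b \<Rightarrow> real) \<Rightarrow> (complex option \<Rightarrow> 'b) set" where
  "monogenic smul K B N =
     {f \<in> extensional (\<Union>j. K j). \<forall>j. restrict f (K j) \<in> C1hol smul (K j) (B j) (N j)}"


section \<open>Quasianalyticity\<close>

definition uniqueness_set ::
  "complex option set \<Rightarrow> (complex option \<Rightarrow> 'b::zero) set \<Rightarrow> complex option set \<Rightarrow> bool" where
  "uniqueness_set K E \<gamma> \<longleftrightarrow>
     \<gamma> \<subseteq> K \<and> (\<forall>f\<in>E. (\<forall>q\<in>\<gamma>. f q = 0) \<longrightarrow> (\<forall>q\<in>K. f q = 0))"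

definition H1_quasianalytic ::
  "complex option set \<Rightarrow> (complex option \<Rightarrow> 'b::zero) set \<Rightarrow> complex option set \<Rightarrow> bool" where
  "H1_quasianalytic K E K' \<longleftrightarrow>
     (\<forall>\<gamma>. \<gamma> \<subseteq> K' \<and> sphere_hausdorff1 \<gamma> > 0 \<longrightarrow> uniqueness_set K E \<gamma>)"

definition asymptotic_expansion_in_chart ::
  "(complex \<Rightarrow> 'b \<Rightarrow> 'b) \<Rightarrow> 'b::ab_group_add set \<Rightarrow> ('b \<Rightarrow> real) \<Rightarrow>
   complex set \<Rightarrow> (complex \<Rightarrow> 'b) \<Rightarrow> complex \<Rightarrow> (nat \<Rightarrow> 'b) \<Rightarrow> bool" where
  "asymptotic_expansion_in_chart smul B N S g z a \<longleftrightarrow>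
     z \<in> S \<and> z islimpt S \<and> (\<forall>n. a n \<in> B) \<and>
     (\<forall>M. limitin (norm_topology B N)
            (\<lambda>q. smul (inverse ((q - z) ^ M)) (g q - (\<Sum>n\<le>M. smul ((q - z) ^ n) (a n))))
            0 (at z within S))"

definition has_asymptotic_expansion ::
  "(complex \<Rightarrow> 'b \<Rightarrow> 'b) \<Rightarrow> 'b::ab_group_add set \<Rightarrow> ('b \<Rightarrow> real) \<Rightarrow>
   complex option set \<Rightarrow> (complex option \<Rightarrow> 'b) \<Rightarrow> complex option \<Rightarrow> (nat \<Rightarrow> 'b) \<Rightarrow> bool" where
  "has_asymptotic_expansion smul B N K f q0 a \<longleftrightarrow>
     (case q0 of
        Some z \<Rightarrow> asymptotic_expansion_in_chart smul B N (Some -` K) (f \<circ> Some) z a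
      | None \<Rightarrow> asymptotic_expansion_in_chart smul B N (inv_chart -` K) (f \<circ> inv_chart) 0 a)"

text \<open>Here \<open>B\<close> and \<open>N\<close> only need to control the functions near \<open>q0\<close>, not on all of \<open>K\<close>.\<close>

definition quasianalytic_at ::
  "(complex \<Rightarrow> 'b \<Rightarrow> 'b) \<Rightarrow> 'b::ab_group_add set \<Rightarrow> ('b \<Rightarrow> real) \<Rightarrow>
   complex option set \<Rightarrow> (complex option \<Rightarrow> 'b) set \<Rightarrow> complex option \<Rightarrow> bool" where
  "quasianalytic_at smul B N K E q0 \<longleftrightarrow>
     (\<forall>f\<in>E. \<exists>a. has_asymptotic_expansion smul B N K f q0 a) \<and>
     (\<forall>f\<in>E. has_asymptotic_expansion smul B N K f q0 (\<lambda>_. 0) \<longrightarrow> (\<forall>q\<in>K. f q = 0))"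

end

(* The heart of the matter is a boundary uniqueness theorem: a function continuous on the closure of a
   rectifiable Jordan domain D, holomorphic in D, and zero on a boundary set of positive length is zero.
   Take a conformal map \<Phi> from the unit disc onto D. Koebe's lemma yields, for every n, disjoint arcs
   ("spokes") from \<Phi>(0) to n boundary points, following n equidistant radii; the Jordan curve theorem forces
   their ends to lie on the boundary in cyclic order. Hence the sums of |\<Phi>(\<omega>\<^sup>k\<^sup>+\<^sup>1 z) - \<Phi>(\<omega>\<^sup>k z)|, with
   \<omega> = exp(2 \<pi> i / n), are bounded by a multiple of the length of the boundary, uniformly in n and z, and so
   the means of |\<Phi>'| over circles are bounded. Writing \<Phi>' = g\<^sup>2, the coefficients of g are square summable,
   which makes \<Phi>' uniformly integrable on circles. By Jensen's inequality a circle close to the boundary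
   spends little time, hence its image spends little length, where the given function is small; this
   forces the zero set to be of length zero. No boundary extension of \<Phi> is needed.

   An inversion transfers this to exterior domains, the Hahn-Banach theorem to Banach space values, and the
   common part of the two curves of a nested pair carries the zeros from one component to the other. *)
theory Submission
  imports Defs "HOL-Complex_Analysis.Complex_Analysis"
begin


section \<open>Sets of vanishing length\<close>

text \<open>The image of a radius is not known to land on the boundary, so a spoke leaves the radius
  near the circle and runs straight to a nearest boundary point. Only this last piece needs Koebe's
  lemma: a path that stays close to the circle while its image stays close to one point cannot turn
  by an angle h. With n spokes and h = pi / (4 n), neighbouring directions are 8 h apart, which
  leaves room for the deviations. As a spoke ends close to \<open>\<Phi> (r u)\<close>, chords
  between ends compare with chords of the image circle.

  A bound for the means of \<open>|\<Phi>'|\<close> alone would not suffice: the lengths of the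
  images could still concentrate on ever smaller sets of angles, exactly where the given function is
  small. Square summability of the coefficients of g excludes this, in the role that the theorem of
  F. and M. Riesz plays in the classical treatment.

  Since boundary values of \<open>\<Phi>\<close> are avoided, the final estimate works with one
  circle at a time. A finite family of disjoint balls centred in the zero set is fixed, and only
  then a radius r is taken so close to 1 that the image of its circle crosses all of them; the
  constants obtained before do not depend on r.\<close>

text \<open>Everything below uses the length only through its null sets, so the supremum and infimum
  of the definition are traded here, once and for all, for covers of small total diameter.\<close>

lemma hausdorff1_eq_0_iff:
  "hausdorff1 A = 0 \<longleftrightarrow>
     (\<forall>\<delta>>0. \<forall>\<epsilon>>0. \<exists>U :: nat \<Rightarrow> 'a::metric_space set. A \<subseteq> (\<Union>n. U n) \<and>
        (\<forall>n. bounded (U n) \<and> diameter (U n) \<le> \<delta>) \<and>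
        (\<Sum>n. ennreal (diameter (U n))) \<le> ennreal \<epsilon>)" (is "_ \<longleftrightarrow> ?R")
proof -
  have "hausdorff1 A = 0 \<longleftrightarrow> (\<forall>\<delta>>0. hausdorff1_premeasure \<delta> A = 0)"
    unfolding hausdorff1_def by (subst bot_ennreal[symmetric], subst SUP_bot_conv) (auto simp: bot_ennreal)
  moreover have "hausdorff1_premeasure \<delta> A = 0 \<longleftrightarrow>
    (\<forall>\<epsilon>>0. \<exists>U :: nat \<Rightarrow> 'a set. A \<subseteq> (\<Union>n. U n) \<and>
        (\<forall>n. bounded (U n) \<and> diameter (U n) \<le> \<delta>) \<and>
        (\<Sum>n. ennreal (diameter (U n))) \<le> ennreal \<epsilon>)" (is "_ \<longleftrightarrow> ?S") for \<delta>
  proof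
    assume *: "hausdorff1_premeasure \<delta> A = 0"
    show ?S
    proof (intro allI impI)
      fix \<epsilon> :: real assume "\<epsilon> > 0"
      then have "hausdorff1_premeasure \<delta> A < ennreal \<epsilon>" using * by simp
      then show "\<exists>U :: nat \<Rightarrow> 'a set. A \<subseteq> (\<Union>n. U n) \<and>
        (\<forall>n. bounded (U n) \<and> diameter (U n) \<le> \<delta>) \<and>
        (\<Sum>n. ennreal (diameter (U n))) \<le> ennreal \<epsilon>"
        unfolding hausdorff1_premeasure_def Inf_less_iff by (auto intro: less_imp_le)
    qed
  next
    assume S: ?S
    have "hausdorff1_premeasure \<delta> A \<le> 0 + ennreal e" if "e > 0" for e
    proof -
      obtain U :: "nat \<Rightarrow> 'a set" where U: "A \<subseteq> (\<Union>n. U n)"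
        "\<forall>n. bounded (U n) \<and> diameter (U n) \<le> \<delta>" "(\<Sum>n. ennreal (diameter (U n))) \<le> ennreal e"
        using S \<open>e > 0\<close> by blast
      have "hausdorff1_premeasure \<delta> A \<le> (\<Sum>n. ennreal (diameter (U n)))"
        unfolding hausdorff1_premeasure_def by (rule Inf_lower) (use U in blast)
      then show ?thesis using U(3) by simp
    qed
    then show "hausdorff1_premeasure \<delta> A = 0"
      using ennreal_le_epsilon[of 0 "hausdorff1_premeasure \<delta> A"] by auto
  qed
  ultimately show ?thesis by simp
qed

lemma diameter_le_metric:
  assumes "0 \<le> d" "\<And>x y. x \<in> S \<Longrightarrow> y \<in> S \<Longrightarrow> dist x y \<le> d"
  shows "diameter S \<le> d"
proof (cases "S = {}")
  case False
  then show ?thesis unfolding diameter_def using assms(2) by (auto intro!: cSUP_least)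
qed (use assms in auto)

lemma hausdorff1_null_subset:
  assumes "hausdorff1 B = 0" "A \<subseteq> B" shows "hausdorff1 A = 0"
  using assms unfolding hausdorff1_eq_0_iff by (meson subset_trans)

lemma hausdorff1_null_UN:
  fixes A :: "nat \<Rightarrow> 'a::metric_space set"
  assumes "\<And>n. hausdorff1 (A n) = 0"
  shows "hausdorff1 (\<Union>n. A n) = 0"
  unfolding hausdorff1_eq_0_iff
proof (intro allI impI)
  fix \<delta> \<epsilon> :: real assume "\<delta> > 0" "\<epsilon> > 0"
  have "\<exists>U :: nat \<Rightarrow> 'a set. A m \<subseteq> (\<Union>n. U n) \<and>
        (\<forall>n. bounded (U n) \<and> diameter (U n) \<le> \<delta>) \<and>
        (\<Sum>n. ennreal (diameter (U n))) \<le> ennreal (\<epsilon> * (1/2)^Suc m)" for m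
    using assms[of m] \<open>\<delta> > 0\<close> \<open>\<epsilon> > 0\<close> unfolding hausdorff1_eq_0_iff by simp
  then obtain U :: "nat \<Rightarrow> nat \<Rightarrow> 'a set" where U: "\<And>m. A m \<subseteq> (\<Union>n. U m n)"
    "\<And>m n. bounded (U m n) \<and> diameter (U m n) \<le> \<delta>"
    "\<And>m. (\<Sum>n. ennreal (diameter (U m n))) \<le> ennreal (\<epsilon> * (1/2)^Suc m)"
    by metis
  define V where "V n = case_prod U (prod_decode n)" for n
  have "(\<Sum>n. ennreal (diameter (V n))) = (\<integral>\<^sup>+n. ennreal (diameter (V n)) \<partial>count_space UNIV)"
    by (simp add: nn_integral_count_space_nat)
  also have "\<dots> = (\<integral>\<^sup>+x. ennreal (diameter (case_prod U x)) \<partial>count_space UNIV)"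
    using nn_integral_bij_count_space[OF bij_prod_decode, of "\<lambda>x. ennreal (diameter (case_prod U x))"]
    by (simp add: V_def)
  also have "\<dots> = (\<integral>\<^sup>+m. \<integral>\<^sup>+n. ennreal (diameter (U m n)) \<partial>count_space UNIV \<partial>count_space UNIV)"
    using nn_integral_fst_count_space[of "\<lambda>x. ennreal (diameter (case_prod U x))"] by simp
  also have "\<dots> = (\<Sum>m. \<Sum>n. ennreal (diameter (U m n)))"
    by (simp add: nn_integral_count_space_nat)
  also have "\<dots> \<le> (\<Sum>m. ennreal (\<epsilon> * (1/2)^Suc m))"
    by (intro suminf_le U(3) summableI)
  also have "\<dots> = ennreal (\<Sum>m. \<epsilon> * (1/2)^Suc m)"
    using \<open>\<epsilon> > 0\<close> by (intro suminf_ennreal2 summable_mult) (auto simp: power_half_series sums_summable)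
  also have "(\<Sum>m. \<epsilon> * (1/2)^Suc m) = \<epsilon>"
    using sums_mult[OF power_half_series, of \<epsilon>] by (simp add: sums_iff)
  finally have "(\<Sum>n. ennreal (diameter (V n))) \<le> ennreal \<epsilon>" .
  moreover have "(\<Union>m. A m) \<subseteq> (\<Union>n. V n)"
  proof
    fix x assume "x \<in> (\<Union>m. A m)"
    then obtain m n where "x \<in> U m n" using U(1) by blast
    then have "x \<in> V (prod_encode (m, n))" by (simp add: V_def)
    then show "x \<in> (\<Union>n. V n)" by (rule UN_I[OF UNIV_I])
  qed
  moreover have "bounded (V n) \<and> diameter (V n) \<le> \<delta>" for n
    using U(2) by (auto simp: V_def split: prod.split)
  ultimately show "\<exists>V :: nat \<Rightarrow> 'a set. (\<Union>m. A m) \<subseteq> (\<Union>n. V n) \<and>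
     (\<forall>n. bounded (V n) \<and> diameter (V n) \<le> \<delta>) \<and> (\<Sum>n. ennreal (diameter (V n))) \<le> ennreal \<epsilon>"
    by (intro exI[of _ V] conjI allI) auto
qed

lemma hausdorff1_null_Un:
  assumes "hausdorff1 A = 0" "hausdorff1 B = 0"
  shows "hausdorff1 (A \<union> B) = 0"
proof -
  have "A \<union> B = (\<Union>n::nat. if n = 0 then A else B)" by (auto split: if_splits)
  then show ?thesis using assms hausdorff1_null_UN[of "\<lambda>n::nat. if n = 0 then A else B"] by simp
qed

lemma hausdorff1_null_countable:
  fixes A :: "'a::metric_space set"
  assumes "countable A" shows "hausdorff1 A = 0"
proof (cases "A = {}")
  case True
  then show ?thesis by (auto simp: hausdorff1_eq_0_iff intro!: exI[of _ "\<lambda>_. {}"])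
next
  case False
  have "hausdorff1 {x} = 0" for x :: 'a
    unfolding hausdorff1_eq_0_iff by (intro allI impI exI[of _ "\<lambda>_. {x}"]) auto
  moreover have "A = (\<Union>n. {from_nat_into A n})"
    using range_from_nat_into[OF False assms] by blast
  ultimately show ?thesis using hausdorff1_null_UN[of "\<lambda>n. {from_nat_into A n}"] by simp
qed

lemma hausdorff1_null_lipschitz_image:
  fixes f :: "'a::metric_space \<Rightarrow> 'b::metric_space"
  assumes "hausdorff1 A = 0" and lip: "C-lipschitz_on A f"
  shows "hausdorff1 (f ` A) = 0"
  unfolding hausdorff1_eq_0_iff
proof (intro allI impI)
  fix \<delta> \<epsilon> :: real assume "\<delta> > 0" "\<epsilon> > 0"
  \<comment> \<open>The Lipschitz constant may be 0, and D is going to be a denominator.\<close>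
  define D where "D = C + 1"
  have D: "D > 0" "\<And>x y. x \<in> A \<Longrightarrow> y \<in> A \<Longrightarrow> dist (f x) (f y) \<le> D * dist x y"
  proof -
    fix x y assume "x \<in> A" "y \<in> A"
    then have "dist (f x) (f y) \<le> C * dist x y" by (rule lipschitz_onD[OF lip])
    also have "\<dots> \<le> D * dist x y" by (intro mult_right_mono) (auto simp: D_def)
    finally show "dist (f x) (f y) \<le> D * dist x y" .
  qed (use lipschitz_on_nonneg[OF lip] in \<open>auto simp: D_def\<close>)
  obtain U :: "nat \<Rightarrow> 'a set" where U: "A \<subseteq> (\<Union>n. U n)"
     "\<And>n. bounded (U n) \<and> diameter (U n) \<le> \<delta> / D"
     "(\<Sum>n. ennreal (diameter (U n))) \<le> ennreal (\<epsilon> / D)"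
    using assms(1)[unfolded hausdorff1_eq_0_iff, rule_format, of "\<delta> / D" "\<epsilon> / D"]
      \<open>\<delta> > 0\<close> \<open>\<epsilon> > 0\<close> D(1) by auto
  define V where "V n = f ` (A \<inter> U n)" for n
  have dV: "diameter (V n) \<le> D * diameter (U n) \<and> bounded (V n)" for n
  proof -
    have *: "dist x y \<le> D * diameter (U n)" if xy: "x \<in> V n" "y \<in> V n" for x y
    proof -
      obtain x' y' where *: "x = f x'" "y = f y'" "x' \<in> A \<inter> U n" "y' \<in> A \<inter> U n"
        using xy unfolding V_def by blast
      have "dist x y \<le> D * dist x' y'" using * D by auto
      also have "\<dots> \<le> D * diameter (U n)"
        using D * U(2) by (intro mult_left_mono diameter_bounded_bound) auto
      finally show ?thesis .
    qed
    have "0 \<le> diameter (U n)" using U(2) diameter_ge_0 by blast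
    then have "diameter (V n) \<le> D * diameter (U n)"
      using * D(1) by (intro diameter_le_metric) auto
    moreover have "bounded (V n)" using * by (auto simp: bounded_two_points)
    ultimately show ?thesis by blast
  qed
  have "(\<Sum>n. ennreal (diameter (V n))) \<le> (\<Sum>n. ennreal D * ennreal (diameter (U n)))"
    using dV D(1) U(2) by (intro suminf_le summableI) (auto simp: ennreal_mult' [symmetric] intro!: ennreal_leI)
  also have "\<dots> = ennreal D * (\<Sum>n. ennreal (diameter (U n)))"
    by (rule ennreal_suminf_cmult)
  also have "\<dots> \<le> ennreal D * ennreal (\<epsilon> / D)" by (intro mult_left_mono U) auto
  also have "\<dots> = ennreal \<epsilon>" using D(1) \<open>\<epsilon> > 0\<close> by (simp add: ennreal_mult'[symmetric])
  finally have s: "(\<Sum>n. ennreal (diameter (V n))) \<le> ennreal \<epsilon>" .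
  have V\<delta>: "diameter (V n) \<le> \<delta>" for n
  proof -
    have "diameter (V n) \<le> D * diameter (U n)" using dV by blast
    also have "\<dots> \<le> D * (\<delta> / D)" using U(2) D(1) by (intro mult_left_mono) auto
    finally show ?thesis using D(1) by simp
  qed
  have cov: "f ` A \<subseteq> (\<Union>n. V n)" unfolding V_def using U(1) by blast
  show "\<exists>V :: nat \<Rightarrow> 'b set. f ` A \<subseteq> (\<Union>n. V n) \<and>
     (\<forall>n. bounded (V n) \<and> diameter (V n) \<le> \<delta>) \<and> (\<Sum>n. ennreal (diameter (V n))) \<le> ennreal \<epsilon>"
    using dV s V\<delta> cov by blast
qed

text \<open>The real part is 1-Lipschitz, so a null open set would have a null projection to the
  line. That projection contains an interval, and Lebesgue measure bounds the total diameter of a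
  cover of an interval from below.\<close>

lemma hausdorff1_open_pos:
  fixes U :: "complex set"
  assumes "open U" "U \<noteq> {}"
  shows "hausdorff1 U > 0"
proof (rule ccontr)
  assume "\<not> hausdorff1 U > 0"
  then have "hausdorff1 U = 0" by simp
  moreover have "1-lipschitz_on U Re"
  proof (rule lipschitz_onI)
    fix x y :: complex
    show "dist (Re x) (Re y) \<le> 1 * dist x y"
      using abs_Re_le_cmod[of "x - y"] by (simp add: dist_norm)
  qed simp
  ultimately have null: "hausdorff1 (Re ` U) = 0" by (rule hausdorff1_null_lipschitz_image)
  obtain z e where e: "e > 0" "ball z e \<subseteq> U" using assms by (meson equals0I openE)
  have sub: "{Re z..<Re z + e} \<subseteq> Re ` U"
  proof
    fix x assume x: "x \<in> {Re z..<Re z + e}"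
    then have "Complex x (Im z) \<in> ball z e"
      by (simp add: dist_complex_def cmod_def)
    then show "x \<in> Re ` U" using e by (metis complex.sel(1) image_eqI subsetD)
  qed
  obtain V :: "nat \<Rightarrow> real set" where V: "Re ` U \<subseteq> (\<Union>n. V n)"
      "\<And>n. bounded (V n)" "(\<Sum>n. ennreal (diameter (V n))) \<le> ennreal (e/4)"
    using null[unfolded hausdorff1_eq_0_iff, rule_format, of 1 "e/4"] e(1) by auto
  \<comment> \<open>The sets \<open>V n\<close> may fail to be measurable, so each is replaced by an
    interval that contains it and whose length is its diameter; the infimum of the empty set is
    unspecified, hence the case distinction.\<close>
  define J where "J n = (if V n = {} then {} else {Inf (V n)..Inf (V n) + diameter (V n)})" for n
  have "V n \<subseteq> J n" for n
  proof
    fix x assume x: "x \<in> V n"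
    have "x - diameter (V n) \<le> Inf (V n)"
    proof (rule cInf_greatest)
      fix y assume "y \<in> V n"
      then show "x - diameter (V n) \<le> y" using diameter_bounded_bound[OF V(2) x \<open>y \<in> V n\<close>]
        by (simp add: dist_real_def)
    qed (use x in auto)
    moreover have "Inf (V n) \<le> x" using x V(2) by (simp add: bounded_imp_bdd_below cInf_lower)
    ultimately show "x \<in> J n" using x by (auto simp: J_def)
  qed
  then have "(\<Union>n. V n) \<subseteq> (\<Union>n. J n)" by (intro UN_mono) auto
  then have "{Re z..<Re z + e} \<subseteq> (\<Union>n. J n)" using sub V(1) by (meson subset_trans)
  then have "emeasure lborel {Re z..<Re z + e} \<le> emeasure lborel (\<Union>n. J n)"
    by (intro emeasure_mono) (auto simp: J_def)
  also have "\<dots> \<le> (\<Sum>n. emeasure lborel (J n))"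
    by (intro emeasure_subadditive_countably) (auto simp: J_def)
  also have "\<dots> \<le> (\<Sum>n. ennreal (diameter (V n)))"
    using V(2) by (intro suminf_le summableI) (auto simp: J_def diameter_ge_0)
  finally have "ennreal e \<le> (\<Sum>n. ennreal (diameter (V n)))" using e(1) by simp
  also note V(3)
  finally have "ennreal e \<le> ennreal (e/4)" .
  then show False using e(1) by (simp add: ennreal_le_iff)
qed

text \<open>The form in which covers arrive from the Vitali covering lemma: finitely many balls of
  one common radius. The diameters are at most twice the radius, so the criterion is applied with
  halved parameters.\<close>

lemma hausdorff1_null_if_ball_covers:
  fixes E :: "'a::metric_space set"
  assumes "\<And>\<delta> \<epsilon>. \<delta> > 0 \<Longrightarrow> \<epsilon> > 0 \<Longrightarrow>
     \<exists>F \<rho>. finite F \<and> 0 < \<rho> \<and> \<rho> \<le> \<delta> \<and> E \<subseteq> (\<Union>x\<in>F. cball x \<rho>) \<and> real (card F) * \<rho> \<le> \<epsilon>"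
  shows "hausdorff1 E = 0"
  unfolding hausdorff1_eq_0_iff
proof (intro allI impI)
  fix \<delta> \<epsilon> :: real assume "\<delta> > 0" "\<epsilon> > 0"
  then have "\<exists>F \<rho>. finite F \<and> 0 < \<rho> \<and> \<rho> \<le> \<delta>/2 \<and> E \<subseteq> (\<Union>x\<in>F. cball x \<rho>) \<and> real (card F) * \<rho> \<le> \<epsilon>/2"
    by (intro assms) auto
  then obtain F :: "'a set" and \<rho> where F: "finite F" "0 < \<rho>" "\<rho> \<le> \<delta>/2"
      "E \<subseteq> (\<Union>x\<in>F. cball x \<rho>)" "real (card F) * \<rho> \<le> \<epsilon>/2"
    by (elim exE conjE)
  obtain h where h: "bij_betw h {..<card F} F"
    using F(1) by (metis atLeast0LessThan ex_bij_betw_nat_finite)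
  define U where "U n = (if n < card F then cball (h n) \<rho> else {})" for n
  have dU: "diameter (U n) \<le> (if n < card F then 2*\<rho> else 0)" for n
  proof -
    have "dist x y \<le> 2 * \<rho>" if "x \<in> cball c \<rho>" "y \<in> cball c \<rho>" for x y c :: 'a
      using that dist_triangle[of x y c] by (auto simp: dist_commute)
    then show ?thesis using F(2) by (auto simp: U_def intro!: diameter_le_metric)
  qed
  have "E \<subseteq> (\<Union>n. U n)"
  proof
    fix x assume "x \<in> E"
    then obtain c where "c \<in> F" "x \<in> cball c \<rho>" using F by auto
    moreover have "c \<in> h ` {..<card F}" using bij_betw_imp_surj_on[OF h] \<open>c \<in> F\<close> by simp
    then obtain n where "n < card F" "h n = c" by auto
    ultimately have "x \<in> U n" by (simp add: U_def)
    then show "x \<in> (\<Union>n. U n)" by (rule UN_I[OF UNIV_I])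
  qed
  moreover have "bounded (U n) \<and> diameter (U n) \<le> \<delta>" for n
    using dU[of n] F(2,3) \<open>\<delta> > 0\<close> by (auto simp: U_def split: if_splits)
  moreover have "(\<Sum>n. ennreal (diameter (U n))) \<le> ennreal \<epsilon>"
  proof -
    have "(\<Sum>n. ennreal (diameter (U n))) = (\<Sum>n<card F. ennreal (diameter (U n)))"
      by (rule suminf_finite) (auto simp: U_def)
    also have "\<dots> \<le> (\<Sum>n<card F. ennreal (2*\<rho>))"
    proof (intro sum_mono ennreal_leI)
      fix n assume "n \<in> {..<card F}"
      then show "diameter (U n) \<le> 2*\<rho>" using dU[of n] by simp
    qed
    also have "\<dots> = ennreal (card F * (2*\<rho>))"
      using F(2) by (subst sum_ennreal) auto
    also have "\<dots> \<le> ennreal \<epsilon>" using F(5) by (intro ennreal_leI) auto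
    finally show ?thesis .
  qed
  ultimately show "\<exists>U :: nat \<Rightarrow> 'a set. E \<subseteq> (\<Union>n. U n) \<and>
     (\<forall>n. bounded (U n) \<and> diameter (U n) \<le> \<delta>) \<and> (\<Sum>n. ennreal (diameter (U n))) \<le> ennreal \<epsilon>"
    by (intro exI[of _ U] conjI allI) auto
qed

section \<open>Koebe's lemma\<close>

text \<open>The topological ingredient of Koebe's lemma: it shows that a curve running from the
  bottom to the top of a rectangle shields one vertical side from the other.\<close>

lemma fashoda_complex:
  fixes f g :: "real \<Rightarrow> complex"
  assumes "path f" "path g" "path_image f \<subseteq> cbox a b" "path_image g \<subseteq> cbox a b"
    and "Re (pathstart f) = Re a" "Re (pathfinish f) = Re b"
    and "Im (pathstart g) = Im a" "Im (pathfinish g) = Im b"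
  obtains z where "z \<in> path_image f" "z \<in> path_image g"
proof -
  define v :: "complex \<Rightarrow> real^2" where "v z = (\<chi> i. if i = 1 then Re z else Im z)" for z
  have v: "v z $ 1 = Re z" "v z $ 2 = Im z" for z by (auto simp: v_def)
  have inj: "v x = v y \<longleftrightarrow> x = y" for x y
    by (metis v complex_eq_iff)
  have cont: "continuous_on S v" for S
    unfolding v_def
  proof (rule continuous_on_vec_lambda)
    show "continuous_on S (\<lambda>z. if i = 1 then Re z else Im z)" for i :: 2
      by (cases "i = 1") (auto intro: continuous_intros)
  qed
  have box: "v ` cbox a b \<subseteq> cbox (v a) (v b)"
    by (auto simp: mem_box_cart in_cbox_complex_iff forall_2 v)
  have im: "path_image (v \<circ> p) = v ` path_image p" for p by (simp add: path_image_compose)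
  obtain z where z: "z \<in> path_image (v \<circ> f)" "z \<in> path_image (v \<circ> g)"
  proof (rule fashoda[of "v \<circ> f" "v \<circ> g" "v a" "v b"])
    show "path (v \<circ> f)" "path (v \<circ> g)" using assms(1,2) cont by (auto intro: path_continuous_image)
    show "path_image (v \<circ> f) \<subseteq> cbox (v a) (v b)" "path_image (v \<circ> g) \<subseteq> cbox (v a) (v b)"
      unfolding im using assms(3,4) box by (meson image_mono subset_trans)+
  qed (use assms(5-) in \<open>auto simp: pathstart_compose pathfinish_compose v\<close>)
  have "z \<in> v ` path_image f" "z \<in> v ` path_image g" using z by (simp_all only: im)
  then obtain x y where xy: "x \<in> path_image f" "y \<in> path_image g" "v x = v y" by (elim imageE) simp
  then have "x = y" using inj by simp
  with xy show ?thesis by (intro that[of x]) simp_all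
qed

lemma Re_eq_norm_times_cos_Arg: "Re z = cmod z * cos (Arg z)"
  by (subst rcis_cmod_Arg[of z, symmetric], subst Re_rcis) simp

lemma Re_complex_sinh: "Re (sinh z) = sinh (Re z) * cos (Im z)"
  by (simp add: sinh_field_def Re_exp left_diff_distrib)

text \<open>The function \<open>sinh (\<pi> (x + 1) / h) \<cdot> cos (\<pi> y / h)\<close>, which vanishes on three sides of the
  rectangle, bounds from below the harmonic measure of the curve crossing it.\<close>

lemma koebe_rectangle:
  fixes F :: "complex \<Rightarrow> complex" and \<tau> :: "real \<Rightarrow> complex"
  assumes hol: "F holomorphic_on {w. Re w < 0}" and M: "\<And>w. Re w < 0 \<Longrightarrow> cmod (F w) \<le> M"
    and \<tau>: "path \<tau>" "\<And>t. t \<in> {0..1} \<Longrightarrow> - 1/2 < Re (\<tau> t) \<and> Re (\<tau> t) < 0 \<and> cmod (F (\<tau> t)) \<le> \<eta>"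
    and h: "h > 0" "Im (\<tau> 0) = y0" "Im (\<tau> 1) = y0 + h" and s: "s \<ge> 0"
  shows "cmod (F (Complex (-1/2) (y0 + h/2))) \<le> max M (\<eta> * exp (s * sinh (pi/h))) * exp (- s * sinh (pi/(2*h)))"
proof -
  \<comment> \<open>Its real part is the harmonic function named above, with heights measured from
    the middle y0 + h/2 of the rectangle.\<close>
  define q where "q w = sinh (of_real (pi/h) * (w + 1 - \<i> * of_real (y0 + h/2)))" for w :: complex
  have Req: "Re (q w) = sinh (pi/h * (Re w + 1)) * cos (pi/h * (Im w - y0 - h/2))" for w
    by (simp add: q_def Re_complex_sinh diff_diff_eq)
  define w0 where "w0 = Complex (-1/2) (y0 + h/2)"
  define X where "X = path_image \<tau>"
  have X: "- 1/2 < Re z \<and> Re z < 0 \<and> cmod (F z) \<le> \<eta>" if "z \<in> X" for z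
    using that \<tau>(2) by (auto simp: X_def path_image_def)
  have "compact X" using \<tau>(1) by (simp add: X_def compact_path_image)
  moreover have "X \<noteq> {}" by (simp add: X_def)
  ultimately have "\<exists>m\<in>X. \<forall>z\<in>X. Re z \<le> Re m"
    by (intro continuous_attains_sup continuous_intros)
  then obtain m where m: "m \<in> X" "\<And>z. z \<in> X \<Longrightarrow> Re z \<le> Re m" by blast
  define xm where "xm = Re m"
  \<comment> \<open>The right side of the rectangle is placed strictly to the right of the curve,
    yet still inside the open half plane where F is bounded.\<close>
  define xR where "xR = xm / 2"
  have xm: "- 1/2 < xm" "xm < xR" "xR < 0" "\<And>z. z \<in> X \<Longrightarrow> Re z \<le> xm"
    using X[OF m(1)] m(2) by (auto simp: xR_def xm_def)
  define a where "a = Complex (-1) y0"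
  define b where "b = Complex xR (y0 + h)"
  define Q where "Q = connected_component_set (box a b - X) w0"
  have inbox: "z \<in> box a b \<longleftrightarrow> -1 < Re z \<and> Re z < xR \<and> y0 < Im z \<and> Im z < y0 + h" for z
    by (auto simp: a_def b_def in_box_complex_iff)
  have incbox: "z \<in> cbox a b \<longleftrightarrow> -1 \<le> Re z \<and> Re z \<le> xR \<and> y0 \<le> Im z \<and> Im z \<le> y0 + h" for z
    by (auto simp: a_def b_def in_cbox_complex_iff)
  have opn: "open (box a b - X)" by (intro open_Diff open_box compact_imp_closed \<open>compact X\<close>)
  have w0: "w0 \<in> box a b - X" using xm h(1) X[of w0] by (auto simp: inbox w0_def)
  have Q: "open Q" "connected Q" "w0 \<in> Q" "Q \<subseteq> box a b - X"
    using opn w0 by (auto simp: Q_def open_connected_component connected_component_subset intro: connected_component_refl)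
  have clQ: "closure Q \<subseteq> cbox a b"
    using Q(4) box_subset_cbox[of a b] by (intro closure_minimal) auto
  have front: "z \<in> X \<or> z \<in> cbox a b - box a b" if "z \<in> frontier Q" for z
  proof (rule ccontr)
    assume "\<not> ?thesis"
    moreover have zc: "z \<in> closure Q" "z \<notin> Q" using that Q(1) by (auto simp: frontier_def interior_open)
    ultimately have "z \<in> box a b - X" using clQ by auto
    then obtain e where e: "e > 0" "ball z e \<subseteq> box a b - X" using opn openE by blast
    obtain y where y: "y \<in> Q" "y \<in> ball z e"
      using zc(1)[unfolded closure_approachable, rule_format, OF e(1)] by (auto simp: dist_commute)
    have "ball z e \<subseteq> connected_component_set (box a b - X) y"
      by (rule connected_component_maximal) (use y e in auto)
    also have "\<dots> = Q" using connected_component_eq[of y "box a b - X" w0] y(1) unfolding Q_def by simp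
    finally have "ball z e \<subseteq> Q" .
    moreover have "z \<in> ball z e" using e(1) by simp
    ultimately show False using zc(2) by blast
  qed
  \<comment> \<open>The curve separates Q from the right side. Otherwise a path along the left half
    of the middle line to w0, then through Q, then horizontally to the right side would avoid the
    curve, against \<open>fashoda_complex\<close>.\<close>
  have right: "Re z \<noteq> xR" if "z \<in> frontier Q" "y0 < Im z" "Im z < y0 + h" for z
  proof
    assume "Re z = xR"
    have "z \<in> closure Q" using that by (simp add: frontier_def)
    \<comment> \<open>This distance puts p to the right of the whole curve, so that the last piece
      \<open>l2\<close> cannot meet it.\<close>
    then obtain p where p: "p \<in> Q" "dist p z < xR - xm"
      using xm(2) unfolding closure_approachable by (elim allE[of _ "xR - xm"]) auto
    have Rep: "Re p > xm" using p(2) \<open>Re z = xR\<close> abs_Re_le_cmod[of "p - z"] by (simp add: dist_norm)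
    obtain \<gamma> where \<gamma>: "path \<gamma>" "path_image \<gamma> \<subseteq> Q" "pathstart \<gamma> = w0" "pathfinish \<gamma> = p"
      using Q p(1) connected_open_path_connected[of Q] unfolding path_connected_def by blast
    define l1 where "l1 = linepath (Complex (-1) (y0 + h/2)) w0"
    define l2 where "l2 = linepath p (Complex xR (Im p))"
    define P where "P = l1 +++ \<gamma> +++ l2"
    \<comment> \<open>The curve may leave the strip of heights. Clamping its height brings it into
      the box, and every point changed in this way lies on a horizontal side, which P avoids; so a
      meeting point belongs to the original curve.\<close>
    define \<tau>' where "\<tau>' t = Complex (Re (\<tau> t)) (max y0 (min (y0 + h) (Im (\<tau> t))))" for t
    have pb: "p \<in> box a b" using p Q by blast
    have l1: "Re z \<le> -1/2 \<and> -1 \<le> Re z \<and> Im z = y0 + h/2" if "z \<in> path_image l1" for z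
    proof -
      have "z \<in> closed_segment (Complex (-1) (y0 + h/2)) w0" using that by (simp add: l1_def)
      then obtain u where u: "0 \<le> u" "u \<le> 1" "z = (1 - u) *\<^sub>R Complex (-1) (y0 + h/2) + u *\<^sub>R w0"
        unfolding closed_segment_def by blast
      have "Re z = -1 + u / 2" "Im z = y0 + h/2" unfolding u(3) w0_def by (simp_all add: algebra_simps)
      then show ?thesis using u by auto
    qed
    have l2: "Re p \<le> Re z \<and> Re z \<le> xR \<and> Im z = Im p" if "z \<in> path_image l2" for z
    proof -
      have "z \<in> closed_segment p (Complex xR (Im p))" using that by (simp add: l2_def)
      then obtain u where u: "0 \<le> u" "u \<le> 1" "z = (1 - u) *\<^sub>R p + u *\<^sub>R Complex xR (Im p)"
        unfolding closed_segment_def by blast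
      have "Re z = Re p + u * (xR - Re p)" "Im z = Im p" unfolding u(3) by (simp_all add: algebra_simps)
      moreover have "0 \<le> u * (xR - Re p)" "u * (xR - Re p) \<le> 1 * (xR - Re p)"
        using u pb inbox by (auto intro!: mult_nonneg_nonneg mult_right_mono)
      ultimately show ?thesis by auto
    qed
    have pP: "path P" "pathstart P = Complex (-1) (y0 + h/2)" "pathfinish P = Complex xR (Im p)"
      using \<gamma> by (auto simp: P_def l1_def l2_def)
    have imP: "path_image P = path_image l1 \<union> (path_image \<gamma> \<union> path_image l2)"
      unfolding P_def using \<gamma> by (simp add: path_image_join l1_def l2_def)
    have strip: "z \<in> cbox a b \<and> y0 < Im z \<and> Im z < y0 + h \<and> z \<notin> X" if "z \<in> path_image P" for z
      using that[unfolded imP]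
    proof (elim UnE)
      assume "z \<in> path_image l1"
      then show ?thesis using l1[of z] X[of z] h(1) xm by (auto simp: incbox)
    next
      assume "z \<in> path_image \<gamma>"
      then have "z \<in> box a b - X" using \<gamma>(2) Q(4) by blast
      then show ?thesis by (auto simp: incbox inbox)
    next
      assume "z \<in> path_image l2"
      then have *: "Re p \<le> Re z" "Re z \<le> xR" "Im z = Im p" using l2[of z] by auto
      then have "z \<notin> X" using xm(4)[of z] Rep by linarith
      then show ?thesis using * pb by (simp add: incbox inbox)
    qed
    have "path \<tau>'" using \<tau>(1) unfolding path_def \<tau>'_def Complex_eq
      by (intro continuous_intros)
    moreover have "path_image \<tau>' \<subseteq> cbox a b"
    proof
      fix z assume "z \<in> path_image \<tau>'"
      then obtain t where t: "t \<in> {0..1}" "z = \<tau>' t" by (auto simp: path_image_def)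
      have "\<tau> t \<in> X" using t(1) by (auto simp: X_def path_image_def)
      then have "- 1/2 < Re (\<tau> t)" "Re (\<tau> t) \<le> xm" using X xm by blast+
      then show "z \<in> cbox a b" using xm(2) h(1) unfolding t(2) incbox \<tau>'_def by (auto simp: min_def max_def)
    qed
    moreover have "Im (pathstart \<tau>') = Im a" "Im (pathfinish \<tau>') = Im b"
      using h by (simp_all add: pathstart_def pathfinish_def \<tau>'_def a_def b_def)
    moreover have "Re (pathstart P) = Re a" "Re (pathfinish P) = Re b"
      using pP by (simp_all add: a_def b_def)
    moreover have "path_image P \<subseteq> cbox a b" using strip by (intro subsetI) simp
    ultimately obtain z where z: "z \<in> path_image P" "z \<in> path_image \<tau>'"
      using pP(1) by (elim fashoda_complex[of P \<tau>' a b])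
    then obtain t where t: "t \<in> {0..1}" "z = \<tau>' t" by (auto simp: path_image_def)
    have "y0 < Im z" "Im z < y0 + h" "z \<notin> X" using strip[OF z(1)] by auto
    then have "z = \<tau> t" using t(2) by (auto simp: \<tau>'_def complex_eq_iff min_def max_def split: if_splits)
    then show False using t(1) \<open>z \<notin> X\<close> by (auto simp: X_def path_image_def)
  qed
  \<comment> \<open>The exponential has modulus 1 on the three sides where Re q vanishes, costs at
    most exp (s sinh (pi/h)) on the curve, where F is small, and gains exp (s sinh (pi/(2h))) at
    w0.\<close>
  define G where "G w = F w * exp (of_real s * q w)" for w
  have normG: "cmod (G w) = cmod (F w) * exp (s * Re (q w))" for w
    by (simp add: G_def norm_mult)
  have qhol: "q holomorphic_on UNIV"
    unfolding q_def sinh_def scaleR_conv_of_real by (intro holomorphic_intros)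
  have Ghol: "G holomorphic_on {w. Re w < 0}"
    unfolding G_def using hol holomorphic_on_subset[OF qhol] by (intro holomorphic_intros) auto
  have neg: "cbox a b \<subseteq> {w. Re w < 0}" using xm by (auto simp: incbox)
  have "cmod (F (-1)) \<le> M" by (rule M) simp
  then have "M \<ge> 0" using norm_ge_zero[of "F (-1)"] by linarith
  have "\<eta> \<ge> 0" using X[OF m(1)] norm_ge_zero[of "F m"] by linarith
  have K0: "sinh (pi/h) \<ge> 0" using h(1) by (simp add: sinh_real_nonneg_iff)
  have GB: "cmod (G w) \<le> max M (\<eta> * exp (s * sinh (pi/h)))" if "w \<in> frontier Q" for w
  proof -
    have wc: "w \<in> cbox a b" using that clQ by (auto simp: frontier_def)
    then have wr: "-1 \<le> Re w" "Re w \<le> xR" "y0 \<le> Im w" "Im w \<le> y0 + h" by (auto simp: incbox)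
    show ?thesis
    proof (cases "w \<in> X")
      case True
      have "sinh (pi/h * (Re w + 1)) \<le> sinh (pi/h)"
        using mult_left_le[of "Re w + 1" "pi/h"] h(1) wr xm by simp
      moreover have "0 \<le> sinh (pi/h * (Re w + 1))" using h(1) wr by (simp add: sinh_real_nonneg_iff)
      ultimately have "Re (q w) \<le> sinh (pi/h)"
        unfolding Req using cos_le_one[of "pi/h * (Im w - y0 - h/2)"]
        by (intro order_trans[OF mult_left_le])
      then have "cmod (F w) * exp (s * Re (q w)) \<le> \<eta> * exp (s * sinh (pi/h))"
        using X[OF True] \<open>\<eta> \<ge> 0\<close> s by (intro mult_mono) (auto intro: mult_left_mono)
      then show ?thesis unfolding normG by simp
    next
      case False
      then have "w \<notin> box a b" using front[OF that] by auto
      then have "Re w = -1 \<or> Im w = y0 \<or> Im w = y0 + h"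
        using right[OF that] wr by (simp add: inbox) linarith
      then have "Re (q w) = 0"
      proof (elim disjE)
        assume "Im w = y0"
        then have "pi/h * (Im w - y0 - h/2) = - (pi/2)" using h(1) by (simp add: field_simps)
        then show ?thesis unfolding Req by (simp only: cos_minus cos_pi_half mult_zero_right)
      next
        assume "Im w = y0 + h"
        then have "pi/h * (Im w - y0 - h/2) = pi/2" using h(1) by (simp add: field_simps)
        then show ?thesis unfolding Req by (simp only: cos_pi_half mult_zero_right)
      qed (simp add: Req)
      then show ?thesis unfolding normG using M[of w] wc neg by (auto simp: le_max_iff_disj)
    qed
  qed
  have "cmod (G w0) \<le> max M (\<eta> * exp (s * sinh (pi/h)))"
  proof (rule maximum_modulus_frontier[of G Q])
    show "G holomorphic_on interior Q"
      by (rule holomorphic_on_subset[OF Ghol]) (use Q neg box_subset_cbox interior_subset in blast)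
    show "continuous_on (closure Q) G"
      by (rule continuous_on_subset[OF holomorphic_on_imp_continuous_on[OF Ghol]]) (use clQ neg in blast)
    show "bounded Q" by (rule bounded_subset[OF bounded_box[of a b]]) (use Q in blast)
  qed (use GB Q in auto)
  moreover have "Re (q w0) = sinh (pi/(2*h))"
    unfolding Req w0_def by simp
  ultimately have "cmod (F w0) * exp (s * sinh (pi/(2*h))) \<le> max M (\<eta> * exp (s * sinh (pi/h)))"
    by (simp add: normG)
  then have "cmod (F w0) \<le> max M (\<eta> * exp (s * sinh (pi/h))) / exp (s * sinh (pi/(2*h)))"
    by (simp add: pos_le_divide_eq)
  then show ?thesis unfolding w0_def by (simp only: mult_minus_left exp_minus divide_inverse)
qed

text \<open>The substitution \<open>F w = \<Phi> (exp w) - a\<close> turns an arc near the circle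
  that turns by h into a curve crossing a rectangle of height h in the left half plane. The bound of
  \<open>koebe_rectangle\<close> on the line Re w = -1/2 then contradicts the lower bound d on the
  circle of radius exp (-1/2). Since \<open>\<eta>\<close> depends on M, d and h alone, one
  \<open>\<eta>\<close> serves all target points a.\<close>

lemma koebe_arc:
  fixes M d h :: real
  assumes "d > 0" "0 < h" "h < pi/2"
  obtains \<eta> where "\<eta> > 0" and
    "\<forall>\<Phi> a T. \<Phi> holomorphic_on ball 0 1 \<and> (\<forall>z\<in>ball 0 1. cmod (\<Phi> z - a) \<le> M) \<and> path T \<and>
       (\<forall>t\<in>{0..1}. 1 - \<eta> < cmod (T t) \<and> cmod (T t) < 1 \<and> cmod (\<Phi> (T t) - a) \<le> \<eta>) \<and>
       (\<forall>u. cmod u = exp (-1/2) \<longrightarrow> d \<le> cmod (\<Phi> u - a))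
     \<longrightarrow> (\<forall>t\<in>{0..1}. T t \<noteq> 0 \<and> \<bar>Arg (T t / T 0)\<bar> < h)"
proof -
  define \<kappa> where "\<kappa> = sinh (pi/(2*h))"
  define K where "K = sinh (pi/h)"
  have "\<kappa> > 0" using assms(2) by (simp add: \<kappa>_def)
  have "((\<lambda>s. max M 1 * exp (- s * \<kappa>)) \<longlongrightarrow> max M 1 * 0) at_top"
    by (intro tendsto_intros) (use \<open>\<kappa> > 0\<close> in real_asymp)
  then have "\<forall>\<^sub>F s in at_top. max M 1 * exp (- s * \<kappa>) < d"
    using assms(1) by (auto dest: order_tendstoD(2)[where a = d])
  then have "\<forall>\<^sub>F s in at_top. max M 1 * exp (- s * \<kappa>) < d \<and> 0 \<le> s"
    using eventually_ge_at_top[of "0::real"] by eventually_elim auto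
  \<comment> \<open>Now s is so large that the gain at the middle point beats d. After that
    \<open>\<eta>\<close> is made so small that the loss exp (s K) on the curve is absorbed; the
    term 1 - exp (-1/2) in \<open>\<eta>\<close> keeps the lifted curve to the right of Re w =
    -1/2.\<close>
  then obtain s where s: "max M 1 * exp (- s * \<kappa>) < d" "0 \<le> s" using eventually_happens by force
  define \<eta> where "\<eta> = min (exp (- s * K)) (1 - exp (-1/2))"
  have "exp (-1/2) < (1::real)" by simp
  then have \<eta>: "\<eta> > 0" "\<eta> \<le> 1 - exp (-1/2)" "\<eta> * exp (s * K) \<le> 1"
  proof -
    have "\<eta> * exp (s * K) \<le> exp (- s * K) * exp (s * K)"
      by (intro mult_right_mono) (auto simp: \<eta>_def)
    then show "\<eta> * exp (s * K) \<le> 1" by (simp add: exp_minus)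
  qed (use \<open>exp (-1/2) < (1::real)\<close> in \<open>auto simp: \<eta>_def\<close>)
  show ?thesis
  proof (rule that[OF \<eta>(1)], intro allI impI, elim conjE)
    fix \<Phi> :: "complex \<Rightarrow> complex" and a and T :: "real \<Rightarrow> complex"
    assume hol: "\<Phi> holomorphic_on ball 0 1" and M': "\<forall>z\<in>ball 0 1. cmod (\<Phi> z - a) \<le> M"
      and "path T"
      and T': "\<forall>t\<in>{0..1}. 1 - \<eta> < cmod (T t) \<and> cmod (T t) < 1 \<and> cmod (\<Phi> (T t) - a) \<le> \<eta>"
      and d': "\<forall>u. cmod u = exp (-1/2) \<longrightarrow> d \<le> cmod (\<Phi> u - a)"
    note M = M'[rule_format] and T = T'[rule_format] and d = d'[rule_format]
    have Tn: "exp (-1/2) < cmod (T t)" if "t \<in> {0..1}" for t using T[OF that] \<eta>(2) by linarith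
    then have T0: "T t \<noteq> 0" if "t \<in> {0..1}" for t using less_trans[OF exp_gt_zero Tn[OF that]] by simp
    define v where "v t = T t / T 0" for t
    have contv: "continuous_on {0..1} v"
      using \<open>path T\<close> T0[of 0] unfolding v_def path_def by (intro continuous_intros) auto
    have v0: "v t \<noteq> 0" if "t \<in> {0..1}" for t using T0 that by (auto simp: v_def)
    define F where "F w = \<Phi> (exp w) - a" for w
    \<comment> \<open>The time \<open>\<sigma>\<close> will be the first at which the angle reaches
      h. Up to then v avoids the cut of the principal logarithm, so \<open>\<tau>\<close> is a
      continuous lift of the arc under exp.\<close>
    have key: False if "\<sigma> \<in> {0..1}" "\<And>t. t \<in> {0..\<sigma>} \<Longrightarrow> v t \<notin> \<real>\<^sub>\<le>\<^sub>0" "\<bar>Arg (v \<sigma>)\<bar> = h" for \<sigma>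
    proof -
      define \<tau> where "\<tau> t = Ln (T 0) + Ln (v (\<sigma> * t))" for t
      have in01: "\<sigma> * t \<in> {0..\<sigma>}" "\<sigma> * t \<in> {0..1}" if "t \<in> {0..1}" for t
        using that \<open>\<sigma> \<in> {0..1}\<close> by (auto simp: mult_left_le mult_le_one)
      have e\<tau>: "exp (\<tau> t) = T (\<sigma> * t)" if "t \<in> {0..1}" for t
        using in01[OF that] T0[of 0] v0[of "\<sigma> * t"] by (simp add: \<tau>_def exp_add v_def)
      have cont: "continuous_on {0..1} (\<lambda>t. v (\<sigma> * t))"
        by (rule continuous_on_compose2[OF contv]) (use in01 in \<open>auto intro!: continuous_intros\<close>)
      have p\<tau>: "path \<tau>" unfolding path_def \<tau>_def
        by (intro continuous_intros continuous_on_Ln cont) (use in01 that(2) in auto)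
      have v00: "v 0 = 1" using T0[of 0] by (simp add: v_def)
      have Im0: "Im (\<tau> 0) = Arg (T 0)" using v00 T0[of 0] by (simp add: \<tau>_def Arg_eq_Im_Ln)
      have Im1: "Im (\<tau> 1) = Arg (T 0) + Arg (v \<sigma>)"
        using T0[of 0] v0[OF that(1)] by (simp add: \<tau>_def Arg_eq_Im_Ln)
      have Re\<tau>: "-1/2 < Re (\<tau> t) \<and> Re (\<tau> t) < 0 \<and> cmod (F (\<tau> t)) \<le> \<eta>" if "t \<in> {0..1}" for t
      proof -
        have "exp (Re (\<tau> t)) = cmod (T (\<sigma> * t))" using e\<tau>[OF that] by (metis norm_exp_eq_Re)
        then have "exp (-1/2) < exp (Re (\<tau> t))" "exp (Re (\<tau> t)) < exp 0"
          using T[OF in01(2)[OF that]] Tn[OF in01(2)[OF that]] by auto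
        then have "-1/2 < Re (\<tau> t)" "Re (\<tau> t) < 0" unfolding exp_less_cancel_iff by auto
        then show ?thesis using T[OF in01(2)[OF that]] by (auto simp: F_def e\<tau>[OF that])
      qed
      have expb: "exp w \<in> ball 0 1" if "Re w < 0" for w :: complex using that by simp
      have Fhol: "F holomorphic_on {w. Re w < 0}"
        unfolding F_def using expb
        by (intro holomorphic_intros holomorphic_on_compose_gen[OF _ hol, unfolded o_def]) auto
      have FM: "cmod (F w) \<le> M" if "Re w < 0" for w unfolding F_def by (intro M expb that)
      have Fd: "d \<le> cmod (F (Complex (-1/2) y))" for y
        unfolding F_def by (rule d) simp
      have "max M (\<eta> * exp (s * K)) \<le> max M 1" using \<eta>(3) by auto
      then have "max M (\<eta> * exp (s * K)) * exp (- s * \<kappa>) \<le> max M 1 * exp (- s * \<kappa>)"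
        by (intro mult_right_mono) simp_all
      also note s(1)
      finally have small: "max M (\<eta> * exp (s * K)) * exp (- s * \<kappa>) < d" .
      have "Arg (v \<sigma>) = h \<or> Arg (v \<sigma>) = - h" using that(3) by auto
      then show False
      proof
        assume *: "Arg (v \<sigma>) = h"
        have "cmod (F (Complex (-1/2) (Arg (T 0) + h/2))) \<le> max M (\<eta> * exp (s * K)) * exp (- s * \<kappa>)"
          unfolding K_def \<kappa>_def
          by (rule koebe_rectangle[OF Fhol FM p\<tau> Re\<tau> assms(2) Im0 _ s(2)]) (use Im1 * in simp_all)
        then show False using small Fd[of "Arg (T 0) + h/2"] by linarith
      next
        \<comment> \<open>If the arc turns clockwise, the reversed lift climbs from Arg (T 0) - h to
          Arg (T 0).\<close>
        assume *: "Arg (v \<sigma>) = - h"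
        have "cmod (F (Complex (-1/2) ((Arg (T 0) - h) + h/2))) \<le> max M (\<eta> * exp (s * K)) * exp (- s * \<kappa>)"
          unfolding K_def \<kappa>_def
        proof (rule koebe_rectangle[OF Fhol FM _ _ assms(2) _ _ s(2), of "reversepath \<tau>"])
          show "-1/2 < Re (reversepath \<tau> t) \<and> Re (reversepath \<tau> t) < 0 \<and> cmod (F (reversepath \<tau> t)) \<le> \<eta>"
            if "t \<in> {0..1}" for t using Re\<tau>[of "1 - t"] that by (auto simp: reversepath_def)
          show "path (reversepath \<tau>)" using p\<tau> by simp
        qed (use Im0 Im1 * in \<open>auto simp: reversepath_def\<close>)
        then show False using small Fd[of "Arg (T 0) - h + h/2"] by linarith
      qed
    qed
    have Re_pos: "v t \<notin> \<real>\<^sub>\<le>\<^sub>0" if "t \<in> {0..1}" "\<bar>Arg (v t)\<bar> \<le> h" for t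
    proof
      assume "v t \<in> \<real>\<^sub>\<le>\<^sub>0"
      moreover have "Re (v t) = cmod (v t) * cos (Arg (v t))" by (rule Re_eq_norm_times_cos_Arg)
      moreover have "cos (Arg (v t)) > 0" using that(2) assms(3) by (intro cos_gt_zero_pi) auto
      ultimately show False using v0[OF that(1)] by (auto simp: complex_nonpos_Reals_iff zero_less_mult_iff not_less [symmetric])
    qed
    show "\<forall>t\<in>{0..1}. T t \<noteq> 0 \<and> \<bar>Arg (T t / T 0)\<bar> < h"
    proof (rule ccontr)
      assume "\<not> ?thesis"
      then obtain t1 where t1: "t1 \<in> {0..1}" "h \<le> \<bar>Arg (v t1)\<bar>" using T0 by (auto simp: v_def not_less)
      \<comment> \<open>Arg jumps on the negative axis, so the intermediate value theorem is applied
        to this continuous function instead; its sign compares \<open>|Arg (v t)|\<close> with h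
        because cos decreases on [0, pi].\<close>
      define g where "g t = Re (v t) - cmod (v t) * cos h" for t
      have g_eq: "g t = cmod (v t) * (cos \<bar>Arg (v t)\<bar> - cos h)" if "t \<in> {0..1}" for t
        by (simp add: g_def Re_eq_norm_times_cos_Arg[of "v t"] algebra_simps)
      have Arg_pi: "\<bar>Arg z\<bar> \<le> pi" for z using Arg_bounded[of z] by auto
      have g0: "g t \<ge> 0 \<longleftrightarrow> \<bar>Arg (v t)\<bar> \<le> h" "g t \<le> 0 \<longleftrightarrow> h \<le> \<bar>Arg (v t)\<bar>" if "t \<in> {0..1}" for t
      proof -
        have "cmod (v t) > 0" using v0[OF that] by simp
        then have "g t \<ge> 0 \<longleftrightarrow> cos h \<le> cos \<bar>Arg (v t)\<bar>" "g t \<le> 0 \<longleftrightarrow> cos \<bar>Arg (v t)\<bar> \<le> cos h"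
          unfolding g_eq[OF that] by (simp_all add: zero_le_mult_iff mult_le_0_iff)
        moreover have "cos h \<le> cos \<bar>Arg (v t)\<bar> \<longleftrightarrow> \<bar>Arg (v t)\<bar> \<le> h"
          "cos \<bar>Arg (v t)\<bar> \<le> cos h \<longleftrightarrow> h \<le> \<bar>Arg (v t)\<bar>"
          by (rule cos_mono_le_eq; use assms(2,3) Arg_pi[of "v t"] in linarith)+
        ultimately show "g t \<ge> 0 \<longleftrightarrow> \<bar>Arg (v t)\<bar> \<le> h" "g t \<le> 0 \<longleftrightarrow> h \<le> \<bar>Arg (v t)\<bar>"
          by simp_all
      qed
      have contg: "continuous_on {0..1} g" unfolding g_def by (intro continuous_intros contv)
      have "g 0 \<ge> 0" using T0[of 0] assms(2) by (subst g0(1)) (auto simp: v_def)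
      have zero: "\<exists>s\<in>{0..t}. g s = 0" if "t \<in> {0..1}" "g t \<le> 0" for t
        using IVT2'[of g t 0 0] that \<open>g 0 \<ge> 0\<close> continuous_on_subset[OF contg, of "{0..t}"] by auto
      define Z where "Z = {t \<in> {0..1}. g t = 0}"
      have "compact Z" unfolding Z_def
      proof -
        have "closed {t \<in> {0..1}. g t = 0}"
          by (rule continuous_closed_preimage_constant[OF contg]) simp
        moreover have "bounded {t \<in> {0..1::real}. g t = 0}" by (rule bounded_subset[of "{0..1}"]) auto
        ultimately show "compact {t \<in> {0..1}. g t = 0}" using compact_eq_bounded_closed by blast
      qed
      moreover have "Z \<noteq> {}" using zero[OF t1(1)] t1 g0(2)[OF t1(1)] by (fastforce simp: Z_def)
      ultimately have "\<exists>\<sigma>\<in>Z. \<forall>t\<in>Z. \<sigma> \<le> t" by (rule compact_attains_inf)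
      then obtain \<sigma> where \<sigma>: "\<sigma> \<in> Z" "\<And>t. t \<in> Z \<Longrightarrow> \<sigma> \<le> t" by blast
      have \<sigma>1: "\<sigma> \<in> {0..1}" "g \<sigma> = 0" using \<sigma>(1) by (auto simp: Z_def)
      have pos: "g t \<ge> 0" if "t \<in> {0..\<sigma>}" for t
      proof (rule ccontr)
        assume "\<not> g t \<ge> 0"
        moreover have t01: "t \<in> {0..1}" using that \<sigma>1 by auto
        ultimately obtain s where "s \<in> {0..t}" "g s = 0" using zero[of t] by auto
        moreover then have "\<sigma> \<le> s" using \<sigma>(2)[of s] t01 by (auto simp: Z_def)
        ultimately have "t = \<sigma>" using that by auto
        then show False using \<sigma>1 \<open>\<not> g t \<ge> 0\<close> by simp
      qed
      show False
      proof (rule key[OF \<sigma>1(1)])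
        show "v t \<notin> \<real>\<^sub>\<le>\<^sub>0" if "t \<in> {0..\<sigma>}" for t
          using Re_pos[of t] pos[OF that] g0(1)[of t] that \<sigma>1(1) by auto
        show "\<bar>Arg (v \<sigma>)\<bar> = h" using g0[OF \<sigma>1(1)] \<sigma>1(2) by auto
      qed
    qed
  qed
qed

section \<open>Conformal maps onto Jordan domains\<close>

locale jordan_conformal =
  fixes g :: "real \<Rightarrow> complex" and \<Phi> \<Psi> :: "complex \<Rightarrow> complex"
  assumes simple: "simple_path g" and loop: "pathfinish g = pathstart g"
    and hol\<Phi>: "\<Phi> holomorphic_on ball 0 1"
    and hol\<Psi>: "\<Psi> holomorphic_on inside (path_image g)"
    and \<Phi>_in: "\<And>z. z \<in> ball 0 1 \<Longrightarrow> \<Phi> z \<in> inside (path_image g)"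
    and \<Psi>\<Phi>: "\<And>z. z \<in> ball 0 1 \<Longrightarrow> \<Psi> (\<Phi> z) = z"
    and \<Psi>_in: "\<And>w. w \<in> inside (path_image g) \<Longrightarrow> \<Psi> w \<in> ball 0 1"
    and \<Phi>\<Psi>: "\<And>w. w \<in> inside (path_image g) \<Longrightarrow> \<Phi> (\<Psi> w) = w"
begin

abbreviation \<Gamma> where "\<Gamma> \<equiv> path_image g"
abbreviation D where "D \<equiv> inside (path_image g)"

lemma D_props: "open D" "connected D" "bounded D" "D \<noteq> {}" "frontier D = \<Gamma>" "D \<inter> \<Gamma> = {}"
  "closure D = D \<union> \<Gamma>" "compact \<Gamma>" "\<Gamma> \<noteq> {}"
proof -
  show 1: "open D" "connected D" "bounded D" "D \<noteq> {}" "frontier D = \<Gamma>"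
    using Jordan_inside_outside[OF simple loop] by simp_all
  show "D \<inter> \<Gamma> = {}" by (rule inside_no_overlap)
  show "closure D = D \<union> \<Gamma>" using closure_Un_frontier[of D] 1(5) by simp
  show "compact \<Gamma>" using simple by (simp add: compact_simple_path_image)
  show "\<Gamma> \<noteq> {}" by simp
qed

lemma cont\<Phi>: "continuous_on (ball 0 1) \<Phi>" and cont\<Psi>: "continuous_on D \<Psi>"
  using hol\<Phi> hol\<Psi> holomorphic_on_imp_continuous_on by blast+

lemma inj\<Phi>: "inj_on \<Phi> (ball 0 1)" by (metis inj_onI \<Psi>\<Phi>)

text \<open>A smaller closed disc has a compact image, which keeps a positive distance from
  \<open>\<Gamma>\<close>. Together with \<open>near_boundary\<close>, the same argument for the
  inverse map, this is properness of \<open>\<Phi>\<close>, the substitute for boundary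
  values.\<close>

lemma near_circle:
  assumes "r < 1"
  obtains \<delta> where "\<delta> > 0" "\<And>w. w \<in> D \<Longrightarrow> infdist w \<Gamma> < \<delta> \<Longrightarrow> r < cmod (\<Psi> w)"
proof -
  have sub: "cball 0 r \<subseteq> ball (0::complex) 1" using assms by auto
  have "compact (\<Phi> ` cball 0 r)"
    by (intro compact_continuous_image continuous_on_subset[OF cont\<Phi> sub] compact_cball)
  moreover have "\<Phi> ` cball 0 r \<inter> \<Gamma> = {}" using \<Phi>_in D_props(6) sub by blast
  ultimately obtain d where d: "d > 0" "\<And>x y. x \<in> \<Phi> ` cball 0 r \<Longrightarrow> y \<in> \<Gamma> \<Longrightarrow> d \<le> dist x y"
    using separate_compact_closed[of "\<Phi> ` cball 0 r" \<Gamma>] compact_imp_closed[OF D_props(8)] by blast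
  show ?thesis
  proof (rule that[OF d(1)])
    fix w assume w: "w \<in> D" "infdist w \<Gamma> < d"
    show "r < cmod (\<Psi> w)"
    proof (rule ccontr)
      assume "\<not> r < cmod (\<Psi> w)"
      then have "w \<in> \<Phi> ` cball 0 r" using \<Phi>\<Psi>[OF w(1)] by (intro image_eqI[of _ _ "\<Psi> w"]) auto
      then have "d \<le> infdist w \<Gamma>"
        using d(2) D_props(9) unfolding infdist_def by (auto intro: cINF_greatest)
      then show False using w(2) by simp
    qed
  qed
qed

lemma compact_image_in_ball:
  assumes "compact X" "X \<subseteq> D"
  obtains R where "R < 1" "\<And>z. z \<in> ball 0 1 \<Longrightarrow> R < cmod z \<Longrightarrow> \<Phi> z \<notin> X"
proof (cases "X = {}")
  case True
  then show ?thesis by (intro that[of 0]) auto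
next
  case False
  have "compact (\<Psi> ` X)"
    by (intro compact_continuous_image continuous_on_subset[OF cont\<Psi> assms(2)] assms)
  then have "\<exists>m\<in>\<Psi> ` X. \<forall>u\<in>\<Psi> ` X. cmod u \<le> cmod m"
    using False by (intro continuous_attains_sup continuous_intros) auto
  then obtain m where m: "m \<in> \<Psi> ` X" "\<And>u. u \<in> \<Psi> ` X \<Longrightarrow> cmod u \<le> cmod m" by blast
  show ?thesis
  proof (rule that)
    show "cmod m < 1" using m(1) \<Psi>_in assms(2) by auto
    fix z assume z: "z \<in> ball 0 1" "cmod m < cmod z"
    show "\<Phi> z \<notin> X"
    proof
      assume "\<Phi> z \<in> X"
      then have "cmod z \<le> cmod m" using m(2)[OF imageI[of "\<Phi> z" X \<Psi>]] \<Psi>\<Phi>[OF z(1)] by simp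
      then show False using z(2) by simp
    qed
  qed
qed

lemma near_boundary:
  assumes "\<delta> > 0"
  obtains R where "R < 1" "\<And>z. R < cmod z \<Longrightarrow> cmod z < 1 \<Longrightarrow> infdist (\<Phi> z) \<Gamma> < \<delta>"
proof -
  define X where "X = closure D \<inter> {w. \<delta> \<le> infdist w \<Gamma>}"
  have "compact X" unfolding X_def
    by (intro compact_Int_closed compact_closure[THEN iffD2] D_props closed_Collect_le continuous_intros)
  moreover have "X \<subseteq> D" using assms unfolding X_def D_props(7) by auto
  ultimately obtain R where R: "R < 1" "\<And>z. z \<in> ball 0 1 \<Longrightarrow> R < cmod z \<Longrightarrow> \<Phi> z \<notin> X"
    by (rule compact_image_in_ball) (rule that)
  show ?thesis
  proof (rule that[OF R(1)])
    fix z :: complex assume z: "R < cmod z" "cmod z < 1"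
    then have "\<Phi> z \<notin> X" "\<Phi> z \<in> D" using R(2) \<Phi>_in by auto
    then show "infdist (\<Phi> z) \<Gamma> < \<delta>" using closure_subset[of D] by (auto simp: X_def)
  qed
qed

text \<open>The lower bound demanded by \<open>koebe_arc\<close> holds for all admissible a at once.
  The image of the circle of radius exp (-1/2) keeps a distance d from \<open>\<Gamma>\<close>,
  whereas a is within d/3 of \<open>\<Phi> (T 0)\<close>, which is within d/3 of
  \<open>\<Gamma>\<close>; this leaves d/3. The bound 2b + 1 arises because a is within 1/2 of a
  point of D, and D lies in the disc of radius b.\<close>

lemma small_angle:
  assumes "0 < h" "h < pi/2"
  obtains \<eta> where "0 < \<eta>" "\<eta> \<le> 1/2" "\<forall>T a. path T \<and>
     (\<forall>t\<in>{0..1}. 1 - \<eta> < cmod (T t) \<and> cmod (T t) < 1 \<and> dist (\<Phi> (T t)) a \<le> \<eta>)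
     \<longrightarrow> (\<forall>t\<in>{0..1}. T t \<noteq> 0 \<and> \<bar>Arg (T t / T 0)\<bar> < h)"
proof -
  obtain b where b: "\<And>w. w \<in> D \<Longrightarrow> cmod w \<le> b" using D_props(3) by (auto simp: bounded_iff)
  define S where "S = \<Phi> ` sphere 0 (exp (-1/2))"
  have sub: "sphere 0 (exp (-1/2)) \<subseteq> ball (0::complex) 1" by auto
  have "compact S" unfolding S_def
    by (intro compact_continuous_image continuous_on_subset[OF cont\<Phi> sub] compact_sphere)
  moreover have "S \<inter> \<Gamma> = {}" using \<Phi>_in D_props(6) sub unfolding S_def by blast
  ultimately obtain d where d: "d > 0" "\<And>x y. x \<in> S \<Longrightarrow> y \<in> \<Gamma> \<Longrightarrow> d \<le> dist x y"
    using separate_compact_closed[of S \<Gamma>] compact_imp_closed[OF D_props(8)] by blast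
  obtain \<eta>1 where \<eta>1: "\<eta>1 > 0"
    "\<forall>\<Phi> a T. \<Phi> holomorphic_on ball 0 1 \<and> (\<forall>z\<in>ball 0 1. cmod (\<Phi> z - a) \<le> 2*b+1) \<and> path T \<and>
       (\<forall>t\<in>{0..1}. 1 - \<eta>1 < cmod (T t) \<and> cmod (T t) < 1 \<and> cmod (\<Phi> (T t) - a) \<le> \<eta>1) \<and>
       (\<forall>u. cmod u = exp (-1/2) \<longrightarrow> d/3 \<le> cmod (\<Phi> u - a))
     \<longrightarrow> (\<forall>t\<in>{0..1}. T t \<noteq> 0 \<and> \<bar>Arg (T t / T 0)\<bar> < h)"
  proof (rule koebe_arc[of "d/3" h "2*b+1"])
    show "d/3 > 0" "0 < h" "h < pi/2" using d(1) assms by auto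
  qed (rule that)
  obtain R where R: "R < 1" "\<And>z. R < cmod z \<Longrightarrow> cmod z < 1 \<Longrightarrow> infdist (\<Phi> z) \<Gamma> < d/3"
  proof (rule near_boundary[of "d/3"])
    show "d/3 > 0" using d(1) by simp
  qed (rule that)
  define \<eta> where "\<eta> = min (min \<eta>1 (1/2)) (min (d/3) (1 - R))"
  have \<eta>: "0 < \<eta>" "\<eta> \<le> \<eta>1" "\<eta> \<le> 1/2" "\<eta> \<le> d/3" "\<eta> \<le> 1 - R"
    using \<eta>1(1) d(1) R(1) unfolding \<eta>_def by linarith+
  show ?thesis
  proof (rule that[OF \<eta>(1,3)], intro allI impI, elim conjE)
    fix T a assume "path T"
      and T': "\<forall>t\<in>{0..1}. 1 - \<eta> < cmod (T t) \<and> cmod (T t) < 1 \<and> dist (\<Phi> (T t)) a \<le> \<eta>"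
    note T = \<open>path T\<close> T'[rule_format]
    have T0: "1 - \<eta> < cmod (T 0)" "cmod (T 0) < 1" "dist (\<Phi> (T 0)) a \<le> \<eta>" using T(2)[of 0] by auto
    have "cmod (\<Phi> z - a) \<le> 2*b+1" if "z \<in> ball 0 1" for z
    proof -
      have "cmod (\<Phi> z) \<le> b" "cmod (\<Phi> (T 0)) \<le> b" using b \<Phi>_in that T0 by auto
      moreover have "cmod (\<Phi> z - a) \<le> cmod (\<Phi> z) + cmod (\<Phi> (T 0)) + cmod (\<Phi> (T 0) - a)"
        using norm_triangle_ineq4[of "\<Phi> z" "\<Phi> (T 0)"] norm_triangle_ineq[of "\<Phi> z - \<Phi> (T 0)" "\<Phi> (T 0) - a"] by simp
      ultimately show "cmod (\<Phi> z - a) \<le> 2*b+1" using T0(3) \<eta>(3) by (simp add: dist_norm)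
    qed
    moreover have "1 - \<eta>1 < cmod (T t) \<and> cmod (T t) < 1 \<and> cmod (\<Phi> (T t) - a) \<le> \<eta>1" if "t \<in> {0..1}" for t
      using T(2)[OF that] \<eta>(2) by (auto simp: dist_norm)
    moreover have "d/3 \<le> cmod (\<Phi> u - a)" if "cmod u = exp (-1/2)" for u
    proof -
      have "\<Phi> u \<in> S" using that by (simp add: S_def)
      have "infdist (\<Phi> (T 0)) \<Gamma> < d/3" using R(2)[OF _ T0(2)] T0(1) \<eta>(5) by simp
      moreover obtain y where y: "y \<in> \<Gamma>" "infdist (\<Phi> (T 0)) \<Gamma> = dist (\<Phi> (T 0)) y"
        by (rule infdist_attains_inf[OF compact_imp_closed[OF D_props(8)] D_props(9), of "\<Phi> (T 0)"]) (rule that)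
      ultimately have y2: "dist (\<Phi> (T 0)) y < d/3" by simp
      have "d \<le> dist (\<Phi> u) y" using d(2)[OF \<open>\<Phi> u \<in> S\<close> y(1)] .
      also have "\<dots> \<le> dist (\<Phi> u) a + dist (\<Phi> (T 0)) a + dist (\<Phi> (T 0)) y"
        using dist_triangle[of "\<Phi> u" y a] dist_triangle3[of a y "\<Phi> (T 0)"] by (simp add: dist_commute)
      finally show "d/3 \<le> cmod (\<Phi> u - a)" using T0(3) \<eta>(4) y2 by (simp add: dist_norm)
    qed
    ultimately show "\<forall>t\<in>{0..1}. T t \<noteq> 0 \<and> \<bar>Arg (T t / T 0)\<bar> < h"
      using \<eta>1(2)[THEN spec, THEN spec, THEN spec, of \<Phi> a T, THEN mp] hol\<Phi> T(1) by simp
  qed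
qed

text \<open>A spoke is an arc in \<open>D\<close> from \<open>\<Phi> 0\<close> to a boundary point, whose preimage in the disc follows the
  radius of direction \<open>u\<close> up to modulus \<open>1/2\<close> and stays in the sector of half-angle \<open>h\<close> after that.\<close>

definition spoke :: "real \<Rightarrow> complex \<Rightarrow> (real \<Rightarrow> complex) \<Rightarrow> bool" where
  "spoke h u q \<longleftrightarrow> arc q \<and> pathstart q = \<Phi> 0 \<and> pathfinish q \<in> \<Gamma> \<and> path_image q - {pathfinish q} \<subseteq> D \<and>
     (\<forall>w\<in>path_image q - {pathfinish q}. (\<Psi> w = 0 \<or> \<bar>Arg (\<Psi> w / u)\<bar> < h) \<and>
        (cmod (\<Psi> w) < 1/2 \<longrightarrow> (\<exists>t\<ge>0. \<Psi> w = of_real t * u))) \<and>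
     (\<forall>t. 0 \<le> t \<and> t < 1/2 \<longrightarrow> \<Phi> (of_real t * u) \<in> path_image q)"

text \<open>The spoke follows the image of the radius until it first hits the segment from
  \<open>p = \<Phi> (r u)\<close> to a nearest boundary point c, and then the segment. Along the
  segment the preimage is close to the circle and the image is within \<open>\<eta>\<close> of c,
  which is the situation of \<open>small_angle\<close>.\<close>

lemma spoke_exists:
  assumes "0 < h" "h < pi/2" "\<epsilon> > 0"
  obtains R where "R < 1" "\<forall>r u. R < r \<and> r < 1 \<and> cmod u = 1 \<longrightarrow>
     (\<exists>q. spoke h u q \<and> dist (\<Phi> (of_real r * u)) (pathfinish q) < \<epsilon>)"
proof -
  obtain \<eta> where \<eta>: "0 < \<eta>" "\<eta> \<le> 1/2" "\<forall>T a. path T \<and>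
     (\<forall>t\<in>{0..1}. 1 - \<eta> < cmod (T t) \<and> cmod (T t) < 1 \<and> dist (\<Phi> (T t)) a \<le> \<eta>)
     \<longrightarrow> (\<forall>t\<in>{0..1}. T t \<noteq> 0 \<and> \<bar>Arg (T t / T 0)\<bar> < h)"
    by (rule small_angle[OF assms(1,2)]) (rule that)
  obtain \<delta> where \<delta>: "\<delta> > 0" "\<And>w. w \<in> D \<Longrightarrow> infdist w \<Gamma> < \<delta> \<Longrightarrow> 1 - \<eta> < cmod (\<Psi> w)"
  proof (rule near_circle[of "1 - \<eta>"])
    show "1 - \<eta> < 1" using \<eta>(1) by simp
  qed (rule that)
  obtain R where R: "R < 1" "\<And>z. R < cmod z \<Longrightarrow> cmod z < 1 \<Longrightarrow> infdist (\<Phi> z) \<Gamma> < min \<delta> (min \<eta> \<epsilon>)"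
  proof (rule near_boundary[of "min \<delta> (min \<eta> \<epsilon>)"])
    show "min \<delta> (min \<eta> \<epsilon>) > 0" using \<eta>(1) \<delta>(1) assms(3) by simp
  qed (rule that)
  show ?thesis
  proof (rule that[of "max R 0"]; (intro allI impI; elim conjE)?)
    show "max R 0 < 1" using R(1) by simp
    fix r :: real and u :: complex assume r: "max R 0 < r" "r < 1" and u: "cmod u = 1"
    have u0: "u \<noteq> 0" using u by auto
    define z where "z = of_real r * u"
    have z: "cmod z = r" "z \<noteq> 0" using r u by (auto simp: z_def norm_mult)
    define p where "p = \<Phi> z"
    have pD: "p \<in> D" unfolding p_def using z r by (intro \<Phi>_in) simp
    have pi: "infdist p \<Gamma> < min \<delta> (min \<eta> \<epsilon>)" unfolding p_def by (rule R(2)) (use r z in auto)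
    obtain c where c: "c \<in> \<Gamma>" "infdist p \<Gamma> = dist p c"
      using infdist_attains_inf[OF compact_imp_closed[OF D_props(8)] D_props(9)] by blast
    have pc: "dist p c < \<delta>" "dist p c < \<eta>" "dist p c < \<epsilon>" using pi c(2) by auto
    define seg where "seg = closed_segment p c"
    have "ball p (dist p c) \<inter> \<Gamma> = {}"
    proof (rule ccontr)
      assume "\<not> ?thesis"
      then obtain y where "y \<in> \<Gamma>" "dist p y < dist p c" by auto
      then show False using infdist_le[of y \<Gamma> p] c(2) by simp
    qed
    moreover have "p \<noteq> c" using c(1) pD D_props(6) by blast
    then have "p \<in> ball p (dist p c)" by simp
    \<comment> \<open>This ball is connected, meets D and contains no frontier point of D. Hence the
      segment from p reaches \<open>\<Gamma>\<close> at c only.\<close>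
    ultimately have ballD: "ball p (dist p c) \<subseteq> D"
      using connected_Int_frontier[of "ball p (dist p c)" D] pD D_props(5) by blast
    have seg_dist: "dist w c \<le> dist p c" if "w \<in> seg" for w
      using dist_in_closed_segment[OF that[unfolded seg_def]] by (simp add: dist_commute)
    have segD: "w \<in> D" if w: "w \<in> seg" "w \<noteq> c" for w
    proof -
      obtain t where t: "0 \<le> t" "t \<le> 1" "w = (1 - t) *\<^sub>R p + t *\<^sub>R c"
        using w(1) unfolding seg_def closed_segment_def by blast
      have "t < 1" using w(2) t by (cases "t = 1") auto
      have "dist p w = t * dist p c"
      proof -
        have "p - w = t *\<^sub>R (p - c)" unfolding t(3) by (simp add: algebra_simps)
        then show ?thesis using t(1) by (simp add: dist_norm)
      qed
      also have "\<dots> < 1 * dist p c" using \<open>t < 1\<close> \<open>p \<noteq> c\<close> by (intro mult_strict_right_mono) auto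
      finally show ?thesis using ballD by auto
    qed
    have seg\<Psi>: "1 - \<eta> < cmod (\<Psi> w)" if "w \<in> seg" "w \<noteq> c" for w
      using seg_dist[OF that(1)] pc(1) infdist_le[OF c(1), of w] by (intro \<delta>(2)[OF segD[OF that]]) simp
    define Z where "Z = {t \<in> {0..r}. \<Phi> (of_real t * u) \<in> seg}"
    have tu: "of_real t * u \<in> ball 0 1" if "t \<in> {0..r}" for t
      using that r u by (auto simp: norm_mult)
    have cont: "continuous_on {0..r} (\<lambda>t. \<Phi> (of_real t * u))"
      by (rule continuous_on_compose2[OF cont\<Phi>]) (use tu in \<open>auto intro!: continuous_intros\<close>)
    have "closed Z" unfolding Z_def
    proof -
      have "closed ({0..r} \<inter> (\<lambda>t. \<Phi> (of_real t * u)) -` seg)"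
        by (rule continuous_closed_preimage[OF cont]) (auto simp: seg_def)
      moreover have "{0..r} \<inter> (\<lambda>t. \<Phi> (of_real t * u)) -` seg = {t \<in> {0..r}. \<Phi> (of_real t * u) \<in> seg}" by auto
      ultimately show "closed {t \<in> {0..r}. \<Phi> (of_real t * u) \<in> seg}" by simp
    qed
    moreover have "bounded Z" by (rule bounded_subset[of "{0..r}"]) (auto simp: Z_def)
    ultimately have "compact Z" using compact_eq_bounded_closed by blast
    moreover have "r \<in> Z" using r by (simp add: Z_def seg_def p_def z_def)
    \<comment> \<open>With the first hit, the two pieces meet in e only, and their join is an
      arc.\<close>
    ultimately have "\<exists>t\<in>Z. \<forall>s\<in>Z. t \<le> s" by (intro compact_attains_inf) auto
    then obtain t where t: "t \<in> Z" "\<And>s. s \<in> Z \<Longrightarrow> t \<le> s" by blast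
    define e where "e = \<Phi> (of_real t * u)"
    have tr: "t \<in> {0..r}" and eseg: "e \<in> seg" using t(1) by (auto simp: Z_def e_def)
    have eD: "e \<in> D" unfolding e_def by (intro \<Phi>_in tu tr)
    have ec: "e \<noteq> c" using eD c(1) D_props(6) by blast
    have \<Psi>e: "\<Psi> e = of_real t * u" unfolding e_def by (intro \<Psi>\<Phi> tu tr)
    \<comment> \<open>The point e lies on the segment, so its preimage has modulus above 1 -
      \<open>\<eta>\<close>, which is at least 1/2. Thus the spoke is exactly radial up to modulus
      1/2.\<close>
    have t12: "1/2 < t" using seg\<Psi>[OF eseg ec] \<eta>(2) tr u by (simp add: \<Psi>e norm_mult)
    define q1 where "q1 = \<Phi> \<circ> linepath 0 (of_real t * u)"
    define q2 where "q2 = linepath e c"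
    have seg0: "closed_segment 0 (of_real t * u) = (\<lambda>s. of_real s * u) ` {0..t}"
    proof -
      have "closed_segment 0 (of_real t * u) = (\<lambda>s. of_real (s * t) * u) ` {0..1}"
        by (auto simp: closed_segment_image_interval scaleR_conv_of_real mult.assoc)
      also have "\<dots> = (\<lambda>s. of_real s * u) ` ((\<lambda>s. s * t) ` {0..1})" by (simp add: image_image)
      also have "(\<lambda>s. s * t) ` {0..1} = {0..t}" using t12 by (simp add: image_mult_atLeastAtMost_if' mult.commute)
      finally show ?thesis .
    qed
    have im1: "path_image q1 = (\<lambda>s. \<Phi> (of_real s * u)) ` {0..t}"
      unfolding q1_def path_image_compose path_image_linepath seg0 by (simp add: image_image)
    have sub1: "closed_segment 0 (of_real t * u) \<subseteq> ball 0 1"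
      unfolding seg0 using tu tr by auto
    have arc1: "arc q1" unfolding q1_def
    proof -
      let ?l = "linepath 0 (of_real t * u)"
      have l: "arc ?l" using t12 u0 by simp
      moreover have "path_image ?l \<subseteq> ball 0 1" using sub1 by simp
      ultimately show "arc (\<Phi> \<circ> ?l)"
        unfolding arc_def path_image_def
        by (auto intro!: path_continuous_image comp_inj_on continuous_on_subset[OF cont\<Phi>] inj_on_subset[OF inj\<Phi>]
            simp: path_image_def)
    qed
    have arc2: "arc q2" using ec by (simp add: q2_def)
    have ends: "pathstart q1 = \<Phi> 0" "pathfinish q1 = e" "pathstart q2 = e" "pathfinish q2 = c"
      by (simp_all add: q1_def q2_def e_def pathstart_compose pathfinish_compose)
    have q2seg: "path_image q2 \<subseteq> seg"
      using eseg by (simp add: q2_def seg_def subset_closed_segment)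
    have "path_image q1 \<inter> path_image q2 \<subseteq> {e}"
    proof
      fix w assume w: "w \<in> path_image q1 \<inter> path_image q2"
      then obtain s where s: "s \<in> {0..t}" "w = \<Phi> (of_real s * u)" unfolding im1 by blast
      then have "s \<in> Z" using w q2seg tr by (auto simp: Z_def)
      then have "s = t" using t(2) s(1) by force
      then show "w \<in> {e}" using s(2) by (simp add: e_def)
    qed
    then have arcq: "arc (q1 +++ q2)" using arc1 arc2 ends by (intro arc_join) auto
    have imq: "path_image (q1 +++ q2) = path_image q1 \<union> path_image q2" using ends by (simp add: path_image_join)
    have q1D: "w \<in> D \<and> (\<exists>s\<in>{0..t}. \<Psi> w = of_real s * u)" if "w \<in> path_image q1" for w
    proof -
      obtain s where s: "s \<in> {0..t}" "w = \<Phi> (of_real s * u)" using \<open>w \<in> path_image q1\<close> unfolding im1 by blast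
      moreover have "of_real s * u \<in> ball 0 1" using s(1) tr by (intro tu) auto
      ultimately show ?thesis using \<Phi>_in \<Psi>\<Phi> by auto
    qed
    have angle: "\<bar>Arg (\<Psi> w / u)\<bar> < h" if w: "w \<in> path_image q2" "w \<noteq> c" for w
    proof -
      \<comment> \<open>This preimage starts on the ray of u, so the angle by which it turns is the
        argument of \<open>\<Psi> w / u\<close>.\<close>
      define T where "T = \<Psi> \<circ> linepath e w"
      have wseg: "w \<in> seg" using w(1) q2seg by blast
      have ew: "closed_segment e w \<subseteq> seg" using eseg wseg by (simp add: seg_def subset_closed_segment)
      have ncw: "c \<notin> closed_segment e w"
      proof
        assume "c \<in> closed_segment e w"
        moreover have "w \<in> closed_segment e c" using w(1) by (simp add: q2_def)
        ultimately show False
          using w(2) between_antisym[where a = c and b = w and c = e]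
          by (simp add: between_mem_segment closed_segment_commute)
      qed
      have lin: "linepath e w s \<in> closed_segment e w" if "s \<in> {0..1}" for s
        using that linepath_image_01 by blast
      have "path T" unfolding T_def
        using ew ncw segD by (intro path_continuous_image continuous_on_subset[OF cont\<Psi>]) auto
      moreover have "1 - \<eta> < cmod (T s) \<and> cmod (T s) < 1 \<and> dist (\<Phi> (T s)) c \<le> \<eta>" if "s \<in> {0..1}" for s
      proof -
        have s: "linepath e w s \<in> seg" "linepath e w s \<noteq> c" using lin[OF that] ew ncw by blast+
        have "linepath e w s \<in> D" by (rule segD[OF s])
        then have "cmod (T s) < 1" "\<Phi> (T s) = linepath e w s" using \<Psi>_in \<Phi>\<Psi> by (auto simp: T_def)
        moreover have "1 - \<eta> < cmod (T s)" using seg\<Psi>[OF s] by (simp add: T_def)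
        moreover have "dist (linepath e w s) c \<le> \<eta>" using seg_dist[OF s(1)] pc(2) by simp
        ultimately show ?thesis by simp
      qed
      ultimately have "\<forall>s\<in>{0..1}. T s \<noteq> 0 \<and> \<bar>Arg (T s / T 0)\<bar> < h"
        using \<eta>(3)[THEN spec, THEN spec, of T c, THEN mp] by simp
      then have "\<bar>Arg (T 1 / T 0)\<bar> < h" by simp
      moreover have "T 1 / T 0 = of_real (inverse t) * (\<Psi> w / u)"
      proof -
        have "T 1 = \<Psi> w" "T 0 = of_real t * u" by (simp_all add: T_def \<Psi>e linepath_def)
        then show ?thesis using t12 u0 by (simp add: field_simps)
      qed
      moreover have "Arg (of_real (inverse t) * (\<Psi> w / u)) = Arg (\<Psi> w / u)"
        using t12 by (intro Arg_times_of_real) simp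
      ultimately show ?thesis by simp
    qed
    have fin: "pathfinish (q1 +++ q2) = c" "pathstart (q1 +++ q2) = \<Phi> 0" using ends by auto
    have "spoke h u (q1 +++ q2)"
      unfolding spoke_def fin
    proof (intro conjI ballI allI impI)
      show "path_image (q1 +++ q2) - {c} \<subseteq> D"
        unfolding imq using q1D q2seg segD by blast
    next
      fix w assume w: "w \<in> path_image (q1 +++ q2) - {c}"
      show "\<Psi> w = 0 \<or> \<bar>Arg (\<Psi> w / u)\<bar> < h"
      proof (cases "w \<in> path_image q1")
        case True
        then obtain s where s: "s \<in> {0..t}" "\<Psi> w = of_real s * u" using q1D by blast
        then show ?thesis using u0 assms(1) by (cases "s = 0") (auto simp: Arg_of_real)
      next
        case False
        then show ?thesis using angle w imq by blast
      qed
    next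
      fix w assume w: "w \<in> path_image (q1 +++ q2) - {c}" "cmod (\<Psi> w) < 1/2"
      then have "w \<notin> path_image q2" using seg\<Psi>[of w] q2seg \<eta>(2) by auto
      then have "w \<in> path_image q1" using w(1) imq by blast
      then show "\<exists>t\<ge>0. \<Psi> w = of_real t * u" using q1D by fastforce
    next
      fix s :: real assume "0 \<le> s \<and> s < 1/2"
      then show "\<Phi> (of_real s * u) \<in> path_image (q1 +++ q2)"
        unfolding imq im1 using t12 by (intro UnI1 imageI) auto
    qed (use arcq c(1) in simp_all)
    moreover have "dist (\<Phi> (of_real r * u)) (pathfinish (q1 +++ q2)) < \<epsilon>"
      unfolding fin using pc(3) by (simp add: p_def z_def)
    ultimately show "\<exists>q. spoke h u q \<and> dist (\<Phi> (of_real r * u)) (pathfinish q) < \<epsilon>" by blast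
  qed
qed

end

section \<open>The cyclic order of spokes\<close>

lemma Arg_cis_cases:
  assumes "s > 0"
  obtains n :: int where "Arg (of_real s * cis \<phi>) = \<phi> - 2 * pi * of_int n"
proof -
  let ?x = "of_real s * cis \<phi>"
  have "?x \<noteq> 0" using assms by simp
  then have "cis (Arg ?x) = sgn ?x" by (rule cis_Arg)
  also have "\<dots> = cis \<phi>" using assms by (simp add: sgn_mult sgn_of_real)
  finally have "cis (\<phi> - Arg ?x) = 1" by (simp add: cis_divide[symmetric])
  then have "cos (\<phi> - Arg ?x) = 1" by (metis cis.sel(1) one_complex.sel(1))
  then obtain n :: int where "\<phi> - Arg ?x = of_int n * 2 * pi" using cos_one_2pi_int by blast
  then show ?thesis by (intro that[of n]) (simp add: algebra_simps)
qed

text \<open>Arguments of quotients are determined only up to multiples of 2 pi; most contradictions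
  between angles below come from here.\<close>

lemma int_gap:
  fixes n :: int
  assumes "\<bar>x - 2 * pi * n\<bar> < h" "h \<le> x" "x \<le> 2 * pi - h"
  shows False
proof (cases "n \<le> 0")
  case True
  then have "2 * pi * n \<le> 0" by (simp add: mult_nonneg_nonpos)
  then show ?thesis using assms by linarith
next
  case False
  then have "2 * pi * 1 \<le> 2 * pi * n" by (intro mult_left_mono) auto
  then show ?thesis using assms by linarith
qed

text \<open>The region between two neighbouring spokes, of directions u and
  \<open>u * cis \<beta>\<close>, as far as it is under control. Up to modulus 1/2 the spokes are
  exact radii, so the full open angle is free; beyond it a margin h on both sides accounts for their
  deviation. The two pieces overlap, which makes the set connected.\<close>

definition sector :: "real \<Rightarrow> real \<Rightarrow> complex \<Rightarrow> complex set" where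
  "sector h \<beta> u = (\<lambda>(s, \<theta>). of_real s * cis \<theta> * u) `
     ({0<..<1/2} \<times> {0<..<\<beta>} \<union> {0<..<1} \<times> {h..\<beta> - h})"

lemma sectorI1: "\<lbrakk>w = of_real s * cis \<theta> * u; 0 < s; s < 1/2; 0 < \<theta>; \<theta> < \<beta>\<rbrakk> \<Longrightarrow> w \<in> sector h \<beta> u"
  unfolding sector_def by (rule image_eqI[of _ _ "(s, \<theta>)"]) auto

lemma sectorI2: "\<lbrakk>w = of_real s * cis \<theta> * u; 0 < s; s < 1; h \<le> \<theta>; \<theta> \<le> \<beta> - h\<rbrakk> \<Longrightarrow> w \<in> sector h \<beta> u"
  unfolding sector_def by (rule image_eqI[of _ _ "(s, \<theta>)"]) auto

lemma sectorE:
  assumes "w \<in> sector h \<beta> u"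
  obtains s \<theta> where "w = of_real s * cis \<theta> * u" "0 < s" "s < 1"
    "s < 1/2 \<and> 0 < \<theta> \<and> \<theta> < \<beta> \<or> h \<le> \<theta> \<and> \<theta> \<le> \<beta> - h"
  using assms unfolding sector_def by force

lemma connected_sector:
  assumes "0 < \<beta>" "2 * h \<le> \<beta>"
  shows "connected (sector h \<beta> u)"
  unfolding sector_def
proof (rule connected_continuous_image)
  show "continuous_on X (\<lambda>(s, \<theta>). of_real s * cis \<theta> * u)" for X :: "(real \<times> real) set"
    unfolding case_prod_unfold by (intro continuous_intros)
  have "(1/4, \<beta>/2) \<in> {0<..<1/2::real} \<times> {0<..<\<beta>}" "(1/4, \<beta>/2) \<in> {0<..<1::real} \<times> {h..\<beta> - h}"
    using assms by auto
  then have "({0<..<1/2::real} \<times> {0<..<\<beta>}) \<inter> ({0<..<1::real} \<times> {h..\<beta> - h}) \<noteq> {}" by blast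
  then show "connected ({0<..<1/2} \<times> {0<..<\<beta>} \<union> {0<..<1::real} \<times> {h..\<beta> - h})"
    by (intro connected_Un convex_connected convex_Times) auto
qed

lemma polar_decomp:
  assumes "v \<noteq> 0"
  shows "w = of_real (cmod (w / v)) * cis (Arg (w / v)) * v"
proof -
  have "w / v = of_real (cmod (w / v)) * cis (Arg (w / v))"
    using rcis_cmod_Arg[of "w / v"] by (simp only: rcis_def)
  then show ?thesis using assms by (metis nonzero_divide_eq_eq)
qed

text \<open>At modulus 1/4 the spoke is a straight radius with one sector on either side, and
  nothing else is nearby. This local picture later decides on which side of a curve through the
  spoke each sector lies.\<close>

lemma sector_nbhd:
  assumes u: "cmod u = 1" and \<beta>: "0 < \<beta>" "\<beta> < 2 * pi"
  obtains e where "e > 0" "\<And>w. w \<in> ball (of_real (1/4) * (u * cis \<beta>)) e \<Longrightarrow>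
     (\<exists>t. 0 \<le> t \<and> t < 1/2 \<and> w = of_real t * (u * cis \<beta>)) \<or> w \<in> sector h \<beta> u \<or> w \<in> sector h (2*pi - \<beta>) (u * cis \<beta>)"
proof -
  define v where "v = u * cis \<beta>"
  have v: "cmod v = 1" "v \<noteq> 0" using u by (auto simp: v_def norm_mult)
  define w1 where "w1 = of_real (1/4) * v"
  have "w1 / v = of_real (1/4)" using v by (simp add: w1_def)
  have "w1 / v \<notin> \<real>\<^sub>\<le>\<^sub>0"
    unfolding \<open>w1 / v = of_real (1/4)\<close> by (simp add: complex_nonpos_Reals_iff)
  then have "continuous (at w1) (\<lambda>w. Arg (w / v))"
    using v by (intro continuous_at_compose[of w1 "\<lambda>w. w / v" Arg, unfolded o_def] continuous_at_Arg continuous_intros) auto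
  moreover have "min \<beta> (2*pi - \<beta>) > 0" using \<beta> by simp
  ultimately obtain d where d: "d > 0" "\<And>w. dist w w1 < d \<Longrightarrow> dist (Arg (w / v)) (Arg (w1 / v)) < min \<beta> (2*pi - \<beta>)"
    unfolding continuous_at_eps_delta by blast
  have A1: "Arg (w1 / v) = 0" unfolding \<open>w1 / v = of_real (1/4)\<close> by (subst Arg_of_real) simp
  show ?thesis
  proof (rule that[of "min d (1/4)"])
    fix w assume "w \<in> ball (of_real (1/4) * (u * cis \<beta>)) (min d (1/4))"
    then have w: "dist w w1 < d" "dist w w1 < 1/4" by (auto simp: w1_def v_def dist_commute)
    define \<alpha> where "\<alpha> = Arg (w / v)"
    define s where "s = cmod (w / v)"
    have weq: "w = of_real s * cis \<alpha> * v" unfolding \<alpha>_def s_def by (rule polar_decomp[OF v(2)])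
    have \<alpha>: "\<bar>\<alpha>\<bar> < \<beta>" "\<bar>\<alpha>\<bar> < 2*pi - \<beta>" using d(2)[OF w(1)] A1 by (auto simp: \<alpha>_def dist_real_def)
    have "cmod w1 = 1/4" using v by (simp add: w1_def norm_mult)
    then have "0 < cmod w" "cmod w < 1/2"
      using w(2) norm_triangle_ineq2[of w w1] norm_triangle_ineq3[of w w1] by (auto simp: dist_norm)
    then have s: "0 < s" "s < 1/2" using v by (auto simp: s_def norm_divide)
    consider "\<alpha> = 0" | "\<alpha> < 0" | "\<alpha> > 0" by linarith
    then show "(\<exists>t. 0 \<le> t \<and> t < 1/2 \<and> w = of_real t * (u * cis \<beta>)) \<or> w \<in> sector h \<beta> u \<or> w \<in> sector h (2*pi - \<beta>) (u * cis \<beta>)"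
    proof cases
      case 1
      then have "w = of_real s * (u * cis \<beta>)" using weq by (simp add: v_def)
      then show ?thesis using s by (intro disjI1 exI[of _ s]) auto
    next
      case 2
      have "w = of_real s * cis (\<alpha> + \<beta>) * u" unfolding weq v_def by (simp add: cis_mult[symmetric])
      then have "w \<in> sector h \<beta> u" using s 2 \<alpha> by (intro sectorI1[of w s "\<alpha> + \<beta>"]) auto
      then show ?thesis by blast
    next
      case 3
      then have "w \<in> sector h (2*pi - \<beta>) v" using s \<alpha> weq by (intro sectorI1[of w s \<alpha>]) auto
      then show ?thesis unfolding v_def by blast
    qed
  qed (use d(1) in auto)
qed

lemma connected_unbounded_subset_outside:
  assumes "connected S" "\<not> bounded S" "S \<inter> P = {}"
  shows "S \<subseteq> outside P"
proof
  fix x assume x: "x \<in> S"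
  have "S \<subseteq> connected_component_set (- P) x"
    by (rule connected_component_maximal) (use assms x in auto)
  then have "\<not> bounded (connected_component_set (- P) x)" using assms(2) bounded_subset by blast
  then show "x \<in> outside P" using x assms(3) by (auto simp: outside_def)
qed

lemma simple_path_arcs_loop:
  assumes "arc p" "arc q" "pathstart q = pathstart p" "pathfinish q = pathfinish p"
    "path_image p \<inter> path_image q \<subseteq> {pathstart p, pathfinish p}"
  shows "simple_path (p +++ reversepath q)" "pathfinish (p +++ reversepath q) = pathstart (p +++ reversepath q)"
    "path_image (p +++ reversepath q) = path_image p \<union> path_image q"
proof -
  show "simple_path (p +++ reversepath q)"
    using assms by (intro simple_path_join_loop) (auto simp: arc_reversepath)
  show "path_image (p +++ reversepath q) = path_image p \<union> path_image q"
    using assms by (simp add: path_image_join)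
qed (use assms in simp)

section \<open>Images of sectors and the spokes that bound them\<close>

context jordan_conformal
begin

lemma spoke_pathfinish: "spoke h u q \<Longrightarrow> pathfinish q \<in> \<Gamma>" "spoke h u q \<Longrightarrow> pathfinish q \<notin> D"
  using D_props(6) unfolding spoke_def by blast+

lemma spoke_D: "spoke h u q \<Longrightarrow> w \<in> path_image q \<Longrightarrow> w \<noteq> pathfinish q \<Longrightarrow> w \<in> D"
  by (auto simp: spoke_def)

lemma spoke_arg: "spoke h u q \<Longrightarrow> w \<in> path_image q \<Longrightarrow> w \<noteq> pathfinish q \<Longrightarrow> \<Psi> w \<noteq> 0 \<Longrightarrow> \<bar>Arg (\<Psi> w / u)\<bar> < h"
  by (auto simp: spoke_def)

lemma spoke_ray: "spoke h u q \<Longrightarrow> w \<in> path_image q \<Longrightarrow> w \<noteq> pathfinish q \<Longrightarrow> cmod (\<Psi> w) < 1/2 \<Longrightarrow> \<exists>t\<ge>0. \<Psi> w = of_real t * u"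
  by (auto simp: spoke_def)

lemma sector_in_ball: "cmod u = 1 \<Longrightarrow> w \<in> sector h \<beta> u \<Longrightarrow> w \<in> ball 0 1"
  by (erule sectorE) (simp add: norm_mult)

text \<open>A common point has argument within h of the direction of the spoke, and argument equal
  to it when the modulus is below 1/2; both are excluded for points of the sector. The cases
  \<open>\<gamma> = 0\<close> and \<open>\<gamma> = \<beta>\<close> are the two spokes bounding the
  sector.\<close>

lemma sector_avoids_spoke:
  assumes u: "cmod u = 1" and \<beta>: "0 < \<beta>" "\<beta> < 2 * pi" and \<gamma>: "\<gamma> = 0 \<or> \<gamma> = \<beta>"
    and q: "spoke h (u * cis \<gamma>) q" and w: "w \<in> sector h \<beta> u"
  shows "\<Phi> w \<notin> path_image q"
proof
  assume *: "\<Phi> w \<in> path_image q"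
  have wb: "w \<in> ball 0 1" by (rule sector_in_ball[OF u w])
  obtain s \<theta> where s: "w = of_real s * cis \<theta> * u" "0 < s" "s < 1"
    "s < 1/2 \<and> 0 < \<theta> \<and> \<theta> < \<beta> \<or> h \<le> \<theta> \<and> \<theta> \<le> \<beta> - h" using w by (rule sectorE)
  have u0: "u \<noteq> 0" using u by auto
  have nf: "\<Phi> w \<noteq> pathfinish q" using \<Phi>_in[OF wb] spoke_pathfinish[OF q] by auto
  have quot: "w / (u * cis \<gamma>) = of_real s * cis (\<theta> - \<gamma>)"
    unfolding s(1) using u0 by (simp add: cis_divide[symmetric])
  have "w \<noteq> 0" using s u0 by simp
  obtain n :: int where n: "Arg (w / (u * cis \<gamma>)) = \<theta> - \<gamma> - 2 * pi * of_int n"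
    unfolding quot by (rule Arg_cis_cases[OF s(2)])
  have nonzero: "\<Psi> (\<Phi> w) = w" by (rule \<Psi>\<Phi>[OF wb])
  have less: "\<bar>\<theta> - \<gamma> - 2 * pi * of_int n\<bar> < h"
    using spoke_arg[OF q * nf] nonzero \<open>w \<noteq> 0\<close> n by simp
  have fin: False if "\<bar>\<theta> - \<gamma> - 2 * pi * of_int n\<bar> < k" "k \<le> \<theta>" "\<theta> \<le> \<beta> - k" for k
  proof (cases "\<gamma> = 0")
    case True
    then show False using int_gap[of \<theta> n k] that \<beta> by simp
  next
    case False
    then have "\<gamma> = \<beta>" using \<gamma> by simp
    then have "\<bar>(\<beta> - \<theta>) - 2 * pi * of_int (- n)\<bar> < k" using that(1) by simp
    then show False using int_gap[of "\<beta> - \<theta>" "- n" k] that(2,3) \<beta> by simp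
  qed
  from s(4) show False
  proof
    assume s': "s < 1/2 \<and> 0 < \<theta> \<and> \<theta> < \<beta>"
    have "cmod (\<Psi> (\<Phi> w)) < 1/2" unfolding nonzero using s s' u by (simp add: norm_mult)
    then obtain t where t: "t \<ge> 0" "w = of_real t * (u * cis \<gamma>)" using spoke_ray[OF q * nf] nonzero by auto
    then have "w / (u * cis \<gamma>) = of_real t" using u0 by simp
    then have "Arg (w / (u * cis \<gamma>)) = 0" using t(1) by (simp add: Arg_of_real)
    then have "\<theta> - \<gamma> - 2 * pi * of_int n = 0" using n by simp
    \<comment> \<open>Close to the centre the argument agrees exactly, so the margin h may be
      replaced by any positive distance to both sides, and the same claim \<open>fin\<close>
      applies.\<close>
    moreover define k where "k = min \<theta> (\<beta> - \<theta>)"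
    moreover have k: "0 < k" "k \<le> \<theta>" "\<theta> \<le> \<beta> - k" using s' unfolding k_def by linarith+
    ultimately have "\<bar>\<theta> - \<gamma> - 2 * pi * of_int n\<bar> < k" by (simp only: abs_zero)
    then show False using fin k by blast
  next
    assume "h \<le> \<theta> \<and> \<theta> \<le> \<beta> - h"
    then show False using fin[OF less] by simp
  qed
qed

lemma spoke_in_sector:
  assumes u: "cmod u = 1" and q: "spoke h (u * cis \<theta>) q" and \<theta>: "2 * h \<le> \<theta>" "\<theta> \<le> \<beta> - 2 * h"
    and w: "w \<in> path_image q" "w \<noteq> pathfinish q" "\<Psi> w \<noteq> 0"
  shows "\<Psi> w \<in> sector h \<beta> u"
proof -
  define v where "v = u * cis \<theta>"
  have v: "cmod v = 1" "v \<noteq> 0" using u by (auto simp: v_def norm_mult)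
  have "\<bar>Arg (\<Psi> w / v)\<bar> < h" using spoke_arg[OF q w] by (simp add: v_def)
  moreover have "\<Psi> w = of_real (cmod (\<Psi> w / v)) * cis (Arg (\<Psi> w / v)) * v" by (rule polar_decomp[OF v(2)])
  then have "\<Psi> w = of_real (cmod (\<Psi> w / v)) * cis (Arg (\<Psi> w / v) + \<theta>) * u"
    unfolding cis_mult[symmetric] by (simp add: v_def mult_ac)
  moreover have "cmod (\<Psi> w) < 1" using \<Psi>_in[OF spoke_D[OF q w(1,2)]] by simp
  ultimately show ?thesis using \<theta> w(3) v by (intro sectorI2) (auto simp: norm_divide)
qed

text \<open>A common point other than the centre would have argument within h of both directions,
  which are at least 2 h apart modulo 2 pi.\<close>

lemma spokes_meet:
  assumes u: "cmod u = 1" and \<beta>: "2 * h \<le> \<beta>" "\<beta> \<le> 2 * pi - 2 * h"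
    and q0: "spoke h u q0" and q1: "spoke h (u * cis \<beta>) q1"
    and w: "w \<in> path_image q0" "w \<in> path_image q1" "w \<noteq> pathfinish q0" "w \<noteq> pathfinish q1"
  shows "w = \<Phi> 0"
proof (rule ccontr)
  assume "w \<noteq> \<Phi> 0"
  have wD: "w \<in> D" using spoke_D[OF q0 w(1,3)] .
  have \<Psi>0: "\<Psi> w \<noteq> 0" using \<Phi>\<Psi>[OF wD] \<open>w \<noteq> \<Phi> 0\<close> by auto
  have u0: "u \<noteq> 0" using u by auto
  define s where "s = cmod (\<Psi> w / u)"
  define \<alpha> where "\<alpha> = Arg (\<Psi> w / u)"
  have s: "s > 0" using \<Psi>0 u0 by (simp add: s_def)
  have "\<Psi> w = of_real s * cis \<alpha> * u" unfolding s_def \<alpha>_def by (rule polar_decomp[OF u0])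
  then have "\<Psi> w / (u * cis \<beta>) = of_real s * cis (\<alpha> - \<beta>)" using u0 by (simp add: cis_divide[symmetric])
  then obtain n :: int where n: "Arg (\<Psi> w / (u * cis \<beta>)) = \<alpha> - \<beta> - 2 * pi * of_int n"
    using Arg_cis_cases[OF s, of "\<alpha> - \<beta>"] by metis
  have "\<bar>\<alpha>\<bar> < h" "\<bar>\<alpha> - \<beta> - 2 * pi * of_int n\<bar> < h"
    using spoke_arg[OF q0 w(1,3) \<Psi>0] spoke_arg[OF q1 w(2,4) \<Psi>0] n by (simp_all add: \<alpha>_def)
  then have "\<bar>\<beta> - 2 * pi * of_int (- n)\<bar> < 2 * h" by simp
  then show False using int_gap[of \<beta> "- n" "2 * h"] \<beta> by simp
qed

lemma sector_image_D: "cmod u = 1 \<Longrightarrow> \<Phi> ` sector h \<beta> u \<subseteq> D"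
  using sector_in_ball \<Phi>_in by blast

lemma connected_sector_image:
  assumes "cmod u = 1" "0 < \<beta>" "2 * h \<le> \<beta>"
  shows "connected (\<Phi> ` sector h \<beta> u)"
  by (rule connected_continuous_image[OF continuous_on_subset[OF cont\<Phi>]])
    (use assms sector_in_ball connected_sector in blast)+

text \<open>The fourth claim is meant for a component G of the complement of a curve containing
  \<open>q1\<close>. Its frontier contains the point of \<open>q1\<close> at modulus 1/4, so G meets
  one of the two sector images. Those are connected and disjoint from both spokes, so one of them is
  swallowed by G when the curve consists of the spokes.\<close>

lemma two_spokes:
  assumes u: "cmod u = 1" and \<beta>: "0 < \<beta>" "\<beta> < 2 * pi"
    and q0: "spoke h u q0" and q1: "spoke h (u * cis \<beta>) q1"
  shows "\<Phi> ` sector h \<beta> u \<inter> (path_image q0 \<union> path_image q1) = {}"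
    and "\<Phi> ` sector h (2*pi - \<beta>) (u * cis \<beta>) \<inter> (path_image q0 \<union> path_image q1) = {}"
    and "\<Phi> (of_real (1/4) * (u * cis \<beta>)) \<in> path_image q1"
    and "\<lbrakk>\<Phi> (of_real (1/4) * (u * cis \<beta>)) \<in> closure G; G \<inter> path_image q1 = {}\<rbrakk> \<Longrightarrow>
      G \<inter> (\<Phi> ` sector h \<beta> u \<union> \<Phi> ` sector h (2*pi - \<beta>) (u * cis \<beta>)) \<noteq> {}"
proof -
  have q0': "spoke h (u * cis 0) q0" using q0 by simp
  show "\<Phi> ` sector h \<beta> u \<inter> (path_image q0 \<union> path_image q1) = {}"
    using sector_avoids_spoke[OF u \<beta> _ q0'] sector_avoids_spoke[OF u \<beta> _ q1] by blast
  define v where "v = u * cis \<beta>"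
  have v: "cmod v = 1" using u by (simp add: v_def norm_mult)
  have \<beta>': "0 < 2*pi - \<beta>" "2*pi - \<beta> < 2*pi" using \<beta> by auto
  have q1v: "spoke h (v * cis 0) q1" using q1 by (simp add: v_def)
  \<comment> \<open>Seen from v, the complementary sector has opening 2 pi - \<open>\<beta>\<close>
    and the spoke of u as its far side, so the same lemma covers it with the roles of the spokes
    exchanged.\<close>
  have "v * cis (2*pi - \<beta>) = u" unfolding v_def mult.assoc cis_mult by simp
  then have q0v: "spoke h (v * cis (2*pi - \<beta>)) q0" using q0 by simp
  show "\<Phi> ` sector h (2*pi - \<beta>) (u * cis \<beta>) \<inter> (path_image q0 \<union> path_image q1) = {}"
    unfolding v_def[symmetric]
    using sector_avoids_spoke[OF v \<beta>' _ q1v] sector_avoids_spoke[OF v \<beta>' _ q0v] by blast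
  have ray: "\<Phi> (of_real t * v) \<in> path_image q1" if "0 \<le> t" "t < 1/2" for t
    using q1 that unfolding spoke_def v_def by blast
  show "\<Phi> (of_real (1/4) * (u * cis \<beta>)) \<in> path_image q1"
    unfolding v_def[symmetric] by (rule ray) auto
  assume G: "\<Phi> (of_real (1/4) * (u * cis \<beta>)) \<in> closure G" "G \<inter> path_image q1 = {}"
  obtain e where e: "e > 0" "\<And>w. w \<in> ball (of_real (1/4) * (u * cis \<beta>)) e \<Longrightarrow>
     (\<exists>t. 0 \<le> t \<and> t < 1/2 \<and> w = of_real t * (u * cis \<beta>)) \<or> w \<in> sector h \<beta> u \<or> w \<in> sector h (2*pi - \<beta>) (u * cis \<beta>)"
    by (rule sector_nbhd[OF u \<beta>]) (rule that)
  define V where "V = D \<inter> \<Psi> -` ball (of_real (1/4) * (u * cis \<beta>)) e"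
  have "open V" unfolding V_def by (intro continuous_open_preimage cont\<Psi> D_props open_ball)
  have b: "of_real (1/4) * (u * cis \<beta>) \<in> ball (0::complex) 1" using u by (simp add: norm_mult)
  have "\<Phi> (of_real (1/4) * (u * cis \<beta>)) \<in> V"
  proof -
    have "\<Psi> (\<Phi> (of_real (1/4) * (u * cis \<beta>))) \<in> ball (of_real (1/4) * (u * cis \<beta>)) e"
      unfolding \<Psi>\<Phi>[OF b] using e(1) by (simp only: centre_in_ball)
    then show ?thesis unfolding V_def using \<Phi>_in[OF b] by blast
  qed
  then have "V \<inter> G \<noteq> {}" using open_Int_closure_eq_empty[OF \<open>open V\<close>, of G] G(1) by blast
  then obtain w where w: "w \<in> G" "w \<in> D" "\<Psi> w \<in> ball (of_real (1/4) * (u * cis \<beta>)) e" unfolding V_def by blast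
  have \<Phi>w: "\<Phi> (\<Psi> w) = w" by (rule \<Phi>\<Psi>[OF w(2)])
  from e(2)[OF w(3)] show "G \<inter> (\<Phi> ` sector h \<beta> u \<union> \<Phi> ` sector h (2*pi - \<beta>) (u * cis \<beta>)) \<noteq> {}"
  proof (elim disjE)
    assume "\<exists>t. 0 \<le> t \<and> t < 1/2 \<and> \<Psi> w = of_real t * (u * cis \<beta>)"
    then have "\<Phi> (\<Psi> w) \<in> path_image q1" using ray by (auto simp: v_def)
    then show ?thesis using \<Phi>w w(1) G(2) by auto
  next
    assume "\<Psi> w \<in> sector h \<beta> u"
    then have "w \<in> \<Phi> ` sector h \<beta> u" using \<Phi>w by (metis imageI)
    then show ?thesis using w(1) by blast
  next
    assume "\<Psi> w \<in> sector h (2*pi - \<beta>) (u * cis \<beta>)"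
    then have "w \<in> \<Phi> ` sector h (2*pi - \<beta>) (u * cis \<beta>)" using \<Phi>w by (metis imageI)
    then show ?thesis using w(1) by blast
  qed
qed

text \<open>The outside of \<open>\<Gamma>\<close> is connected, unbounded and disjoint from P,
  hence lies outside P. An open set missing it also misses its frontier \<open>\<Gamma>\<close>, and
  only D is left.\<close>

lemma inside_subset_D:
  assumes "P \<subseteq> D \<union> \<Gamma>" "open (inside P)"
  shows "inside P \<subseteq> D"
proof -
  have J: "connected (outside \<Gamma>)" "\<not> bounded (outside \<Gamma>)" "D \<inter> outside \<Gamma> = {}" "D \<union> outside \<Gamma> = - \<Gamma>"
    "frontier (outside \<Gamma>) = \<Gamma>"
    using Jordan_inside_outside[OF simple loop] by auto
  have "outside \<Gamma> \<inter> P = {}" using assms(1) J(3,4) by blast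
  then have "outside \<Gamma> \<subseteq> outside P" by (intro connected_unbounded_subset_outside J)
  then have out: "inside P \<inter> outside \<Gamma> = {}" using inside_Int_outside[of P] by blast
  then have "inside P \<inter> closure (outside \<Gamma>) = {}" using open_Int_closure_eq_empty[OF assms(2)] by blast
  then have "inside P \<inter> \<Gamma> = {}" using J(5) unfolding frontier_def by blast
  then show ?thesis using out J(4) by blast
qed

text \<open>If two spokes had the same endpoint, one of the two complementary sectors would be mapped inside the
  Jordan curve that they form, so \<open>\<Phi>\<close> would tend to that endpoint along a whole arc of the circle.\<close>

lemma sector_not_inside:
  assumes u: "cmod u = 1" and h: "0 < h" "h < pi/2" and \<beta>: "4 * h \<le> \<beta>" "\<beta> \<le> 2 * pi - 4 * h"
    and P: "closure (\<Phi> ` sector h \<beta> u) \<subseteq> D \<union> {c}"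
  shows False
proof -
  obtain \<eta> where \<eta>: "0 < \<eta>" "\<eta> \<le> 1/2" "\<forall>T a. path T \<and>
     (\<forall>t\<in>{0..1}. 1 - \<eta> < cmod (T t) \<and> cmod (T t) < 1 \<and> dist (\<Phi> (T t)) a \<le> \<eta>)
     \<longrightarrow> (\<forall>t\<in>{0..1}. T t \<noteq> 0 \<and> \<bar>Arg (T t / T 0)\<bar> < h)"
    by (rule small_angle[OF h]) (rule that)
  define X where "X = closure (\<Phi> ` sector h \<beta> u) \<inter> {w. \<eta> \<le> dist w c}"
  have "bounded (\<Phi> ` sector h \<beta> u)"
    by (rule bounded_subset[OF D_props(3) sector_image_D[OF u]])
  then have "compact X" unfolding X_def
    by (intro compact_Int_closed compact_closure[THEN iffD2] closed_Collect_le continuous_intros)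
  moreover have "X \<subseteq> D" using P \<eta>(1) by (auto simp: X_def)
  ultimately obtain R where R: "R < 1" "\<And>z. z \<in> ball 0 1 \<Longrightarrow> R < cmod z \<Longrightarrow> \<Phi> z \<notin> X"
    by (rule compact_image_in_ball) (rule that)
  define m where "m = max (1/2) (max R (1 - \<eta>))"
  have "m < 1" using R(1) \<eta>(1) by (simp add: m_def)
  then obtain s where s: "m < s" "s < 1" using dense by blast
  then have s': "1/2 < s" "R < s" "1 - \<eta> < s" by (simp_all add: m_def)
  have u0: "u \<noteq> 0" using u by auto
  \<comment> \<open>A circular arc in the sector so close to the unit circle that its image stays
    within \<open>\<eta>\<close> of c. It turns by \<open>\<beta>\<close> - 2 h, which lies between
    2 h and 2 pi - 6 h, whereas \<open>small_angle\<close> allows less than h.\<close>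
  define T where "T t = of_real s * cis (h + t * (\<beta> - 2*h)) * u" for t
  have "path T" unfolding path_def T_def by (intro continuous_intros)
  have cT: "cmod (T t) = s" for t using u s' by (simp add: T_def norm_mult)
  have "\<forall>t\<in>{0..1}. 1 - \<eta> < cmod (T t) \<and> cmod (T t) < 1 \<and> dist (\<Phi> (T t)) c \<le> \<eta>"
  proof
    fix t :: real assume t: "t \<in> {0..1}"
    have "0 \<le> t * (\<beta> - 2*h)" "t * (\<beta> - 2*h) \<le> 1 * (\<beta> - 2*h)"
      using t \<beta> h by (auto intro: mult_right_mono)
    then have "T t \<in> sector h \<beta> u" using s s'
      by (intro sectorI2[of _ s "h + t * (\<beta> - 2*h)"]) (auto simp: T_def)
    then have "\<Phi> (T t) \<in> closure (\<Phi> ` sector h \<beta> u)" by (intro subsetD[OF closure_subset imageI])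
    moreover have "\<Phi> (T t) \<notin> X" using R(2)[of "T t"] cT s s' by simp
    ultimately have "dist (\<Phi> (T t)) c \<le> \<eta>" by (simp add: X_def)
    then show "1 - \<eta> < cmod (T t) \<and> cmod (T t) < 1 \<and> dist (\<Phi> (T t)) c \<le> \<eta>" using cT s s' by simp
  qed
  then have "\<bar>Arg (T 1 / T 0)\<bar> < h"
    using \<eta>(3)[THEN spec, THEN spec, of T c, THEN mp] \<open>path T\<close> by simp
  moreover have "T 1 / T 0 = of_real 1 * cis (\<beta> - 2*h)"
    using s' u0 by (simp add: T_def cis_divide)
  moreover obtain n :: int where "Arg (of_real 1 * cis (\<beta> - 2*h)) = \<beta> - 2*h - 2 * pi * of_int n"
    by (rule Arg_cis_cases[of 1 "\<beta> - 2*h"]) auto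
  ultimately have "\<bar>\<beta> - 2*h - 2 * pi * of_int n\<bar> < h" by simp
  then show False using int_gap[of "\<beta> - 2*h" n h] \<beta> h by simp
qed

lemma spokes_distinct_ends:
  assumes u: "cmod u = 1" and h: "0 < h" "h < pi/2" and \<beta>: "4 * h \<le> \<beta>" "\<beta> \<le> 2 * pi - 4 * h"
    and q0: "spoke h u q0" and q1: "spoke h (u * cis \<beta>) q1"
  shows "pathfinish q0 \<noteq> pathfinish q1"
proof
  assume eq: "pathfinish q0 = pathfinish q1"
  define c where "c = pathfinish q1"
  define P where "P = path_image q0 \<union> path_image q1"
  have \<beta>': "0 < \<beta>" "\<beta> < 2 * pi" "2*h \<le> \<beta>" "\<beta> \<le> 2*pi - 2*h" using h \<beta> by auto
  have ar: "arc q0" "arc q1" "pathstart q0 = \<Phi> 0" "pathstart q1 = \<Phi> 0" using q0 q1 by (auto simp: spoke_def)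
  have int: "path_image q0 \<inter> path_image q1 \<subseteq> {pathstart q0, pathfinish q0}"
    using spokes_meet[OF u \<beta>'(3,4) q0 q1] eq ar by auto
  note J = simple_path_arcs_loop[OF ar(1,2) _ _ int]
  have J': "simple_path (q0 +++ reversepath q1)" "pathfinish (q0 +++ reversepath q1) = pathstart (q0 +++ reversepath q1)"
     "path_image (q0 +++ reversepath q1) = P" using J ar eq by (simp_all add: P_def)
  have I: "open (inside P)" "frontier (inside P) = P" "connected (inside P)" "inside P \<noteq> {}"
    using Jordan_inside_outside[OF J'(1,2)] unfolding J'(3) by simp_all
  have PD: "P \<subseteq> D \<union> {c}" using spoke_D[OF q0] spoke_D[OF q1] eq by (auto simp: P_def c_def)
  \<comment> \<open>The loop of the two spokes touches \<open>\<Gamma>\<close> at the common end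
    only, so the same holds for the closed region that it bounds; this is the hypothesis of
    \<open>sector_not_inside\<close>.\<close>
  have cl: "closure (inside P) \<subseteq> D \<union> {c}"
  proof -
    have "inside P \<subseteq> D"
      by (rule inside_subset_D[OF _ I(1)]) (use PD spoke_pathfinish(1)[OF q1] in \<open>auto simp: c_def\<close>)
    then show ?thesis using closure_Un_frontier[of "inside P"] I(2) PD by auto
  qed
  note ts = two_spokes[OF u \<beta>'(1,2) q0 q1]
  define v where "v = u * cis \<beta>"
  have v: "cmod v = 1" using u by (simp add: v_def norm_mult)
  \<comment> \<open>A connected set that meets the inside and avoids its frontier P cannot leave
    it.\<close>
  have sub: "\<Phi> ` S \<subseteq> inside P" if "connected (\<Phi> ` S)" "\<Phi> ` S \<inter> P = {}" "inside P \<inter> \<Phi> ` S \<noteq> {}" for S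
    using connected_Int_frontier[OF that(1), of "inside P"] that(2,3) I(2) by blast
  have "\<Phi> (of_real (1/4) * (u * cis \<beta>)) \<in> closure (inside P)"
    using ts(3) I(2) by (auto simp: P_def frontier_def)
  moreover have "inside P \<inter> path_image q1 = {}" using inside_no_overlap[of P] unfolding P_def by blast
  ultimately have "inside P \<inter> (\<Phi> ` sector h \<beta> u \<union> \<Phi> ` sector h (2*pi - \<beta>) v) \<noteq> {}"
    unfolding v_def by (rule ts(4))
  then consider "inside P \<inter> \<Phi> ` sector h \<beta> u \<noteq> {}" | "inside P \<inter> \<Phi> ` sector h (2*pi - \<beta>) v \<noteq> {}" by blast
  then show False
  proof cases
    case 1
    have "\<Phi> ` sector h \<beta> u \<subseteq> inside P"
      by (rule sub) (use 1 ts(1) connected_sector_image[OF u \<beta>'(1,3)] in \<open>auto simp: P_def\<close>)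
    then show False by (rule sector_not_inside[OF u h \<beta> subset_trans[OF closure_mono cl]])
  next
    case 2
    have "\<Phi> ` sector h (2*pi - \<beta>) v \<subseteq> inside P"
      by (rule sub) (use 2 ts(2) \<beta>' connected_sector_image[OF v, of "2*pi - \<beta>" h] in \<open>auto simp: P_def v_def\<close>)
    then show False
      by (intro sector_not_inside[OF v h _ _ subset_trans[OF closure_mono cl], of "2*pi - \<beta>"]) (use \<beta> in auto)
  qed
qed

text \<open>A spoke whose direction is 2 h away from both sides of the sector runs, between its two
  ends, through the image of the sector. This is how information about sectors reaches points of the
  boundary.\<close>

lemma spoke_end_in_closure:
  assumes u: "cmod u = 1" and q: "spoke h (u * cis \<theta>) q" and \<theta>: "2 * h \<le> \<theta>" "\<theta> \<le> \<beta> - 2 * h"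
  shows "pathfinish q \<in> closure (\<Phi> ` sector h \<beta> u)"
proof -
  have ar: "arc q" "pathstart q = \<Phi> 0" using q by (auto simp: spoke_def)
  have "q t \<in> \<Phi> ` sector h \<beta> u" if t: "t \<in> {0<..<1}" for t
  proof -
    have inj: "inj_on q {0..1}" using ar(1) by (simp add: arc_def)
    have "q t \<in> path_image q" using t by (auto simp: path_image_def)
    moreover have "q t \<noteq> pathfinish q" using inj_onD[OF inj, of t 1] t by (auto simp: pathfinish_def)
    moreover have "q t \<noteq> \<Phi> 0" using inj_onD[OF inj, of t 0] t ar(2) by (auto simp: pathstart_def)
    moreover have "q t \<in> D" using spoke_D[OF q calculation(1,2)] .
    moreover have "\<Psi> (q t) \<noteq> 0" using \<Phi>\<Psi>[OF calculation(4)] calculation(3) by auto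
    ultimately have "\<Psi> (q t) \<in> sector h \<beta> u" by (intro spoke_in_sector[OF u q \<theta>]) auto
    then show ?thesis using \<Phi>\<Psi>[OF \<open>q t \<in> D\<close>] by (metis imageI)
  qed
  then have "q ` {0<..<1} \<subseteq> \<Phi> ` sector h \<beta> u" by blast
  moreover have "q ` closure {0<..<1} \<subseteq> closure (\<Phi> ` sector h \<beta> u)"
  proof (rule image_closure_subset)
    show "continuous_on (closure {0<..<1}) q" using arc_imp_path[OF ar(1)] by (simp add: path_def)
    show "q ` {0<..<1} \<subseteq> closure (\<Phi> ` sector h \<beta> u)" by (rule subset_trans[OF calculation closure_subset])
  qed simp
  ultimately show ?thesis by (auto simp: pathfinish_def)
qed

text \<open>The spokes \<open>q0\<close> and \<open>q1\<close> form a crosscut of D, which splits it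
  into two regions; on \<open>\<Gamma>\<close> the closure of one sees only parameters up to t1, the
  other only parameters from t1 on. Each sector image lies in one region, and the two sectors lie in
  different ones. So the ends of all spokes in one sector have parameters on the same side of t1.
  The orientation of \<open>\<gamma>\<close> relative to the disc is unknown, hence the truth value
  b.\<close>

lemma crosscut:
  assumes \<gamma>: "simple_path \<gamma>" "pathfinish \<gamma> = pathstart \<gamma>" "path_image \<gamma> = \<Gamma>"
    and u: "cmod u = 1" and h: "0 < h" "h < pi/2" and \<beta>: "4 * h \<le> \<beta>" "\<beta> \<le> 2 * pi - 4 * h"
    and q0: "spoke h u q0" "pathfinish q0 = \<gamma> 0"
    and q1: "spoke h (u * cis \<beta>) q1" "pathfinish q1 = \<gamma> t1" "0 < t1" "t1 < 1"
  obtains b where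
    "\<forall>\<theta> q t. 2 * h \<le> \<theta> \<and> \<theta> \<le> \<beta> - 2 * h \<and> spoke h (u * cis \<theta>) q \<and>
       pathfinish q = \<gamma> t \<and> 0 < t \<and> t < 1 \<and> t \<noteq> t1 \<longrightarrow> (t < t1 \<longleftrightarrow> b)"
    "\<forall>\<theta> q t. 2 * h \<le> \<theta> \<and> \<theta> \<le> (2*pi - \<beta>) - 2 * h \<and> spoke h (u * cis \<beta> * cis \<theta>) q \<and>
       pathfinish q = \<gamma> t \<and> 0 < t \<and> t < 1 \<and> t \<noteq> t1 \<longrightarrow> (t < t1 \<longleftrightarrow> \<not> b)"
proof -
  have \<beta>': "0 < \<beta>" "\<beta> < 2 * pi" "2*h \<le> \<beta>" "\<beta> \<le> 2*pi - 2*h" using h \<beta> by auto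
  define a where "a = \<gamma> 0"
  define b where "b = \<gamma> t1"
  have \<gamma>inj: "s = t \<or> s = 0 \<and> t = 1 \<or> s = 1 \<and> t = 0" if "\<gamma> s = \<gamma> t" "s \<in> {0..1}" "t \<in> {0..1}" for s t
    using \<gamma>(1) that unfolding simple_path_def loop_free_def by blast
  have ab: "a \<noteq> b" using \<gamma>inj[of 0 t1] q1(3,4) by (auto simp: a_def b_def)
  have ar: "arc q0" "arc q1" "pathstart q0 = \<Phi> 0" "pathstart q1 = \<Phi> 0" using q0 q1 by (auto simp: spoke_def)
  have \<gamma>1: "\<gamma> 1 = a" using \<gamma>(2) by (simp add: a_def pathfinish_def pathstart_def)
  define C where "C = reversepath q0 +++ q1"
  have fin: "pathfinish q0 = a" "pathfinish q1 = b" using q0 q1 by (auto simp: a_def b_def)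
  have ab\<Gamma>: "a \<in> \<Gamma>" "b \<in> \<Gamma>" using spoke_pathfinish(1)[OF q0(1)] spoke_pathfinish(1)[OF q1(1)] fin by auto
  have q0D: "w \<in> D" if "w \<in> path_image q0" "w \<noteq> a" for w using spoke_D[OF q0(1) that(1)] that(2) fin by simp
  have q1D: "w \<in> D" if "w \<in> path_image q1" "w \<noteq> b" for w using spoke_D[OF q1(1) that(1)] that(2) fin by simp
  have D\<Gamma>: "w \<notin> \<Gamma>" if "w \<in> D" for w using D_props(6) that by blast
  have meet: "path_image q0 \<inter> path_image q1 \<subseteq> {\<Phi> 0}"
  proof
    fix w assume w: "w \<in> path_image q0 \<inter> path_image q1"
    have "w \<noteq> a" using w q1D[of a] ab ab\<Gamma> D\<Gamma> by auto
    moreover have "w \<noteq> b" using w q0D[of b] ab ab\<Gamma> D\<Gamma> by auto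
    ultimately show "w \<in> {\<Phi> 0}" using spokes_meet[OF u \<beta>'(3,4) q0(1) q1(1)] w fin by auto
  qed
  have C: "arc C" "pathstart C = a" "pathfinish C = b" "path_image C = path_image q0 \<union> path_image q1"
    unfolding C_def using ar meet fin
    by (auto intro!: arc_join simp: arc_reversepath path_image_join)
  have C\<Gamma>: "path_image C \<inter> \<Gamma> = {a, b}"
    using q0D q1D D\<Gamma> ab\<Gamma> C pathstart_in_path_image[of C] pathfinish_in_path_image[of C] by auto
  define g1 where "g1 = subpath 0 t1 \<gamma>"
  define g2 where "g2 = subpath 1 t1 \<gamma>"
  have g1: "pathstart g1 = a" "pathfinish g1 = b" "path_image g1 = \<gamma> ` {0..t1}"
    using q1 by (auto simp: g1_def a_def b_def path_image_subpath)
  have g2: "pathstart g2 = a" "pathfinish g2 = b" "path_image g2 = \<gamma> ` {t1..1}"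
    using q1 \<gamma>1 by (auto simp: g2_def a_def b_def path_image_subpath)
  have sp: "simple_path g1" "simple_path g2"
    unfolding g1_def g2_def using \<gamma>(1) q1 by (auto intro: simple_path_subpath)
  have arg: "arc g1" "arc g2" using sp ab g1 g2 by (auto intro: simple_path_imp_arc)
  have un: "path_image g1 \<union> path_image g2 = \<Gamma>"
  proof -
    have "{0..t1} \<union> {t1..1} = {0..1}" using q1 by auto
    moreover have "path_image \<gamma> = \<gamma> ` {0..1}" by (simp add: path_image_def)
    ultimately show ?thesis unfolding g1(3) g2(3) \<gamma>(3)[symmetric] image_Un[symmetric] by simp
  qed
  have g12: "path_image g1 \<inter> path_image g2 = {a, b}"
  proof
    show "path_image g1 \<inter> path_image g2 \<subseteq> {a, b}"
    proof
      fix w assume "w \<in> path_image g1 \<inter> path_image g2"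
      then obtain s t where st: "s \<in> {0..t1}" "t \<in> {t1..1}" "w = \<gamma> s" "w = \<gamma> t" unfolding g1(3) g2(3) by blast
      then have "s = t \<or> s = 0 \<and> t = 1 \<or> s = 1 \<and> t = 0" using \<gamma>inj[of s t] q1 by auto
      then have "s = t1 \<or> s = 0" using st q1 by auto
      then show "w \<in> {a, b}" using st by (auto simp: a_def b_def)
    qed
    show "{a, b} \<subseteq> path_image g1 \<inter> path_image g2"
      using pathstart_in_path_image[of g1] pathfinish_in_path_image[of g1]
        pathstart_in_path_image[of g2] pathfinish_in_path_image[of g2] g1 g2 by auto
  qed
  have gC: "path_image g1 \<inter> path_image C = {a, b}" "path_image g2 \<inter> path_image C = {a, b}"
    using un C\<Gamma> g12 by blast+
  have "\<Phi> 0 \<in> path_image C" using C ar pathstart_in_path_image[of q0] by auto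
  then have ne: "path_image C \<inter> inside (path_image g1 \<union> path_image g2) \<noteq> {}"
    unfolding un using \<Phi>_in[of 0] by auto
  define I1 where "I1 = inside (path_image g1 \<union> path_image C)"
  define I2 where "I2 = inside (path_image g2 \<union> path_image C)"
  \<comment> \<open>The two arcs of \<open>\<Gamma>\<close> and the crosscut form a theta
    curve.\<close>
  have split: "I1 \<inter> I2 = {}" "I1 \<union> I2 \<union> (path_image C - {a, b}) = D"
    unfolding I1_def I2_def un[symmetric]
    by (rule split_inside_simple_closed_curve[OF sp(1) g1(1,2) sp(2) g2(1,2) arc_imp_simple_path[OF C(1)] C(2,3) ab g12 gC ne]; assumption)+
  note L1 = simple_path_arcs_loop[OF arg(1) C(1)] and L2 = simple_path_arcs_loop[OF arg(2) C(1)]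
  have J1: "open I1" "frontier I1 = path_image g1 \<union> path_image C"
    using Jordan_inside_outside[OF L1(1,2)] L1(3) gC g1 C unfolding I1_def by simp_all
  have J2: "open I2" "frontier I2 = path_image g2 \<union> path_image C"
    using Jordan_inside_outside[OF L2(1,2)] L2(3) gC g2 C unfolding I2_def by simp_all
  have cl1: "closure I1 \<inter> \<Gamma> \<subseteq> path_image g1"
    using closure_Un_frontier[of I1] J1(2) split(2) D\<Gamma> C\<Gamma> g12 by blast
  have cl2: "closure I2 \<inter> \<Gamma> \<subseteq> path_image g2"
    using closure_Un_frontier[of I2] J2(2) split(2) D\<Gamma> C\<Gamma> g12 by blast
  define v where "v = u * cis \<beta>"
  have v: "cmod v = 1" using u by (simp add: v_def norm_mult)
  define A where "A = \<Phi> ` sector h \<beta> u"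
  define A' where "A' = \<Phi> ` sector h (2*pi - \<beta>) v"
  note ts = two_spokes[OF u \<beta>'(1,2) q0(1) q1(1), folded v_def, folded A_def A'_def, folded C(4)]
  have con: "connected A" "connected A'" unfolding A_def A'_def
    using connected_sector_image[OF u \<beta>'(1,3)] connected_sector_image[OF v, of "2*pi - \<beta>" h] \<beta>' by auto
  have in12: "S \<subseteq> I1 \<or> S \<subseteq> I2" if "connected S" "S \<subseteq> D" "S \<inter> path_image C = {}" for S
  proof -
    have "S \<subseteq> I1 \<union> I2" using that(2,3) split(2) by blast
    then show ?thesis using connectedD[OF that(1) J1(1) J2(1)] split(1) by blast
  qed
  have "A \<subseteq> I1 \<or> A \<subseteq> I2" "A' \<subseteq> I1 \<or> A' \<subseteq> I2"
    by (rule in12; use con ts sector_image_D[OF u] sector_image_D[OF v] in \<open>auto simp: A_def A'_def\<close>)+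
  \<comment> \<open>The point of \<open>q1\<close> at modulus 1/4 belongs to the frontier of both
    regions, so each region meets one of the two sector images.\<close>
  moreover have "\<not> (A \<subseteq> I1 \<and> A' \<subseteq> I1)"
  proof
    assume *: "A \<subseteq> I1 \<and> A' \<subseteq> I1"
    have "I2 \<inter> (A \<union> A') \<noteq> {}"
    proof (rule ts(4))
      show "\<Phi> (of_real (1/4) * v) \<in> closure I2" using ts(3) J2(2) C(4) by (auto simp: frontier_def)
      show "I2 \<inter> path_image q1 = {}" using C(4) inside_no_overlap[of "path_image g2 \<union> path_image C"] unfolding I2_def by blast
    qed
    then show False using * split(1) by blast
  qed
  moreover have "\<not> (A \<subseteq> I2 \<and> A' \<subseteq> I2)"
  proof
    assume *: "A \<subseteq> I2 \<and> A' \<subseteq> I2"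
    have "I1 \<inter> (A \<union> A') \<noteq> {}"
    proof (rule ts(4))
      show "\<Phi> (of_real (1/4) * v) \<in> closure I1" using ts(3) J1(2) C(4) by (auto simp: frontier_def)
      show "I1 \<inter> path_image q1 = {}" using C(4) inside_no_overlap[of "path_image g1 \<union> path_image C"] unfolding I1_def by blast
    qed
    then show False using * split(1) by blast
  qed
  ultimately have AA: "A \<subseteq> I1 \<and> A' \<subseteq> I2 \<or> A \<subseteq> I2 \<and> A' \<subseteq> I1" by blast
  have side1: "t < t1" if "\<gamma> t \<in> closure S" "S \<subseteq> I1" "0 < t" "t < 1" "t \<noteq> t1" for t S
  proof -
    have "\<gamma> t \<in> path_image \<gamma>" using that by (auto simp: path_image_def)
    then have "\<gamma> t \<in> \<Gamma>" using \<gamma>(3) by simp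
    then have "\<gamma> t \<in> path_image g1" using cl1 that closure_mono[OF that(2)] by blast
    then obtain s where s: "s \<in> {0..t1}" "\<gamma> t = \<gamma> s" unfolding g1(3) by blast
    then show ?thesis using \<gamma>inj[of t s] that q1 by auto
  qed
  have side2: "t1 < t" if "\<gamma> t \<in> closure S" "S \<subseteq> I2" "0 < t" "t < 1" "t \<noteq> t1" for t S
  proof -
    have "\<gamma> t \<in> path_image \<gamma>" using that by (auto simp: path_image_def)
    then have "\<gamma> t \<in> \<Gamma>" using \<gamma>(3) by simp
    then have "\<gamma> t \<in> path_image g2" using cl2 that closure_mono[OF that(2)] by blast
    then obtain s where s: "s \<in> {t1..1}" "\<gamma> t = \<gamma> s" unfolding g2(3) by blast
    then show ?thesis using \<gamma>inj[of t s] that q1 by auto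
  qed
  show ?thesis
  proof (rule that[of "A \<subseteq> I1"]; intro allI impI; elim conjE)
    fix \<theta> q t assume *: "2 * h \<le> \<theta>" "\<theta> \<le> \<beta> - 2 * h" "spoke h (u * cis \<theta>) q" "pathfinish q = \<gamma> t" "0 < t" "t < 1" "t \<noteq> t1"
    have cl: "\<gamma> t \<in> closure A" using spoke_end_in_closure[OF u *(3,1,2)] *(4) by (simp add: A_def)
    show "t < t1 \<longleftrightarrow> A \<subseteq> I1"
    proof (cases "A \<subseteq> I1")
      case True
      then show ?thesis using side1[OF cl True *(5-7)] by simp
    next
      case False
      then have "A \<subseteq> I2" using AA by blast
      then show ?thesis using side2[OF cl _ *(5-7)] False by simp
    qed
  next
    fix \<theta> q t assume *: "2 * h \<le> \<theta>" "\<theta> \<le> (2*pi - \<beta>) - 2 * h" "spoke h (u * cis \<beta> * cis \<theta>) q" "pathfinish q = \<gamma> t" "0 < t" "t < 1" "t \<noteq> t1"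
    have cl: "\<gamma> t \<in> closure A'" using spoke_end_in_closure[OF v *(3)[folded v_def] *(1,2)] *(4) by (simp add: A'_def)
    show "t < t1 \<longleftrightarrow> \<not> A \<subseteq> I1"
    proof (cases "A \<subseteq> I1")
      case True
      then have "A' \<subseteq> I2" using AA ts \<open>\<not> (A \<subseteq> I1 \<and> A' \<subseteq> I1)\<close> by blast
      then show ?thesis using side2[OF cl _ *(5-7)] True by simp
    next
      case False
      then have "A' \<subseteq> I1" using AA by blast
      then show ?thesis using side1[OF cl _ *(5-7)] False by simp
    qed
  qed
qed

end

text \<open>The second clause of \<open>rectifiable_path\<close> with its bound made a parameter, so
  that constants can be tracked.\<close>

definition variation_le :: "(real \<Rightarrow> 'a::metric_space) \<Rightarrow> real \<Rightarrow> bool" where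
  "variation_le g L \<longleftrightarrow> (\<forall>n. \<forall>t :: nat \<Rightarrow> real.
     (\<forall>i\<le>n. t i \<in> {0..1}) \<and> (\<forall>i<n. t i \<le> t (Suc i)) \<longrightarrow>
     (\<Sum>i<n. dist (g (t i)) (g (t (Suc i)))) \<le> L)"

lemma variation_leD:
  assumes "variation_le g L" "\<And>i. i \<le> n \<Longrightarrow> t i \<in> {0..1}" "\<And>i. i < n \<Longrightarrow> t i \<le> t (Suc i)"
  shows "(\<Sum>i<n. dist (g (t i)) (g (t (Suc i)))) \<le> L"
  using assms unfolding variation_le_def by blast

lemma variation_le_decreasing:
  assumes "variation_le g L" "\<And>i. i \<le> n \<Longrightarrow> t i \<in> {0..1}" "\<And>i. i < n \<Longrightarrow> t (Suc i) \<le> t i"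
  shows "(\<Sum>i<n. dist (g (t i)) (g (t (Suc i)))) \<le> L"
proof -
  define s where "s i = t (n - i)" for i
  have "(\<Sum>i<n. dist (g (t i)) (g (t (Suc i)))) = (\<Sum>i<n. dist (g (t (n - Suc i))) (g (t (Suc (n - Suc i)))))"
    by (rule sum.nat_diff_reindex[symmetric])
  also have "\<dots> = (\<Sum>i<n. dist (g (s i)) (g (s (Suc i))))"
  proof (rule sum.cong[OF refl])
    fix i assume "i \<in> {..<n}"
    then have "Suc (n - Suc i) = n - i" by auto
    then show "dist (g (t (n - Suc i))) (g (t (Suc (n - Suc i)))) = dist (g (s i)) (g (s (Suc i)))"
      by (simp add: s_def dist_commute)
  qed
  also have "\<dots> \<le> L"
  proof (rule variation_leD[OF assms(1)])
    show "s i \<le> s (Suc i)" if "i < n" for i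
    proof -
      have "n - i = Suc (n - Suc i)" "n - Suc i < n" using that by auto
      then show ?thesis using assms(3)[of "n - Suc i"] by (simp add: s_def)
    qed
  qed (use assms(2) in \<open>simp add: s_def\<close>)
  finally show ?thesis .
qed

lemma variation_le_dist:
  assumes "variation_le g L" "s \<in> {0..1}" "t \<in> {0..1}"
  shows "dist (g s) (g t) \<le> L"
proof -
  have *: "dist (g s) (g t) \<le> L" if "s \<in> {0..1}" "t \<in> {0..1}" "s \<le> t" for s t
    using variation_leD[OF assms(1), of 1 "\<lambda>i. if i = 0 then s else t"] that by auto
  show ?thesis
  proof (cases "s \<le> t")
    case False
    then show ?thesis using *[of t s] assms by (simp add: dist_commute)
  qed (use * assms in auto)
qed

text \<open>The shifted times a + t are split at the seam into the clamped sequences x, before it,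
  and y, after it. Both are monotone and cost at most L; the single step across the seam is divided
  at g 1 = g 0.\<close>

lemma variation_le_shiftpath:
  assumes g: "variation_le g L" "pathfinish g = pathstart g" and a: "a \<in> {0..1}"
  shows "variation_le (shiftpath a g) (2 * L)"
  unfolding variation_le_def
proof (intro allI impI, elim conjE)
  fix n and t :: "nat \<Rightarrow> real"
  assume t: "\<forall>i\<le>n. t i \<in> {0..1}" "\<forall>i<n. t i \<le> t (Suc i)"
  define x where "x i = min (a + t i) 1" for i
  define y where "y i = max (a + t i - 1) 0" for i
  have g01: "g 0 = g 1" using g(2) by (simp add: pathfinish_def pathstart_def)
  have le: "dist (shiftpath a g (t i)) (shiftpath a g (t (Suc i))) \<le>
      dist (g (x i)) (g (x (Suc i))) + dist (g (y i)) (g (y (Suc i)))" if "i < n" for i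
  proof -
    have m: "t i \<le> t (Suc i)" using t(2) that by blast
    consider "a + t (Suc i) \<le> 1" | "a + t i \<le> 1" "1 < a + t (Suc i)" | "1 < a + t i" by linarith
    then show ?thesis
    proof cases
      case 1
      then show ?thesis using m by (simp add: shiftpath_def x_def y_def)
    next
      case 2
      have "dist (g (a + t i)) (g (a + t (Suc i) - 1)) \<le> dist (g (a + t i)) (g 1) + dist (g 1) (g (a + t (Suc i) - 1))"
        by (rule dist_triangle)
      then show ?thesis using 2 g01 by (simp add: shiftpath_def x_def y_def)
    next
      case 3
      then show ?thesis using m by (simp add: shiftpath_def x_def y_def)
    qed
  qed
  have "(\<Sum>i<n. dist (shiftpath a g (t i)) (shiftpath a g (t (Suc i)))) \<le>
      (\<Sum>i<n. dist (g (x i)) (g (x (Suc i)))) + (\<Sum>i<n. dist (g (y i)) (g (y (Suc i))))"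
    unfolding sum.distrib[symmetric] using le by (intro sum_mono) auto
  also have "\<dots> \<le> L + L"
  proof (intro add_mono variation_leD[OF g(1)])
    fix i
    show "x i \<in> {0..1}" "y i \<in> {0..1}" if "i \<le> n"
      using a t(1)[rule_format, OF that] by (auto simp: x_def y_def)
    show "x i \<le> x (Suc i)" "y i \<le> y (Suc i)" if "i < n"
      using t(2)[rule_format, OF that] by (auto simp: x_def y_def)
  qed
  finally show "(\<Sum>i<n. dist (shiftpath a g (t i)) (shiftpath a g (t (Suc i)))) \<le> 2 * L" by simp
qed

text \<open>The hypothesis at j = 1 puts all later values on one side of \<open>t 1\<close>.
  Comparing \<open>t 1\<close> with \<open>t i\<close> shows that the truth value at i is the same
  as at 1, and this value then determines whether \<open>t (Suc i)\<close> lies above or below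
  \<open>t i\<close>.\<close>

lemma monotone_if_nested:
  fixes t :: "nat \<Rightarrow> real"
  assumes distinct: "\<And>i j. 1 \<le> i \<Longrightarrow> i < j \<Longrightarrow> j \<le> n \<Longrightarrow> t i \<noteq> t j"
    and nested: "\<And>j. 1 \<le> j \<Longrightarrow> j \<le> n \<Longrightarrow> \<exists>b. (\<forall>i. 1 \<le> i \<and> i < j \<longrightarrow> (t i < t j \<longleftrightarrow> b)) \<and>
        (\<forall>k. j < k \<and> k \<le> n \<longrightarrow> (t k < t j \<longleftrightarrow> \<not> b))"
  shows "(\<forall>i. 1 \<le> i \<and> i < n \<longrightarrow> t i \<le> t (Suc i)) \<or> (\<forall>i. 1 \<le> i \<and> i < n \<longrightarrow> t (Suc i) \<le> t i)"
proof (cases "n \<ge> 1")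
  case True
  obtain b where b: "\<And>k. 1 < k \<Longrightarrow> k \<le> n \<Longrightarrow> (t k < t 1 \<longleftrightarrow> \<not> b)"
    using nested[of 1] True by auto
  have step: "t (Suc i) < t i \<longleftrightarrow> \<not> b" if i: "1 \<le> i" "i < n" for i
  proof (cases "i = 1")
    case True
    then show ?thesis using b[of "Suc i"] i by simp
  next
    case False
    have "i \<le> n" using i by simp
    obtain b' where b': "\<forall>j. 1 \<le> j \<and> j < i \<longrightarrow> (t j < t i \<longleftrightarrow> b')" "\<forall>k. i < k \<and> k \<le> n \<longrightarrow> (t k < t i \<longleftrightarrow> \<not> b')"
      using nested[OF i(1) \<open>i \<le> n\<close>] by (elim exE conjE)
    have "t 1 < t i \<longleftrightarrow> b'" using b'(1)[THEN spec, of 1] False i by simp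
    moreover have "t i < t 1 \<longleftrightarrow> \<not> b" using b[of i] False i by simp
    moreover have "t 1 \<noteq> t i" using distinct[of 1 i] False i by simp
    ultimately have "b = b'" by auto
    then show ?thesis using b'(2)[THEN spec, of "Suc i"] i by simp
  qed
  show ?thesis
  proof (cases b)
    case True
    then show ?thesis using step by (auto simp: not_less)
  next
    case False
    then show ?thesis using step by (auto intro: less_imp_le)
  qed
qed auto

section \<open>Polygons inscribed in the images of circles\<close>

context jordan_conformal
begin

text \<open>The loop is shifted so as to start at the end of the spoke number 0, which doubles the
  variation bound to 2 L. By \<open>crosscut\<close>, the parameters of the other ends are monotone
  in one direction, so the chords between them add up to at most 2 L. The two chords at the starting
  point contribute at most 2 L each. The spacing of the directions is 8 h.\<close>

lemma spoke_ends_sum: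
  assumes L: "variation_le g L" and N: "N \<ge> 2" and u: "cmod u = 1" and h: "h = pi / (4 * N)"
    and q: "\<And>k. k < N \<Longrightarrow> spoke h (u * cis (2 * pi * k / N)) (q k)"
  shows "(\<Sum>k<N. dist (pathfinish (q k)) (pathfinish (q (Suc k mod N)))) \<le> 6 * L"
proof -
  define c where "c k = pathfinish (q k)" for k
  have N0: "real N > 0" using N by simp
  have h0: "0 < h" "h < pi/2"
  proof -
    show "0 < h" using N0 by (simp add: h)
    have "pi * 2 < pi * (4 * real N)" using N by (intro mult_strict_left_mono) auto
    then show "h < pi/2" using N0 by (simp add: h field_simps)
  qed
  have hN: "4 * h = pi / N" by (simp add: h)
  have mono: "2 * pi * real i / N \<le> 2 * pi * real j / N" if "i \<le> j" for i j :: nat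
    using that by (intro divide_right_mono mult_left_mono) auto
  have full: "2 * pi * real N / N = 2 * pi" using N0 by simp
  have diff: "2 * pi * real j / N - 2 * pi * real i / N \<ge> 8 * h" if "i < j" for i j :: nat
  proof -
    have "2 * pi * real (Suc i) / N \<le> 2 * pi * real j / N" using that by (intro mono) simp
    moreover have "2 * pi * real (Suc i) / N = 2 * pi * real i / N + 8 * h"
      using N0 hN by (simp add: field_simps)
    ultimately show ?thesis by linarith
  qed
  have distinct: "c i \<noteq> c j" if "i < j" "j < N" for i j
    unfolding c_def
  proof (rule spokes_distinct_ends[OF _ h0])
    show "cmod (u * cis (2 * pi * i / N)) = 1" using u by (simp add: norm_mult)
    show "spoke h (u * cis (2 * pi * real i / real N)) (q i)" using q[of i] that by simp
    show "spoke h (u * cis (2 * pi * real i / real N) * cis (2 * pi * j / N - 2 * pi * i / N)) (q j)"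
      using q[of j] that by (simp add: mult.assoc cis_mult)
    show "4 * h \<le> 2 * pi * j / N - 2 * pi * i / N" using diff[OF that(1)] h0 by linarith
    have "0 \<le> 2 * pi * real i / real N" by simp
    then show "2 * pi * j / N - 2 * pi * i / N \<le> 2 * pi - 4 * h" using diff[OF that(2)] full h0 by linarith
  qed
  have c\<Gamma>: "c k \<in> \<Gamma>" if "k < N" for k using spoke_pathfinish(1)[OF q[OF that]] by (simp add: c_def)
  have "c 0 \<in> \<Gamma>" using c\<Gamma> N by simp
  then obtain a where a: "a \<in> {0..1}" "g a = c 0" by (auto simp: path_image_def)
  define \<gamma> where "\<gamma> = shiftpath a g"
  have \<gamma>: "simple_path \<gamma>" "pathfinish \<gamma> = pathstart \<gamma>" "path_image \<gamma> = \<Gamma>"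
    unfolding \<gamma>_def using simple_path_shiftpath[OF simple loop] path_image_shiftpath[OF a(1) loop]
      closed_shiftpath[OF loop a(1)] a(1) by simp_all
  have \<gamma>0: "\<gamma> 0 = c 0" using a by (simp add: \<gamma>_def shiftpath_def)
  have \<gamma>1: "\<gamma> 1 = c 0" using \<gamma>(2) \<gamma>0 by (simp add: pathfinish_def pathstart_def)
  have var: "variation_le \<gamma> (2 * L)" unfolding \<gamma>_def by (rule variation_le_shiftpath[OF L loop a(1)])
  have "\<exists>t. 0 < t \<and> t < 1 \<and> \<gamma> t = c k" if "1 \<le> k" "k < N" for k
  proof -
    have "c k \<in> path_image \<gamma>" using c\<Gamma>[OF that(2)] \<gamma>(3) by simp
    then obtain t where t: "t \<in> {0..1}" "\<gamma> t = c k" by (auto simp: path_image_def)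
    have "c k \<noteq> c 0" using distinct[of 0 k] that by auto
    then have "t \<noteq> 0" "t \<noteq> 1" using t \<gamma>0 \<gamma>1 by auto
    then show ?thesis using t by (intro exI[of _ t]) auto
  qed
  then obtain t where t: "\<And>k. 1 \<le> k \<Longrightarrow> k < N \<Longrightarrow> 0 < t k \<and> t k < 1 \<and> \<gamma> (t k) = c k" by metis
  define n where "n = N - 1"
  have tn: "0 < t k" "t k < 1" "\<gamma> (t k) = c k" if "1 \<le> k" "k \<le> n" for k
    using t[of k] that N by (auto simp: n_def)
  have t_distinct: "t i \<noteq> t j" if "1 \<le> i" "i < j" "j \<le> n" for i j
  proof
    assume "t i = t j"
    moreover have "i \<le> n" "1 \<le> j" "j < N" using that N by (auto simp: n_def)
    ultimately show False using distinct[OF that(2)] tn(3)[of i] tn(3)[of j] that by simp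
  qed
  have nested: "\<exists>b. (\<forall>i. 1 \<le> i \<and> i < j \<longrightarrow> (t i < t j \<longleftrightarrow> b)) \<and> (\<forall>k. j < k \<and> k \<le> n \<longrightarrow> (t k < t j \<longleftrightarrow> \<not> b))"
    if j: "1 \<le> j" "j \<le> n" for j
  proof -
    have jN: "0 < j" "j < N" using j N by (auto simp: n_def)
    define \<beta> where "\<beta> = 2 * pi * j / N"
    have \<beta>: "4 * h \<le> \<beta>" "\<beta> \<le> 2 * pi - 4 * h"
      using diff[OF jN(1)] diff[OF jN(2)] full h0 by (auto simp: \<beta>_def)
    have q0: "spoke h u (q 0)" "pathfinish (q 0) = \<gamma> 0" using q[of 0] N \<gamma>0 by (auto simp: c_def)
    have qj: "spoke h (u * cis \<beta>) (q j)" "pathfinish (q j) = \<gamma> (t j)" using q[OF jN(2)] tn(3)[OF j] by (auto simp: \<beta>_def c_def)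
    obtain b where b:
      "\<forall>\<theta> q s. 2 * h \<le> \<theta> \<and> \<theta> \<le> \<beta> - 2 * h \<and> spoke h (u * cis \<theta>) q \<and>
         pathfinish q = \<gamma> s \<and> 0 < s \<and> s < 1 \<and> s \<noteq> t j \<longrightarrow> (s < t j \<longleftrightarrow> b)"
      "\<forall>\<theta> q s. 2 * h \<le> \<theta> \<and> \<theta> \<le> (2*pi - \<beta>) - 2 * h \<and> spoke h (u * cis \<beta> * cis \<theta>) q \<and>
         pathfinish q = \<gamma> s \<and> 0 < s \<and> s < 1 \<and> s \<noteq> t j \<longrightarrow> (s < t j \<longleftrightarrow> \<not> b)"
      by (rule crosscut[OF \<gamma> u h0 \<beta> q0 qj tn(1,2)[OF j]]) (rule that)
    show ?thesis
    proof (intro exI[of _ b] conjI allI impI; elim conjE)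
      fix i assume i: "1 \<le> i" "i < j"
      have iN: "0 < i" "i < N" "i \<le> n" using i j jN by auto
      show "t i < t j \<longleftrightarrow> b"
      proof (rule b(1)[THEN spec, THEN spec, THEN spec, THEN mp, of "2 * pi * i / N" "q i"], intro conjI)
        show "2 * h \<le> 2 * pi * i / N" using diff[OF iN(1)] h0 by simp
        show "2 * pi * i / N \<le> \<beta> - 2 * h" using diff[OF i(2)] h0 by (simp add: \<beta>_def)
      qed (use q[OF iN(2)] tn[OF i(1) iN(3)] t_distinct[OF i(1,2) j(2)] in \<open>auto simp: c_def\<close>)
    next
      fix k assume k: "j < k" "k \<le> n"
      have kN: "1 \<le> k" "k < N" using k j N by (auto simp: n_def)
      show "t k < t j \<longleftrightarrow> \<not> b"
      proof (rule b(2)[THEN spec, THEN spec, THEN spec, THEN mp, of "2 * pi * k / N - \<beta>" "q k"], intro conjI)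
        show "2 * h \<le> 2 * pi * k / N - \<beta>" using diff[OF k(1)] h0 by (simp add: \<beta>_def)
        show "2 * pi * k / N - \<beta> \<le> (2*pi - \<beta>) - 2 * h" using diff[OF kN(2)] full h0 by simp
        show "spoke h (u * cis \<beta> * cis (2 * pi * k / N - \<beta>)) (q k)"
          using q[OF kN(2)] by (simp add: mult.assoc cis_mult)
      qed (use tn[OF kN(1) k(2)] t_distinct[OF j(1) k] in \<open>auto simp: c_def\<close>)
    qed
  qed
  define f where "f k = dist (c k) (c (Suc k mod N))" for k
  have f_le: "f k \<le> 2 * L" if k: "k < N" for k
  proof -
    have ex: "\<exists>s\<in>{0..1}. \<gamma> s = c k" if "k < N" for k
      using c\<Gamma>[OF that] unfolding \<gamma>(3)[symmetric] by (auto simp: path_image_def)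
    obtain s s' where "s \<in> {0..1}" "s' \<in> {0..1}" "\<gamma> s = c k" "\<gamma> s' = c (Suc k mod N)"
      using ex[OF k] ex[of "Suc k mod N"] N by auto
    then show ?thesis using variation_le_dist[OF var, of s s'] by (simp add: f_def)
  qed
  define s where "s i = t (Suc i)" for i
  \<comment> \<open>The N - 1 ends other than the starting point have m chords between consecutive
    ones; \<open>f 0\<close> and \<open>f (Suc m)\<close> are the chords at the starting
    point.\<close>
  obtain m where m: "N = Suc (Suc m)" using N by (metis add_2_eq_Suc le_Suc_ex)
  have s01: "s i \<in> {0..1}" if "i \<le> m" for i using tn[of "Suc i"] that by (auto simp: s_def n_def m)
  have "(\<forall>i<m. s i \<le> s (Suc i)) \<or> (\<forall>i<m. s (Suc i) \<le> s i)"
    using monotone_if_nested[OF t_distinct nested] by (auto simp: s_def n_def m)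
  then have "(\<Sum>i<m. dist (\<gamma> (s i)) (\<gamma> (s (Suc i)))) \<le> 2 * L"
  proof
    assume "\<forall>i<m. s i \<le> s (Suc i)"
    then show ?thesis by (intro variation_leD[OF var s01]) auto
  next
    assume "\<forall>i<m. s (Suc i) \<le> s i"
    then show ?thesis by (intro variation_le_decreasing[OF var s01]) auto
  qed
  also have "(\<Sum>i<m. dist (\<gamma> (s i)) (\<gamma> (s (Suc i)))) = (\<Sum>i<m. f (Suc i))"
    by (rule sum.cong) (auto simp: s_def f_def tn n_def m)
  finally have "(\<Sum>i<m. f (Suc i)) \<le> 2 * L" .
  moreover have "(\<Sum>k<N. f k) = f 0 + (\<Sum>i<m. f (Suc i)) + f (Suc m)"
    unfolding m sum.lessThan_Suc[of f "Suc m"] sum.lessThan_Suc_shift[of f m] ..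
  ultimately have "(\<Sum>k<N. f k) \<le> 6 * L" using f_le[of 0] f_le[of "Suc m"] m by simp
  then show ?thesis by (simp add: f_def c_def)
qed

text \<open>Near the circle, the chords of the image differ little from the chords between ends of
  spokes. How near depends on N and on the error, but the bound does not, and the maximum principle
  carries it to all z in the disc.\<close>

lemma discrete_length_le:
  assumes L: "variation_le g L" and N: "N \<ge> 2" and z: "cmod z < 1"
  shows "(\<Sum>k<N. cmod (\<Phi> (z * cis (2 * pi * Suc k / N)) - \<Phi> (z * cis (2 * pi * k / N)))) \<le> 6 * L"
proof -
  define d where "d k z = \<Phi> (z * cis (2 * pi * Suc k / N)) - \<Phi> (z * cis (2 * pi * k / N))" for k z
  have N0: "real N > 0" using N by simp
  define h where "h = pi / (4 * real N)"
  have h0: "0 < h" "h < pi/2"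
  proof -
    show "0 < h" using N0 by (simp add: h_def)
    have "pi * 2 < pi * (4 * real N)" using N by (intro mult_strict_left_mono) auto
    then show "h < pi/2" using N0 by (simp add: h_def field_simps)
  qed
  have near: "\<exists>R<1. \<forall>z. R < cmod z \<and> cmod z < 1 \<longrightarrow> (\<Sum>k<N. cmod (d k z)) \<le> 6 * L + \<epsilon>" if "\<epsilon> > 0" for \<epsilon>
  proof -
    \<comment> \<open>There are N chords, each with an error at both ends.\<close>
    define \<epsilon>' where "\<epsilon>' = \<epsilon> / (2 * N)"
    have "\<epsilon>' > 0" using that N0 by (simp add: \<epsilon>'_def)
    obtain R where R: "R < 1" "\<forall>r u. R < r \<and> r < 1 \<and> cmod u = 1 \<longrightarrow>
       (\<exists>q. spoke h u q \<and> dist (\<Phi> (of_real r * u)) (pathfinish q) < \<epsilon>')"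
      by (rule spoke_exists[OF h0 \<open>\<epsilon>' > 0\<close>]) (rule that)
    show ?thesis
    proof (intro exI[of _ "max R 0"] conjI allI impI; (elim conjE)?)
      fix z assume z: "max R 0 < cmod z" "cmod z < 1"
      have "z \<noteq> 0" using z by auto
      define u where "u = z / of_real (cmod z)"
      have u: "cmod u = 1" "z = of_real (cmod z) * u" using \<open>z \<noteq> 0\<close> by (simp_all add: u_def norm_divide)
      have "\<exists>q. spoke h (u * cis (2 * pi * k / N)) q \<and>
          dist (\<Phi> (of_real (cmod z) * (u * cis (2 * pi * k / N)))) (pathfinish q) < \<epsilon>'" for k :: nat
        using R(2)[rule_format, of "cmod z" "u * cis (2 * pi * k / N)"] z u(1) by (simp add: norm_mult)
      then obtain q where q: "\<And>k. spoke h (u * cis (2 * pi * real k / N)) (q k)"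
        "\<And>k. dist (\<Phi> (of_real (cmod z) * (u * cis (2 * pi * real k / N)))) (pathfinish (q k)) < \<epsilon>'" by metis
      have p: "dist (\<Phi> (z * cis (2 * pi * real k / N))) (pathfinish (q k)) < \<epsilon>'" for k
        using q(2)[of k] by (simp only: mult.assoc[symmetric] u(2)[symmetric])
      have p': "dist (\<Phi> (z * cis (2 * pi * real (Suc k) / N))) (pathfinish (q (Suc k mod N))) < \<epsilon>'" if "k < N" for k
      proof (cases "Suc k = N")
        case True
        have "cis (2 * pi * real (Suc k) / N) = 1" unfolding True using N0 by simp
        then show ?thesis using p[of 0] True by simp
      next
        case False
        then show ?thesis using p[of "Suc k"] that by simp
      qed
      have "(\<Sum>k<N. cmod (d k z)) \<le> (\<Sum>k<N. dist (pathfinish (q k)) (pathfinish (q (Suc k mod N))) + 2 * \<epsilon>')"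
      proof (rule sum_mono)
        fix k assume "k \<in> {..<N}"
        then have "k < N" by simp
        have "cmod (d k z) = dist (\<Phi> (z * cis (2 * pi * Suc k / N))) (\<Phi> (z * cis (2 * pi * k / N)))"
          by (simp add: d_def dist_norm)
        also have "\<dots> \<le> dist (\<Phi> (z * cis (2 * pi * Suc k / N))) (pathfinish (q (Suc k mod N))) +
            (dist (pathfinish (q k)) (pathfinish (q (Suc k mod N))) + dist (\<Phi> (z * cis (2 * pi * k / N))) (pathfinish (q k)))"
          using dist_triangle[of "\<Phi> (z * cis (2 * pi * Suc k / N))" "\<Phi> (z * cis (2 * pi * k / N))" "pathfinish (q (Suc k mod N))"]
            dist_triangle[of "pathfinish (q (Suc k mod N))" "\<Phi> (z * cis (2 * pi * k / N))" "pathfinish (q k)"]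
            dist_commute[of "pathfinish (q (Suc k mod N))" "pathfinish (q k)"]
            dist_commute[of "pathfinish (q k)" "\<Phi> (z * cis (2 * pi * k / N))"]
            dist_commute[of "pathfinish (q (Suc k mod N))" "\<Phi> (z * cis (2 * pi * k / N))"]
          by linarith
        finally show "cmod (d k z) \<le> dist (pathfinish (q k)) (pathfinish (q (Suc k mod N))) + 2 * \<epsilon>'"
          using p[of k] p'[OF \<open>k < N\<close>] by linarith
      qed
      also have "\<dots> = (\<Sum>k<N. dist (pathfinish (q k)) (pathfinish (q (Suc k mod N)))) + \<epsilon>"
        using N0 by (simp add: sum.distrib \<epsilon>'_def)
      also have "\<dots> \<le> 6 * L + \<epsilon>"
        using spoke_ends_sum[OF L N u(1) h_def q(1)] by simp
      finally show "(\<Sum>k<N. cmod (d k z)) \<le> 6 * L + \<epsilon>" .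
    qed (use R in auto)
  qed
  have "(\<Sum>k<N. cmod (d k z)) \<le> 6 * L"
  proof (rule field_le_epsilon)
    fix \<epsilon> :: real assume "\<epsilon> > 0"
    obtain R where R: "R < 1" "\<forall>z. R < cmod z \<and> cmod z < 1 \<longrightarrow> (\<Sum>k<N. cmod (d k z)) \<le> 6 * L + \<epsilon>"
      using near[OF \<open>\<epsilon> > 0\<close>] by blast
    obtain r where r: "max R (cmod z) < r" "r < 1" using dense[of "max R (cmod z)" 1] R(1) z by auto
    have "0 \<le> cmod z" by simp
    then have "r > 0" using r by linarith
    \<comment> \<open>The sum of moduli is turned into the modulus of one holomorphic function H:
      the phases are frozen at the given z, so H bounds the sum from below everywhere and equals it
      at z.\<close>
    define e where "e k = cnj (sgn (d k z))" for k
    have e: "cmod (e k) \<le> 1" "e k * d k z = of_real (cmod (d k z))" for k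
    proof -
      show "cmod (e k) \<le> 1" by (simp add: e_def norm_sgn)
      show "e k * d k z = of_real (cmod (d k z))"
      proof (cases "d k z = 0")
        case False
        have "e k * d k z = (cnj (d k z) * d k z) / of_real (cmod (d k z))" by (simp add: e_def sgn_eq)
        also have "cnj (d k z) * d k z = of_real ((cmod (d k z))\<^sup>2)" by (simp only: complex_norm_square mult.commute)
        finally show ?thesis using False by (simp add: power2_eq_square)
      qed (simp add: e_def)
    qed
    define H where "H w = (\<Sum>k<N. e k * d k w)" for w
    have b: "w * cis x \<in> ball 0 1" if "w \<in> ball 0 1" for w x using that by (simp add: norm_mult)
    have hol: "(\<lambda>w. \<Phi> (w * cis x)) holomorphic_on ball 0 1" for x
      by (rule holomorphic_on_compose_gen[OF _ hol\<Phi>, of "\<lambda>w. w * cis x", unfolded o_def])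
        (use b in \<open>auto intro!: holomorphic_intros\<close>)
    have Hhol: "H holomorphic_on ball 0 1"
      unfolding H_def d_def by (intro holomorphic_intros hol)
    have sub: "cball 0 r \<subseteq> ball (0::complex) 1" using r by auto
    have "cmod (H z) \<le> 6 * L + \<epsilon>"
    proof (rule maximum_modulus_frontier[of H "ball 0 r"])
      show "H holomorphic_on interior (ball 0 r)"
        by (rule holomorphic_on_subset[OF Hhol]) (use sub in auto)
      show "continuous_on (closure (ball 0 r)) H"
        by (rule continuous_on_subset[OF holomorphic_on_imp_continuous_on[OF Hhol]]) (use sub \<open>r > 0\<close> in auto)
      fix w :: complex assume "w \<in> frontier (ball 0 r)"
      then have w: "cmod w = r" using \<open>r > 0\<close> by (auto simp: frontier_ball)
      have "cmod (H w) \<le> (\<Sum>k<N. cmod (e k * d k w))" unfolding H_def by (rule norm_sum)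
      also have "\<dots> \<le> (\<Sum>k<N. cmod (d k w))"
        by (rule sum_mono) (use e(1) in \<open>simp add: norm_mult mult_left_le_one_le\<close>)
      also have "\<dots> \<le> 6 * L + \<epsilon>" using R(2) w r by simp
      finally show "cmod (H w) \<le> 6 * L + \<epsilon>" .
    qed (use r in auto)
    moreover have "H z = of_real (\<Sum>k<N. cmod (d k z))" unfolding H_def e(2) by simp
    ultimately have "\<bar>\<Sum>k<N. cmod (d k z)\<bar> \<le> 6 * L + \<epsilon>" by (simp only: norm_of_real)
    then show "(\<Sum>k<N. cmod (d k z)) \<le> 6 * L + \<epsilon>" by linarith
  qed
  then show ?thesis by (simp add: d_def)
qed

end

section \<open>Means over circles\<close>

lemma riemann_sum_bound:
  fixes f :: "real \<Rightarrow> real" and n :: nat and a \<delta> \<epsilon> :: real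
  assumes "0 \<le> \<delta>" "continuous_on {a..a + n * \<delta>} f"
    and "\<And>x y. x \<in> {a..a + n * \<delta>} \<Longrightarrow> y \<in> {a..a + n * \<delta>} \<Longrightarrow> \<bar>x - y\<bar> \<le> \<delta> \<Longrightarrow> \<bar>f x - f y\<bar> \<le> \<epsilon>"
  shows "\<bar>\<delta> * (\<Sum>k<n. f (a + k * \<delta>)) - integral {a..a + n * \<delta>} f\<bar> \<le> \<epsilon> * n * \<delta>"
  using assms(2,3)
proof (induction n)
  case (Suc n)
  define x where "x = a + n * \<delta>"
  have x: "a \<le> x" "a + Suc n * \<delta> = x + \<delta>" using assms(1) by (auto simp: x_def algebra_simps)
  have sub: "{a..x} \<subseteq> {a..a + Suc n * \<delta>}" "{x..x + \<delta>} \<subseteq> {a..a + Suc n * \<delta>}" using x assms(1) by auto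
  have c1: "continuous_on {a..x} f" and c2: "continuous_on {x..x + \<delta>} f"
    using continuous_on_subset[OF Suc.prems(1)] sub by blast+
  have IH: "\<bar>\<delta> * (\<Sum>k<n. f (a + k * \<delta>)) - integral {a..x} f\<bar> \<le> \<epsilon> * n * \<delta>"
    unfolding x_def
  proof (rule Suc.IH)
    show "continuous_on {a..a + n * \<delta>} f" using c1 by (simp add: x_def)
    show "\<bar>f s - f t\<bar> \<le> \<epsilon>" if "s \<in> {a..a + n * \<delta>}" "t \<in> {a..a + n * \<delta>}" "\<bar>s - t\<bar> \<le> \<delta>" for s t
      using that sub(1) unfolding x_def by (intro Suc.prems(2)) blast+
  qed
  have "norm (integral {x..x + \<delta>} (\<lambda>t. f x - f t)) \<le> \<epsilon> * ((x + \<delta>) - x)"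
  proof (rule integral_bound)
    show "continuous_on {x..x + \<delta>} (\<lambda>t. f x - f t)" by (intro continuous_intros c2)
    show "norm (f x - f t) \<le> \<epsilon>" if "t \<in> {x..x + \<delta>}" for t
      unfolding real_norm_def by (rule Suc.prems(2)) (use that sub assms(1) in auto)
  qed (use assms(1) in simp)
  moreover have "integral {x..x + \<delta>} (\<lambda>t. f x - f t) = \<delta> * f x - integral {x..x + \<delta>} f"
    using assms(1) by (subst Henstock_Kurzweil_Integration.integral_diff)
      (auto intro: integrable_continuous_interval c2)
  ultimately have st: "\<bar>\<delta> * f x - integral {x..x + \<delta>} f\<bar> \<le> \<epsilon> * \<delta>" by simp
  have "integral {a..x} f + integral {x..x + \<delta>} f = integral {a..x + \<delta>} f"
    by (rule Henstock_Kurzweil_Integration.integral_combine)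
      (use x assms(1) Suc.prems(1) in \<open>auto intro!: integrable_continuous_interval\<close>)
  moreover have "\<delta> * (\<Sum>k<Suc n. f (a + k * \<delta>)) = \<delta> * (\<Sum>k<n. f (a + k * \<delta>)) + \<delta> * f x"
    by (simp add: x_def distrib_left)
  moreover have "\<epsilon> * Suc n * \<delta> = \<epsilon> * n * \<delta> + \<epsilon> * \<delta>" by (simp add: algebra_simps)
  ultimately show ?case using IH st unfolding x(2) by linarith
qed simp

text \<open>Uniform continuity of p' is used twice, for the Riemann sum of \<open>|p'|\<close> and
  for replacing each chord by the derivative times the step; each use costs
  \<open>\<epsilon> T\<close>, half of the allowed error e.\<close>

lemma length_integral_le:
  fixes p p' :: "real \<Rightarrow> complex" and T L :: real
  assumes deriv: "\<And>t. (p has_vector_derivative p' t) (at t)" and cont: "continuous_on UNIV p'"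
    and T: "0 < T"
    and le: "\<And>n. n \<ge> 2 \<Longrightarrow> (\<Sum>k<n. cmod (p (T * Suc k / n) - p (T * k / n))) \<le> L"
  shows "integral {0..T} (\<lambda>t. cmod (p' t)) \<le> L"
proof (rule field_le_epsilon)
  fix e :: real assume "e > 0"
  define \<epsilon> where "\<epsilon> = e / (2 * T)"
  have \<epsilon>: "\<epsilon> > 0" "2 * \<epsilon> * T = e" using \<open>e > 0\<close> T by (auto simp: \<epsilon>_def)
  have "uniformly_continuous_on {0..T} p'"
    by (intro compact_uniformly_continuous continuous_on_subset[OF cont]) auto
  then obtain d where d: "d > 0" "\<And>x y. x \<in> {0..T} \<Longrightarrow> y \<in> {0..T} \<Longrightarrow> dist y x < d \<Longrightarrow> dist (p' y) (p' x) < \<epsilon>"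
    using \<epsilon>(1) unfolding uniformly_continuous_on_def by metis
  obtain n :: nat where n: "n > max 2 (T / d)" using reals_Archimedean2 by blast
  have n2: "n \<ge> 2" and n0: "real n > 0" using n by auto
  define \<delta> where "\<delta> = T / n"
  have \<delta>: "0 < \<delta>" "\<delta> < d" "n * \<delta> = T"
  proof -
    show "0 < \<delta>" "n * \<delta> = T" using T n0 by (auto simp: \<delta>_def)
    have "T / d < n" using n by simp
    then have "T < n * d" using d(1) by (simp add: pos_divide_less_eq)
    then show "\<delta> < d" using n0 by (simp add: \<delta>_def pos_divide_less_eq mult.commute)
  qed
  have pcont: "continuous_on {0..T} (\<lambda>t. cmod (p' t))"
    by (intro continuous_intros continuous_on_subset[OF cont]) auto
  have "\<bar>\<delta> * (\<Sum>k<n. cmod (p' (0 + k * \<delta>))) - integral {0..0 + n * \<delta>} (\<lambda>t. cmod (p' t))\<bar> \<le> \<epsilon> * n * \<delta>"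
  proof (rule riemann_sum_bound)
    show "continuous_on {0..0 + n * \<delta>} (\<lambda>t. cmod (p' t))" using pcont \<delta>(3) by simp
    fix x y :: real assume xy: "x \<in> {0..0 + n * \<delta>}" "y \<in> {0..0 + n * \<delta>}" "\<bar>x - y\<bar> \<le> \<delta>"
    then have "dist (p' x) (p' y) < \<epsilon>" using \<delta> by (intro d(2)) (auto simp: dist_real_def)
    moreover have "\<bar>cmod (p' x) - cmod (p' y)\<bar> \<le> cmod (p' x - p' y)" by (rule norm_triangle_ineq3)
    ultimately show "\<bar>cmod (p' x) - cmod (p' y)\<bar> \<le> \<epsilon>" by (simp add: dist_norm)
  qed (use \<delta> in simp)
  then have R: "integral {0..T} (\<lambda>t. cmod (p' t)) \<le> \<delta> * (\<Sum>k<n. cmod (p' (k * \<delta>))) + \<epsilon> * T"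
    using \<delta>(3) by (simp add: mult.assoc)
  have st: "\<delta> * cmod (p' (k * \<delta>)) \<le> cmod (p (T * Suc k / n) - p (T * k / n)) + \<epsilon> * \<delta>" if "k < n" for k
  proof -
    define x where "x = k * \<delta>"
    have "real (Suc k) * \<delta> \<le> real n * \<delta>" using that \<delta>(1) by (intro mult_right_mono) auto
    then have x: "0 \<le> x" "x + \<delta> \<le> T" using \<delta> by (auto simp: x_def algebra_simps)
    have "(p' has_integral p (x + \<delta>) - p x) {x..x + \<delta>}"
      by (rule fundamental_theorem_of_calculus) (use \<delta>(1) deriv in \<open>auto intro: has_vector_derivative_at_within\<close>)
    then have I: "integral {x..x + \<delta>} p' = p (x + \<delta>) - p x" "p' integrable_on {x..x + \<delta>}"
      by (auto simp: has_integral_integrable_integral)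
    have "norm (integral {x..x + \<delta>} (\<lambda>t. p' x - p' t)) \<le> \<epsilon> * ((x + \<delta>) - x)"
    proof (rule integral_bound)
      show "continuous_on {x..x + \<delta>} (\<lambda>t. p' x - p' t)"
        by (intro continuous_intros continuous_on_subset[OF cont]) auto
      show "norm (p' x - p' t) \<le> \<epsilon>" if "t \<in> {x..x + \<delta>}" for t
        using d(2)[of t x] that x \<delta> by (auto simp: dist_norm dist_real_def)
    qed (use \<delta>(1) in simp)
    moreover have "integral {x..x + \<delta>} (\<lambda>t. p' x - p' t) = \<delta> *\<^sub>R p' x - (p (x + \<delta>) - p x)"
      using \<delta>(1) I by (subst Henstock_Kurzweil_Integration.integral_diff) auto
    ultimately have "cmod (\<delta> *\<^sub>R p' x - (p (x + \<delta>) - p x)) \<le> \<epsilon> * \<delta>" by simp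
    moreover have "cmod (\<delta> *\<^sub>R p' x) \<le> cmod (p (x + \<delta>) - p x) + cmod (\<delta> *\<^sub>R p' x - (p (x + \<delta>) - p x))"
      by (metis add.commute diff_add_cancel norm_triangle_ineq)
    moreover have "T * Suc k / n = x + \<delta>" "T * k / n = x" by (simp_all add: x_def \<delta>_def add_divide_distrib distrib_left mult.commute)
    ultimately show ?thesis using \<delta>(1) by (simp add: x_def)
  qed
  have "\<delta> * (\<Sum>k<n. cmod (p' (k * \<delta>))) \<le> (\<Sum>k<n. cmod (p (T * Suc k / n) - p (T * k / n)) + \<epsilon> * \<delta>)"
    unfolding sum_distrib_left by (intro sum_mono st) simp
  also have "\<dots> = (\<Sum>k<n. cmod (p (T * Suc k / n) - p (T * k / n))) + \<epsilon> * T"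
    using \<delta>(3) by (simp add: sum.distrib)
  also have "\<dots> \<le> L + \<epsilon> * T" using le[OF n2] by simp
  finally show "integral {0..T} (\<lambda>t. cmod (p' t)) \<le> L + e" using R \<epsilon>(2) by linarith
qed

section \<open>Parseval's identity and uniform integrability of squares\<close>

lemma integral_cis_multiple:
  fixes j :: real
  assumes "j \<noteq> 0" "cis (2 * pi * j) = 1"
  shows "((\<lambda>t. cis (j * t)) has_integral 0) {0..2*pi}"
proof -
  have "((\<lambda>t. cis (j * t)) has_integral (cis (j * (2*pi)) / (\<i> * j) - cis (j * 0) / (\<i> * j))) {0..2*pi}"
  proof (rule fundamental_theorem_of_calculus)
    fix t :: real assume "t \<in> {0..2*pi}"
    have "((\<lambda>z. exp (\<i> * j * z) / (\<i> * j)) has_field_derivative exp (\<i> * j * of_real t)) (at (of_real t))"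
      using assms(1) by (auto intro!: derivative_eq_intros)
    then have "((\<lambda>x. exp (\<i> * j * of_real x) / (\<i> * j)) has_vector_derivative exp (\<i> * j * of_real t)) (at t within {0..2*pi})"
      by (rule has_vector_derivative_real_field)
    then show "((\<lambda>t. cis (j * t) / (\<i> * j)) has_vector_derivative cis (j * t)) (at t within {0..2*pi})"
      by (simp add: cis_conv_exp mult.assoc)
  qed simp
  then show ?thesis using assms(2) by (simp add: mult.commute)
qed

lemma parseval_finite:
  fixes a :: "nat \<Rightarrow> complex"
  shows "((\<lambda>t. (cmod (\<Sum>n<m. a n * cis (n * t)))\<^sup>2) has_integral 2 * pi * (\<Sum>n<m. (cmod (a n))\<^sup>2)) {0..2*pi}"
proof (induction m)
  case (Suc m)
  define s where "s t = (\<Sum>n<m. a n * cis (n * t))" for t :: real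
  have "((\<lambda>t. a n * cnj (a m) * cis ((real n - real m) * t)) has_integral a n * cnj (a m) * 0) {0..2*pi}" if "n < m" for n
  proof (intro has_integral_mult_right integral_cis_multiple)
    have "cis (2 * pi * (real n - real m)) = cis (2 * pi * real_of_int (int n - int m))" by simp
    also have "\<dots> = 1" by (intro cis_multiple_2pi) (simp only: Ints_of_int)
    finally show "cis (2 * pi * (real n - real m)) = 1" .
  qed (use that in simp)
  then have "((\<lambda>t. \<Sum>n<m. a n * cnj (a m) * cis ((real n - real m) * t)) has_integral (\<Sum>n<m. a n * cnj (a m) * 0)) {0..2*pi}"
    by (intro has_integral_sum) auto
  moreover have "(\<Sum>n<m. a n * cnj (a m) * cis ((real n - real m) * t)) = s t * cnj (a m * cis (m * t))" for t :: real
  proof -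
    have "cis ((real n - real m) * t) = cis (n * t) * cnj (cis (m * t))" for n
      by (simp add: cis_cnj cis_mult left_diff_distrib)
    then show ?thesis by (simp add: s_def sum_distrib_right sum_distrib_left mult_ac)
  qed
  ultimately have "((\<lambda>t. s t * cnj (a m * cis (m * t))) has_integral 0) {0..2*pi}" by simp
  then have "((\<lambda>t. Re (s t * cnj (a m * cis (m * t)))) has_integral Re 0) {0..2*pi}"
    by (rule has_integral_Re)
  note int1 = this
  have int2: "((\<lambda>t. (cmod (a m))\<^sup>2) has_integral (2 * pi) * (cmod (a m))\<^sup>2) {0..2*pi}"
    using has_integral_const_real[of "(cmod (a m))\<^sup>2" 0 "2*pi"] by simp
  have int3: "((\<lambda>t. (cmod (s t))\<^sup>2 + 2 * Re (s t * cnj (a m * cis (m * t))) + (cmod (a m))\<^sup>2) has_integral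
      2 * pi * (\<Sum>n<m. (cmod (a n))\<^sup>2) + 2 * Re 0 + (2 * pi) * (cmod (a m))\<^sup>2) {0..2*pi}"
    by (rule has_integral_add[OF has_integral_add[OF Suc.IH[folded s_def] has_integral_mult_right[OF int1]] int2])
  have eq: "(cmod (\<Sum>n<Suc m. a n * cis (n * t)))\<^sup>2 =
      (cmod (s t))\<^sup>2 + 2 * Re (s t * cnj (a m * cis (m * t))) + (cmod (a m))\<^sup>2" for t :: real
  proof -
    have "(cmod (x + y))\<^sup>2 = (cmod x)\<^sup>2 + 2 * Re (x * cnj y) + (cmod y)\<^sup>2" for x y
      unfolding cmod_power2 by (simp add: power2_eq_square algebra_simps)
    moreover have "(\<Sum>n<Suc m. a n * cis (n * t)) = s t + a m * cis (m * t)" by (simp add: s_def)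
    ultimately show ?thesis by (simp only: norm_mult norm_cis mult_1_right)
  qed
  show ?case
    by (rule has_integral_eq_rhs[OF has_integral_eq[OF eq[symmetric] int3]]) (simp add: distrib_left)
qed simp

text \<open>Absolute summability makes the series converge uniformly, so the finite identity passes
  to the limit. It is available for power series on circles of radius below the radius of
  convergence, which is where the lemma is used.\<close>

lemma parseval:
  fixes a :: "nat \<Rightarrow> complex"
  assumes "summable (\<lambda>n. cmod (a n))"
  shows "(\<lambda>n. (cmod (a n))\<^sup>2) sums (integral {0..2*pi} (\<lambda>t. (cmod (\<Sum>n. a n * cis (n * t)))\<^sup>2) / (2 * pi))"
proof -
  define s where "s m t = (\<Sum>n<m. a n * cis (n * t))" for m and t :: real
  define S where "S t = (\<Sum>n. a n * cis (n * t))" for t :: real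
  define C where "C = (\<Sum>n. cmod (a n))"
  have unif: "uniform_limit {0..2*pi} s S sequentially"
    unfolding s_def S_def by (rule Weierstrass_m_test[OF _ assms]) (simp add: norm_mult)
  have b: "cmod (s m t) \<le> C" for m t
  proof -
    have "cmod (s m t) \<le> (\<Sum>n<m. cmod (a n * cis (n * t)))" unfolding s_def by (rule norm_sum)
    also have "\<dots> = (\<Sum>n<m. cmod (a n))" by (simp add: norm_mult)
    also have "\<dots> \<le> C" unfolding C_def by (rule sum_le_suminf[OF assms]) auto
    finally show ?thesis .
  qed
  have "C \<ge> 0" using b[of 0 0] by (simp add: s_def)
  have lim: "(\<lambda>m. s m t) \<longlonglongrightarrow> S t" if "t \<in> {0..2*pi}" for t
    by (rule tendsto_uniform_limitI[OF unif that])
  have bS: "cmod (S t) \<le> C" if "t \<in> {0..2*pi}" for t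
    by (rule Lim_bounded[OF tendsto_norm[OF lim[OF that]]]) (use b in auto)
  have "uniform_limit {0..2*pi} (\<lambda>m t. (cmod (s m t))\<^sup>2) (\<lambda>t. (cmod (S t))\<^sup>2) sequentially"
  proof (rule uniform_limitI)
    fix e :: real assume "e > 0"
    then have "e / (2*C+1) > 0" using \<open>C \<ge> 0\<close> by simp
    from uniform_limitD[OF unif this]
    show "\<forall>\<^sub>F m in sequentially. \<forall>t\<in>{0..2*pi}. dist ((cmod (s m t))\<^sup>2) ((cmod (S t))\<^sup>2) < e"
    proof eventually_elim
      case (elim m)
      show ?case
      proof
        fix t :: real assume t: "t \<in> {0..2*pi}"
        have "\<bar>(cmod (s m t))\<^sup>2 - (cmod (S t))\<^sup>2\<bar> = \<bar>cmod (s m t) - cmod (S t)\<bar> * \<bar>cmod (s m t) + cmod (S t)\<bar>"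
          unfolding abs_mult[symmetric] by (simp add: power2_eq_square algebra_simps)
        also have "\<dots> \<le> cmod (s m t - S t) * (2 * C + 1)"
          using b[of m t] bS[OF t] \<open>C \<ge> 0\<close> by (intro mult_mono norm_triangle_ineq3) auto
        also have "\<dots> < e / (2*C+1) * (2*C+1)"
          using elim t \<open>C \<ge> 0\<close> by (intro mult_strict_right_mono) (auto simp: dist_norm)
        finally show "dist ((cmod (s m t))\<^sup>2) ((cmod (S t))\<^sup>2) < e"
          using \<open>C \<ge> 0\<close> by (simp add: dist_real_def)
      qed
    qed
  qed
  then have U: "uniform_limit (cbox 0 (2*pi)) (\<lambda>m t. (cmod (s m t))\<^sup>2) (\<lambda>t. (cmod (S t))\<^sup>2) sequentially"
    by simp
  have sc: "continuous_on (cbox 0 (2*pi)) (\<lambda>t. (cmod (s m t))\<^sup>2)" for m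
    unfolding s_def by (intro continuous_intros)
  have "\<exists>I J. (\<forall>m. ((\<lambda>t. (cmod (s m t))\<^sup>2) has_integral I m) (cbox 0 (2*pi))) \<and>
    ((\<lambda>t. (cmod (S t))\<^sup>2) has_integral J) (cbox 0 (2*pi)) \<and> I \<longlonglongrightarrow> J"
    by (rule uniform_limit_integral_cbox[OF U sc trivial_limit_sequentially]) blast
  then obtain I J where IJ: "\<And>m. ((\<lambda>t. (cmod (s m t))\<^sup>2) has_integral I m) (cbox 0 (2*pi))"
    "((\<lambda>t. (cmod (S t))\<^sup>2) has_integral J) (cbox 0 (2*pi))" "I \<longlonglongrightarrow> J"
    by blast
  have "I m = 2 * pi * (\<Sum>n<m. (cmod (a n))\<^sup>2)" for m
    by (rule has_integral_unique[OF IJ(1)]) (use parseval_finite[where a = a and m = m] in \<open>simp add: s_def\<close>)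
  then have "(\<lambda>m. I m / (2*pi)) = (\<lambda>m. \<Sum>n<m. (cmod (a n))\<^sup>2)" by (simp add: fun_eq_iff)
  moreover have "(\<lambda>m. I m / (2*pi)) \<longlonglongrightarrow> J / (2*pi)" by (intro tendsto_intros IJ(3)) simp
  moreover have "integral {0..2*pi} (\<lambda>t. (cmod (S t))\<^sup>2) = J" using IJ(2) by (auto intro: integral_unique)
  ultimately show ?thesis unfolding sums_def S_def[symmetric] by simp
qed

text \<open>On each circle, \<open>g\<close> differs from a fixed polynomial by a function of small square mean.\<close>

lemma square_uniformly_integrable:
  assumes hol: "g holomorphic_on ball 0 1"
    and L: "\<And>r. 0 < r \<Longrightarrow> r < 1 \<Longrightarrow> r * integral {0..2*pi} (\<lambda>t. (cmod (g (of_real r * cis t)))\<^sup>2) \<le> L"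
    and "\<epsilon> > 0"
  obtains C where "C > 0" "\<forall>r w. 0 < r \<and> r < 1 \<and> continuous_on {0..2*pi} w \<and> (\<forall>t\<in>{0..2*pi}. 0 \<le> w t \<and> w t \<le> 1) \<longrightarrow>
    integral {0..2*pi} (\<lambda>t. w t * (cmod (g (of_real r * cis t)))\<^sup>2) \<le> C * integral {0..2*pi} w + \<epsilon>"
proof -
  define b where "b n = (deriv ^^ n) g 0 / fact n" for n
  have ser: "(\<lambda>n. b n * z ^ n) sums g z" if "cmod z < 1" for z
    using holomorphic_power_series[OF hol, of z] that by (simp add: b_def)
  have circle: "(\<lambda>n. b n * of_real r ^ n * cis (n * t)) sums g (of_real r * cis t)" if r: "0 < r" "r < 1" for r t :: real
  proof -
    have "(of_real r * cis t) ^ n = of_real r ^ n * cis (n * t)" for n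
      by (simp only: power_mult_distrib Complex.DeMoivre)
    moreover have "(\<lambda>n. b n * (of_real r * cis t) ^ n) sums g (of_real r * cis t)"
      by (rule ser) (use r in \<open>simp add: norm_mult\<close>)
    ultimately show ?thesis by (simp only: mult.assoc)
  qed
  have summ: "summable (\<lambda>n. cmod (b n * of_real r ^ n))" if r: "0 < r" "r < 1" for r
  proof -
    obtain R where "r < R" "R < 1" using dense[OF r(2)] by blast
    then show ?thesis
      using powser_insidea[of b "of_real R" "of_real r :: complex"] ser[of "of_real R"] r by (auto simp: sums_iff)
  qed
  have sumsq: "(\<lambda>n. (cmod (b n * of_real r ^ n))\<^sup>2) sums (integral {0..2*pi} (\<lambda>t. (cmod (g (of_real r * cis t)))\<^sup>2) / (2 * pi))"
    if r: "0 < r" "r < 1" for r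
  proof -
    have "(\<Sum>n. b n * of_real r ^ n * cis (n * t)) = g (of_real r * cis t)" for t :: real
      using circle[OF r, of t] by (simp only: sums_iff)
    then show ?thesis using parseval[OF summ[OF r]] by simp
  qed
  \<comment> \<open>For fixed m the bound on the circle of radius r survives the limit r to 1; this
    gives square summability of the coefficients themselves.\<close>
  have partial: "(\<Sum>n<m. (cmod (b n))\<^sup>2) \<le> L / (2 * pi)" for m
  proof -
    have "r * (\<Sum>n<m. (cmod (b n * of_real r ^ n))\<^sup>2) \<le> L / (2 * pi)" if r: "0 < r" "r < 1" for r
    proof -
      have "(\<Sum>n<m. (cmod (b n * of_real r ^ n))\<^sup>2) \<le> integral {0..2*pi} (\<lambda>t. (cmod (g (of_real r * cis t)))\<^sup>2) / (2 * pi)"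
        using sumsq[OF r] sum_le_suminf[of "\<lambda>n. (cmod (b n * of_real r ^ n))\<^sup>2" "{..<m}"] by (auto simp: sums_iff)
      then have "r * (\<Sum>n<m. (cmod (b n * of_real r ^ n))\<^sup>2) \<le> r * (integral {0..2*pi} (\<lambda>t. (cmod (g (of_real r * cis t)))\<^sup>2) / (2 * pi))"
        using r by (intro mult_left_mono) auto
      also have "\<dots> \<le> L / (2 * pi)" using L[OF r] by (simp add: divide_right_mono)
      finally show ?thesis .
    qed
    then have "\<forall>\<^sub>F r in at_left 1. r * (\<Sum>n<m. (cmod (b n * of_real r ^ n))\<^sup>2) \<le> L / (2 * pi)"
      using eventually_at_left_real[of 0 "1::real"] by (auto elim!: eventually_mono)
    moreover have "((\<lambda>r. r * (\<Sum>n<m. (cmod (b n * of_real r ^ n))\<^sup>2)) \<longlongrightarrow> 1 * (\<Sum>n<m. (cmod (b n * of_real 1 ^ n))\<^sup>2)) (at_left (1::real))"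
      by (intro tendsto_intros)
    ultimately show ?thesis
      using tendsto_upperbound[of _ "1 * (\<Sum>n<m. (cmod (b n * of_real 1 ^ n))\<^sup>2)" "at_left (1::real)" "L / (2*pi)"]
      by (simp add: trivial_limit_at_left_real)
  qed
  have sb: "summable (\<lambda>n. (cmod (b n))\<^sup>2)"
    by (rule summableI_nonneg_bounded[of _ "L / (2 * pi)"]) (use partial in auto)
  have "(\<lambda>m. \<Sum>n. (cmod (b (n + m)))\<^sup>2) \<longlonglongrightarrow> 0" by (rule suminf_exist_split2[OF sb])
  then have "\<forall>\<^sub>F m in sequentially. (\<Sum>n. (cmod (b (n + m)))\<^sup>2) < \<epsilon> / (4 * pi)"
    using \<open>\<epsilon> > 0\<close> by (auto dest: order_tendstoD(2)[where a = "\<epsilon> / (4 * pi)"])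
  \<comment> \<open>By Parseval the tail then has square integral at most
    \<open>\<epsilon>\<close>/2 on every circle.\<close>
  then obtain m where m: "(\<Sum>n. (cmod (b (n + m)))\<^sup>2) < \<epsilon> / (4 * pi)" using eventually_happens by force
  define P where "P = (\<Sum>n<m. cmod (b n))"
  \<comment> \<open>The 2 comes from estimating the square of a sum by twice the sum of the squares,
    and 1 is added for positivity; P bounds the initial polynomial on the whole disc.\<close>
  define C where "C = 2 * P\<^sup>2 + 1"
  have "C > 0" unfolding C_def by (simp add: add_nonneg_pos)
  show ?thesis
  proof (rule that[OF \<open>C > 0\<close>], intro allI impI, elim conjE)
    fix r :: real and w :: "real \<Rightarrow> real"
    assume r: "0 < r" "r < 1" and w1: "continuous_on {0..2*pi} w" and w2: "\<forall>t\<in>{0..2*pi}. 0 \<le> w t \<and> w t \<le> 1"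
    note w = w1 w2[rule_format]
    define a where "a n = (if n < m then 0 else b n * of_real r ^ n)" for n
    have an: "cmod (a n) \<le> cmod (b n * of_real r ^ n)" for n by (simp add: a_def)
    have suma: "summable (\<lambda>n. cmod (a n))"
      by (rule summable_comparison_test'[OF summ[OF r], of 0]) (use an in simp)
    define t where "t x = (\<Sum>n. a n * cis (n * x))" for x :: real
    have dec: "g (of_real r * cis x) = (\<Sum>n<m. b n * of_real r ^ n * cis (n * x)) + t x" for x :: real
    proof -
      have s: "(\<lambda>n. b n * of_real r ^ n * cis (n * x)) sums g (of_real r * cis x)"
        by (rule circle[OF r])
      have "(\<lambda>n. if n \<in> {..<m} then b n * of_real r ^ n * cis (n * x) else 0) sums (\<Sum>n<m. b n * of_real r ^ n * cis (n * x))"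
        by (rule sums_If_finite_set) simp
      from sums_diff[OF s this] have "(\<lambda>n. a n * cis (n * x)) sums (g (of_real r * cis x) - (\<Sum>n<m. b n * of_real r ^ n * cis (n * x)))"
        by (rule sums_cong[THEN iffD1, rotated]) (simp add: a_def)
      then show ?thesis by (simp add: t_def sums_iff)
    qed
    have Pb: "cmod (\<Sum>n<m. b n * of_real r ^ n * cis (n * x)) \<le> P" for x :: real
    proof -
      have "cmod (\<Sum>n<m. b n * of_real r ^ n * cis (n * x)) \<le> (\<Sum>n<m. cmod (b n * of_real r ^ n * cis (n * x)))" by (rule norm_sum)
      also have "\<dots> \<le> P" unfolding P_def
        by (rule sum_mono) (use r in \<open>simp add: norm_mult norm_power mult_left_le power_le_one\<close>)
      finally show ?thesis .
    qed
    have sub: "of_real r * cis x \<in> ball 0 1" for x using r by (simp add: norm_mult)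
    have gcont: "continuous_on S (\<lambda>x. g (of_real r * cis x))" for S
      by (rule continuous_on_compose2[OF holomorphic_on_imp_continuous_on[OF hol]])
        (use sub in \<open>auto intro!: continuous_intros\<close>)
    have tcont: "continuous_on S t" for S
    proof -
      have "t = (\<lambda>x::real. g (of_real r * cis x) - (\<Sum>n<m. b n * of_real r ^ n * cis (n * x)))" using dec by (simp add: fun_eq_iff)
      then show ?thesis by (auto intro!: continuous_intros gcont)
    qed
    have It: "integral {0..2*pi} (\<lambda>x. (cmod (t x))\<^sup>2) \<le> \<epsilon> / 2"
    proof -
      have "(\<lambda>n. (cmod (a n))\<^sup>2) sums (integral {0..2*pi} (\<lambda>x. (cmod (t x))\<^sup>2) / (2*pi))"
        using parseval[OF suma] by (simp add: t_def)
      then have eq: "integral {0..2*pi} (\<lambda>x. (cmod (t x))\<^sup>2) / (2*pi) = (\<Sum>n. (cmod (a n))\<^sup>2)" and sa: "summable (\<lambda>n. (cmod (a n))\<^sup>2)"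
        by (simp_all add: sums_iff)
      have "(\<Sum>n. (cmod (a n))\<^sup>2) = (\<Sum>n. (cmod (a (n + m)))\<^sup>2) + (\<Sum>n<m. (cmod (a n))\<^sup>2)"
        by (rule suminf_split_initial_segment[OF sa])
      also have "(\<Sum>n<m. (cmod (a n))\<^sup>2) = 0" by (simp add: a_def)
      also have "(\<Sum>n. (cmod (a (n + m)))\<^sup>2) \<le> (\<Sum>n. (cmod (b (n + m)))\<^sup>2)"
      proof (rule suminf_le)
        show "(cmod (a (n + m)))\<^sup>2 \<le> (cmod (b (n + m)))\<^sup>2" for n
          using r by (intro power_mono) (simp_all add: a_def norm_mult norm_power mult_left_le power_le_one)
        show "summable (\<lambda>n. (cmod (a (n + m)))\<^sup>2)" "summable (\<lambda>n. (cmod (b (n + m)))\<^sup>2)"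
          using sa sb by (auto intro: summable_ignore_initial_segment)
      qed
      finally have "integral {0..2*pi} (\<lambda>x. (cmod (t x))\<^sup>2) / (2*pi) \<le> \<epsilon> / (4*pi)" using m eq by linarith
      then show ?thesis by (simp add: field_simps)
    qed
    have "integral {0..2*pi} (\<lambda>x. w x * (cmod (g (of_real r * cis x)))\<^sup>2) \<le>
        integral {0..2*pi} (\<lambda>x. C * w x + 2 * (cmod (t x))\<^sup>2)"
    proof (rule integral_le)
      show "(\<lambda>x. w x * (cmod (g (of_real r * cis x)))\<^sup>2) integrable_on {0..2*pi}"
        "(\<lambda>x. C * w x + 2 * (cmod (t x))\<^sup>2) integrable_on {0..2*pi}"
        by (intro integrable_continuous_interval continuous_intros w gcont tcont)+
      fix x :: real assume x: "x \<in> {0..2*pi}"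
      let ?p = "cmod (\<Sum>n<m. b n * of_real r ^ n * cis (n * x))"
      have "cmod (g (of_real r * cis x)) \<le> ?p + cmod (t x)" unfolding dec by (rule norm_triangle_ineq)
      then have "(cmod (g (of_real r * cis x)))\<^sup>2 \<le> (?p + cmod (t x))\<^sup>2" by (intro power_mono) auto
      also have "\<dots> \<le> 2 * ?p\<^sup>2 + 2 * (cmod (t x))\<^sup>2"
        using zero_le_power2[of "?p - cmod (t x)"] by (simp add: power2_sum power2_diff)
      also have "\<dots> \<le> C + 2 * (cmod (t x))\<^sup>2"
        using power_mono[OF Pb[of x], of 2] by (simp add: C_def)
      finally have "w x * (cmod (g (of_real r * cis x)))\<^sup>2 \<le> w x * (C + 2 * (cmod (t x))\<^sup>2)"
        using w(2)[OF x] by (intro mult_left_mono) auto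
      also have "\<dots> \<le> C * w x + 2 * (cmod (t x))\<^sup>2"
        using w(2)[OF x] mult_right_mono[of "w x" 1 "2 * (cmod (t x))\<^sup>2"] by (simp add: algebra_simps)
      finally show "w x * (cmod (g (of_real r * cis x)))\<^sup>2 \<le> C * w x + 2 * (cmod (t x))\<^sup>2" .
    qed
    also have "\<dots> = C * integral {0..2*pi} w + 2 * integral {0..2*pi} (\<lambda>x. (cmod (t x))\<^sup>2)"
      by (subst Henstock_Kurzweil_Integration.integral_add)
        (auto intro!: integrable_continuous_interval continuous_intros w tcont)
    also have "\<dots> \<le> C * integral {0..2*pi} w + \<epsilon>" using It by simp
    finally show "integral {0..2*pi} (\<lambda>t. w t * (cmod (g (of_real r * cis t)))\<^sup>2) \<le> C * integral {0..2*pi} w + \<epsilon>" .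
  qed
qed

text \<open>By the maximum principle for the products
  \<open>F z F (\<omega> z) \<dots> F (\<omega>\<^sup>n\<^sup>-\<^sup>1 z)\<close> over the \<open>n\<close>-th roots of unity.\<close>

lemma jensen_truncated:
  assumes hol: "F holomorphic_on ball 0 1" and "F 0 \<noteq> 0" and r: "0 < r" "r < 1" and \<tau>: "0 < \<tau>"
  shows "2 * pi * ln (cmod (F 0)) \<le> integral {0..2*pi} (\<lambda>t. ln (max (cmod (F (of_real r * cis t))) \<tau>))"
proof (rule field_le_epsilon)
  fix e :: real assume "e > 0"
  define c where "c t = ln (max (cmod (F (of_real r * cis t))) \<tau>)" for t
  define \<epsilon> where "\<epsilon> = e / (2 * pi)"
  have \<epsilon>: "\<epsilon> > 0" "\<epsilon> * (2 * pi) = e" using \<open>e > 0\<close> by (auto simp: \<epsilon>_def)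
  have sub: "of_real r * cis t \<in> ball 0 1" for t using r by (simp add: norm_mult)
  have ccont: "continuous_on S c" for S
  proof -
    have "continuous_on S (\<lambda>t. F (of_real r * cis t))"
      by (rule continuous_on_compose2[OF holomorphic_on_imp_continuous_on[OF hol]])
        (use sub in \<open>auto intro!: continuous_intros\<close>)
    then show ?thesis unfolding c_def using \<tau> by (intro continuous_intros) auto
  qed
  have per: "c (t + 2 * pi) = c t" for t
  proof -
    have "cis (t + 2 * pi) = cis t" by (simp add: cis_mult[symmetric])
    then show ?thesis by (simp add: c_def)
  qed
  \<comment> \<open>Two full turns, because the Riemann sum covers one turn starting at an arbitrary
    angle in [0, 2 pi].\<close>
  have "uniformly_continuous_on {0..4*pi} c" by (intro compact_uniformly_continuous ccont) auto
  then obtain d where d: "d > 0" "\<And>x y. x \<in> {0..4*pi} \<Longrightarrow> y \<in> {0..4*pi} \<Longrightarrow> dist y x < d \<Longrightarrow> dist (c y) (c x) < \<epsilon>"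
    using \<epsilon>(1) unfolding uniformly_continuous_on_def by metis
  obtain n :: nat where n: "n > max 1 (2 * pi / d)" using reals_Archimedean2 by blast
  have n0: "real n > 0" using n by simp
  define \<delta> where "\<delta> = 2 * pi / n"
  have \<delta>: "0 < \<delta>" "\<delta> < d" "n * \<delta> = 2 * pi"
  proof -
    show "0 < \<delta>" "n * \<delta> = 2 * pi" using n0 by (auto simp: \<delta>_def)
    have "2 * pi / d < n" using n by simp
    then have "2 * pi < n * d" using d(1) by (simp add: pos_divide_less_eq)
    then show "\<delta> < d" using n0 by (simp add: \<delta>_def pos_divide_less_eq mult.commute)
  qed
  define G where "G z = (\<Prod>k<n. F (z * cis (k * \<delta>)))" for z
  have Ghol: "G holomorphic_on ball 0 1" unfolding G_def
    by (intro holomorphic_on_prod holomorphic_on_compose_gen[OF _ hol, unfolded o_def])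
      (auto intro!: holomorphic_intros simp: norm_mult)
  have cb: "cball 0 r \<subseteq> ball (0::complex) 1" using r by auto
  have Gc: "continuous_on (cball 0 r) G"
    by (rule continuous_on_subset[OF holomorphic_on_imp_continuous_on[OF Ghol] cb])
  have "\<exists>z\<in>sphere 0 r. \<forall>y\<in>sphere 0 r. cmod (G y) \<le> cmod (G z)"
    using r by (intro continuous_attains_sup continuous_intros continuous_on_subset[OF Gc]) auto
  then obtain z where z: "cmod z = r" "\<And>y. cmod y = r \<Longrightarrow> cmod (G y) \<le> cmod (G z)" by auto
  have "cmod (G 0) \<le> cmod (G z)"
  proof (rule maximum_modulus_frontier[of G "ball 0 r"])
    show "G holomorphic_on interior (ball 0 r)"
      by (rule holomorphic_on_subset[OF Ghol]) (use cb in auto)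
    show "continuous_on (closure (ball 0 r)) G" using Gc r by simp
  qed (use z r in \<open>auto simp: frontier_ball\<close>)
  have "G 0 = F 0 ^ n" by (simp add: G_def)
  \<comment> \<open>The Riemann sum is taken at the rotations of the point z where the product is
    largest on the circle, so it starts at the angle of z; periodicity of c afterwards moves the
    interval of integration back.\<close>
  define \<theta> where "\<theta> = Arg2pi z"
  have \<theta>: "0 \<le> \<theta>" "\<theta> \<le> 2 * pi" "z = of_real r * cis \<theta>"
    using Arg2pi[of z] z(1) by (auto simp: \<theta>_def cis_conv_exp is_Arg_def)
  have "cmod (G z) = (\<Prod>k<n. cmod (F (of_real r * cis (\<theta> + k * \<delta>))))"
    unfolding G_def \<theta>(3) by (simp add: mult.assoc cis_mult prod_norm)
  also have "\<dots> \<le> (\<Prod>k<n. exp (c (\<theta> + k * \<delta>)))"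
    by (rule prod_mono) (use \<tau> in \<open>simp add: c_def\<close>)
  also have "\<dots> = exp (\<Sum>k<n. c (\<theta> + k * \<delta>))" by (simp add: exp_sum)
  finally have "cmod (F 0) ^ n \<le> exp (\<Sum>k<n. c (\<theta> + k * \<delta>))"
    using \<open>cmod (G 0) \<le> cmod (G z)\<close> \<open>G 0 = F 0 ^ n\<close> by (simp add: norm_power)
  moreover have "cmod (F 0) ^ n = exp (n * ln (cmod (F 0)))"
    using \<open>F 0 \<noteq> 0\<close> by (simp add: exp_of_nat_mult)
  ultimately have "n * ln (cmod (F 0)) \<le> (\<Sum>k<n. c (\<theta> + k * \<delta>))" by simp
  then have "\<delta> * (n * ln (cmod (F 0))) \<le> \<delta> * (\<Sum>k<n. c (\<theta> + k * \<delta>))"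
    using \<delta>(1) by (intro mult_left_mono) auto
  moreover have "\<delta> * (n * ln (cmod (F 0))) = 2 * pi * ln (cmod (F 0))" using \<delta>(3) by (metis mult.assoc mult.commute)
  moreover have "\<bar>\<delta> * (\<Sum>k<n. c (\<theta> + k * \<delta>)) - integral {\<theta>..\<theta> + n * \<delta>} c\<bar> \<le> \<epsilon> * n * \<delta>"
  proof (rule riemann_sum_bound[OF _ ccont])
    fix x y :: real assume xy: "x \<in> {\<theta>..\<theta> + n * \<delta>}" "y \<in> {\<theta>..\<theta> + n * \<delta>}" "\<bar>x - y\<bar> \<le> \<delta>"
    then have "dist (c x) (c y) < \<epsilon>" using \<delta> \<theta> by (intro d(2)) (auto simp: dist_real_def)
    then show "\<bar>c x - c y\<bar> \<le> \<epsilon>" by (simp add: dist_real_def)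
  qed (use \<delta> in simp)
  moreover have "integral {\<theta>..\<theta> + n * \<delta>} c = integral {0..2*pi} c"
  proof -
    have int: "c integrable_on {x..y}" for x y by (intro integrable_continuous_interval ccont)
    have "integral {\<theta>..2*pi} c + integral {2*pi..\<theta> + 2*pi} c = integral {\<theta>..\<theta> + 2*pi} c"
      "integral {0..\<theta>} c + integral {\<theta>..2*pi} c = integral {0..2*pi} c"
      using \<theta> int by (auto intro!: Henstock_Kurzweil_Integration.integral_combine)
    moreover have "integral {2*pi - 2*pi..(\<theta> + 2*pi) - 2*pi} (\<lambda>x. c (x + 2*pi)) = integral {2*pi..\<theta> + 2*pi} c"
      by (rule integral_shift_real_ivl)
    ultimately show ?thesis unfolding \<delta>(3) per by simp
  qed
  ultimately have "2 * pi * ln (cmod (F 0)) \<le> integral {0..2*pi} c + e" using \<epsilon>(2) \<delta>(3) by (simp add: mult.assoc)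
  then show "2 * pi * ln (cmod (F 0)) \<le> integral {0..2*pi} (\<lambda>t. ln (max (cmod (F (of_real r * cis t))) \<tau>)) + e"
  proof -
    have "c = (\<lambda>t. ln (max (cmod (F (of_real r * cis t))) \<tau>))" by (simp add: fun_eq_iff c_def)
    then show ?thesis using \<open>2 * pi * ln (cmod (F 0)) \<le> integral {0..2*pi} c + e\<close> by simp
  qed
qed

section \<open>Uniqueness on a set of positive length\<close>

text \<open>A Moebius automorphism of the disc moves the centre, so that any point where the given
  function does not vanish can be taken as \<open>\<Phi> 0\<close>; Jensen's inequality needs a
  nonzero value there.\<close>

lemma riemann_map_at:
  assumes "simple_path g" "pathfinish g = pathstart g" "w0 \<in> inside (path_image g)"
  obtains \<Phi> \<Psi> where "jordan_conformal g \<Phi> \<Psi>" "\<Phi> 0 = w0"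
proof -
  define S where "S = inside (path_image g)"
  have S: "open S" "bounded S" "w0 \<in> S" using Jordan_inside_outside[OF assms(1,2)] assms(3) by (simp_all add: S_def)
  have "simply_connected S" unfolding S_def by (rule simply_connected_inside_simple_path[OF assms(1)])
  moreover have "S \<noteq> {}" "S \<noteq> UNIV" using S by auto
  ultimately have "\<exists>f h. f holomorphic_on S \<and> h holomorphic_on ball 0 1 \<and>
      (\<forall>z\<in>S. f z \<in> ball 0 1 \<and> h (f z) = z) \<and> (\<forall>z\<in>ball 0 1. h z \<in> S \<and> f (h z) = z)"
    using simply_connected_eq_biholomorphic_to_disc[OF S(1)] by simp
  then obtain f h where fh: "f holomorphic_on S" "h holomorphic_on ball 0 1"
      "\<forall>z\<in>S. f z \<in> ball 0 1 \<and> h (f z) = z" "\<forall>z\<in>ball 0 1. h z \<in> S \<and> f (h z) = z"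
    by (elim exE conjE)
  define a where "a = f w0"
  have a: "cmod a < 1" "h a = w0" using fh(3) S(3) by (auto simp: a_def)
  define M where "M = Moebius_function 0 (- a)"
  define M' where "M' = Moebius_function 0 a"
  have M: "M z \<in> ball 0 1" "M' z \<in> ball 0 1" if "z \<in> ball 0 1" for z
    using Moebius_function_norm_lt_1[of "- a" z 0] Moebius_function_norm_lt_1[of a z 0] a that
    by (auto simp: M_def M'_def)
  have MM: "M (M' z) = z" "M' (M z) = z" if "z \<in> ball 0 1" for z
    using Moebius_function_compose[of "- a" a z] Moebius_function_compose[of a "- a" z] a that
    by (auto simp: M_def M'_def)
  have Mh: "M holomorphic_on ball 0 1" "M' holomorphic_on ball 0 1"
    using Moebius_function_holomorphic[of "- a"] Moebius_function_holomorphic[of a] a by (auto simp: M_def M'_def)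
  show ?thesis
  proof (rule that[of "h \<circ> M" "M' \<circ> f"])
    show "jordan_conformal g (h \<circ> M) (M' \<circ> f)"
    proof (unfold_locales, unfold S_def[symmetric])
      show "h \<circ> M holomorphic_on ball 0 1"
        by (rule holomorphic_on_compose_gen[OF Mh(1) fh(2)]) (use M in auto)
      show "M' \<circ> f holomorphic_on S"
        by (rule holomorphic_on_compose_gen[OF fh(1) Mh(2)]) (use fh in auto)
      show "(h \<circ> M) z \<in> S" "(M' \<circ> f) ((h \<circ> M) z) = z" if "z \<in> ball 0 1" for z
        using fh(4) M[OF that] MM[OF that] by auto
      show "(M' \<circ> f) w \<in> ball 0 1" "(h \<circ> M) ((M' \<circ> f) w) = w" if "w \<in> S" for w
      proof -
        have b: "f w \<in> ball 0 1" "h (f w) = w" using fh(3) that by auto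
        show "(M' \<circ> f) w \<in> ball 0 1" using M(2)[OF b(1)] by simp
        show "(h \<circ> M) ((M' \<circ> f) w) = w" using MM(1)[OF b(1)] b(2) by simp
      qed
    qed (use assms in auto)
    show "(h \<circ> M) 0 = w0" using a by (simp add: M_def Moebius_function_of_zero)
  qed
qed

section \<open>Disjoint time intervals and crossing times\<close>

lemma sum_integral_disjoint_le:
  fixes f :: "real \<Rightarrow> real"
  assumes F: "finite F" and cont: "continuous_on {a..b} f" and pos: "\<And>x. x \<in> {a..b} \<Longrightarrow> 0 \<le> f x"
    and sub: "\<And>i. i \<in> F \<Longrightarrow> {l i..u i} \<subseteq> {a..b}"
    and disj: "\<And>i j. i \<in> F \<Longrightarrow> j \<in> F \<Longrightarrow> i \<noteq> j \<Longrightarrow> {l i..u i} \<inter> {l j..u j} = {}"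
  shows "(\<Sum>i\<in>F. integral {l i..u i} f) \<le> integral {a..b} f"
proof -
  have int: "f integrable_on {l i..u i}" if "i \<in> F" for i
    by (rule integrable_continuous_interval[OF continuous_on_subset[OF cont sub[OF that]]])
  have inter: "{l i..u i} \<inter> {a..b} = {l i..u i}" if "i \<in> F" for i using sub[OF that] by blast
  have int': "(\<lambda>x. if x \<in> {l i..u i} then f x else 0) integrable_on {a..b}" if "i \<in> F" for i
    unfolding integrable_restrict_Int inter[OF that] by (rule int[OF that])
  have "(\<Sum>i\<in>F. integral {l i..u i} f) = (\<Sum>i\<in>F. integral {a..b} (\<lambda>x. if x \<in> {l i..u i} then f x else 0))"
    by (rule sum.cong[OF refl]) (simp only: integral_restrict_Int inter)
  also have "\<dots> = integral {a..b} (\<lambda>x. \<Sum>i\<in>F. if x \<in> {l i..u i} then f x else 0)"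
    by (rule Henstock_Kurzweil_Integration.integral_sum[symmetric]) (use F int' in auto)
  also have "\<dots> \<le> integral {a..b} f"
  proof (rule integral_le)
    show "(\<lambda>x. \<Sum>i\<in>F. if x \<in> {l i..u i} then f x else 0) integrable_on {a..b}"
      by (rule integrable_sum) (use F int' in auto)
    show "f integrable_on {a..b}" by (rule integrable_continuous_interval[OF cont])
    fix x assume x: "x \<in> {a..b}"
    have "finite {i \<in> F. x \<in> {l i..u i}}" using F by simp
    moreover have "\<forall>i\<in>{i \<in> F. x \<in> {l i..u i}}. \<forall>j\<in>{i \<in> F. x \<in> {l i..u i}}. i = j" using disj by blast
    ultimately have "card {i \<in> F. x \<in> {l i..u i}} \<le> 1"
      by (simp add: card_le_Suc0_iff_eq)
    moreover have "(\<Sum>i\<in>F. if x \<in> {l i..u i} then f x else 0) = (\<Sum>i\<in>{i \<in> F. x \<in> {l i..u i}}. f x)"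
      by (rule sum.inter_filter[OF F, symmetric])
    ultimately show "(\<Sum>i\<in>F. if x \<in> {l i..u i} then f x else 0) \<le> f x"
      using pos[OF x] mult_right_mono[of "real (card {i \<in> F. x \<in> {l i..u i}})" 1 "f x"] by simp
  qed
  finally show ?thesis .
qed

lemma crossing_interval_right:
  fixes s :: "real \<Rightarrow> real"
  assumes cont: "continuous_on {x..y} s" and "s x < c" "c \<le> s y" "x \<le> y"
  obtains \<beta> where "x \<le> \<beta>" "\<beta> \<le> y" "s \<beta> = c" "\<And>t. t \<in> {x..\<beta>} \<Longrightarrow> s t \<le> c"
proof -
  have IVT: "\<exists>z. x \<le> z \<and> z \<le> t \<and> s z = c" if "t \<in> {x..y}" "c \<le> s t" for t
    using IVT'[of s x c t] that assms(2) continuous_on_subset[OF cont, of "{x..t}"] by auto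
  define Z where "Z = {t \<in> {x..y}. s t = c}"
  have "closed Z" unfolding Z_def by (rule continuous_closed_preimage_constant[OF cont]) simp
  moreover have "bounded Z" by (rule bounded_subset[of "{x..y}"]) (auto simp: Z_def)
  ultimately have "compact Z" using compact_eq_bounded_closed by blast
  moreover have "Z \<noteq> {}" using IVT[of y] assms unfolding Z_def by auto
  ultimately have "\<exists>m\<in>Z. \<forall>t\<in>Z. m \<le> t" by (rule compact_attains_inf)
  then obtain m where m: "m \<in> Z" "\<And>t. t \<in> Z \<Longrightarrow> m \<le> t" by blast
  show ?thesis
  proof (rule that[of m])
    fix t assume t: "t \<in> {x..m}"
    show "s t \<le> c"
    proof (rule ccontr)
      assume n: "\<not> s t \<le> c"
      have "t \<in> {x..y}" using t m(1) by (auto simp: Z_def)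
      then obtain z where z: "x \<le> z" "z \<le> t" "s z = c" using IVT[of t] n by auto
      then have "z \<in> Z" using \<open>t \<in> {x..y}\<close> by (auto simp: Z_def)
      then have "t = m" using m(2)[of z] z t by auto
      then show False using n m(1) by (simp add: Z_def)
    qed
  qed (use m(1) in \<open>auto simp: Z_def\<close>)
qed

text \<open>Meant for s the distance from a boundary point to a point moving along the image of a
  circle: in the time interval found, the moving point stays in the ball of radius c and travels at
  least c - s x. The far point may come earlier or later than the near one, hence the absolute
  value.\<close>

lemma crossing_interval:
  fixes s :: "real \<Rightarrow> real"
  assumes cont: "continuous_on {a..b} s" and x: "x \<in> {a..b}" "s x < c" and y: "y \<in> {a..b}" "c \<le> s y"
  obtains \<alpha> \<beta> where "a \<le> \<alpha>" "\<alpha> \<le> \<beta>" "\<beta> \<le> b" "\<And>t. t \<in> {\<alpha>..\<beta>} \<Longrightarrow> s t \<le> c" "\<bar>s \<alpha> - s \<beta>\<bar> = c - s x"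
proof (cases "x \<le> y")
  case True
  have "continuous_on {x..y} s" by (rule continuous_on_subset[OF cont]) (use x y in auto)
  from crossing_interval_right[OF this x(2) y(2) True]
  obtain \<beta> where "x \<le> \<beta>" "\<beta> \<le> y" "s \<beta> = c" "\<And>t. t \<in> {x..\<beta>} \<Longrightarrow> s t \<le> c" by metis
  then show ?thesis by (intro that[of x \<beta>]) (use x y in auto)
next
  case False
  have "continuous_on {- x..- y} (\<lambda>t. s (- t))"
    by (rule continuous_on_compose2[OF cont]) (use x y in \<open>auto intro!: continuous_intros\<close>)
  from crossing_interval_right[OF this, of c] x(2) y(2) False
  obtain \<beta> where \<beta>: "- x \<le> \<beta>" "\<beta> \<le> - y" "s (- \<beta>) = c" "\<And>t. t \<in> {- x..\<beta>} \<Longrightarrow> s (- t) \<le> c" by auto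
  have "s t \<le> c" if "t \<in> {- \<beta>..x}" for t using \<beta>(4)[of "- t"] that by auto
  then show ?thesis by (intro that[of "- \<beta>" x]) (use \<beta> x y in auto)
qed

section \<open>Images of circles near a zero set on the boundary\<close>

context jordan_conformal
begin

text \<open>The segment from \<open>\<Phi> z\<close> to e starts in the image of the disc of radius
  r and ends outside it. Where it crosses the frontier of that image there is a point of the image
  of the circle, no farther from e than \<open>\<Phi> z\<close>.\<close>

lemma circle_point_near:
  assumes e: "e \<in> \<Gamma>" and z: "cmod z < r" "r < 1" "dist (\<Phi> z) e < \<delta>"
  obtains \<theta> where "\<theta> \<in> {0..2*pi}" "dist (\<Phi> (of_real r * cis \<theta>)) e < \<delta>"
proof -
  have r: "0 < r" using z(1) norm_ge_zero[of z] by linarith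
  define V where "V = \<Phi> ` ball 0 r"
  have b: "ball 0 r \<subseteq> ball (0::complex) 1" "cball 0 r \<subseteq> ball (0::complex) 1" using z by auto
  have zV: "\<Phi> z \<in> V" using z(1) by (simp add: V_def)
  have eV: "e \<notin> V" using e \<Phi>_in D_props(6) b(1) unfolding V_def by blast
  have "V = D \<inter> \<Psi> -` ball 0 r"
  proof
    show "V \<subseteq> D \<inter> \<Psi> -` ball 0 r"
    proof
      fix w assume "w \<in> V"
      then obtain u where u: "u \<in> ball 0 r" "w = \<Phi> u" unfolding V_def by blast
      then have "u \<in> ball 0 1" using b by blast
      then show "w \<in> D \<inter> \<Psi> -` ball 0 r" using u \<Phi>_in \<Psi>\<Phi> by auto
    qed
    show "D \<inter> \<Psi> -` ball 0 r \<subseteq> V"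
    proof
      fix w assume w: "w \<in> D \<inter> \<Psi> -` ball 0 r"
      then have "w = \<Phi> (\<Psi> w)" using \<Phi>\<Psi> by simp
      then show "w \<in> V" using w unfolding V_def by blast
    qed
  qed
  then have "open V" using continuous_open_preimage[OF cont\<Psi> D_props(1) open_ball] by simp
  have "compact (\<Phi> ` cball 0 r)"
    by (intro compact_continuous_image continuous_on_subset[OF cont\<Phi> b(2)] compact_cball)
  then have cl: "closure V \<subseteq> \<Phi> ` cball 0 r"
    by (intro closure_minimal compact_imp_closed) (auto simp: V_def)
  have "closed_segment (\<Phi> z) e \<inter> frontier V \<noteq> {}"
    by (rule connected_Int_frontier) (use zV eV in auto)
  then obtain y where y: "y \<in> closed_segment (\<Phi> z) e" "y \<in> closure V" "y \<notin> V"
    using \<open>open V\<close> unfolding frontier_def by (auto simp: interior_open)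
  then obtain u where u: "y = \<Phi> u" "cmod u \<le> r" using cl by auto
  then have "cmod u = r" using y(3) by (cases "cmod u < r") (auto simp: V_def)
  have "dist y e \<le> dist (\<Phi> z) e" using dist_in_closed_segment[OF y(1)] by (simp add: dist_commute)
  then show ?thesis
    using z(3) u(1) \<open>cmod u = r\<close> Arg2pi[of u] by (intro that[of "Arg2pi u"]) (auto simp: cis_conv_exp is_Arg_def)
qed

text \<open>By the maximum principle for \<open>\<Phi> - e\<close>, the circle cannot be mapped
  closer to e than the centre is.\<close>

lemma circle_point_far:
  assumes r: "0 < r" "r < 1" and d: "\<delta> < dist (\<Phi> 0) e"
  obtains \<theta> where "\<theta> \<in> {0..2*pi}" "\<delta> \<le> dist (\<Phi> (of_real r * cis \<theta>)) e"
proof -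
  have b: "cball 0 r \<subseteq> ball (0::complex) 1" using r by auto
  have "\<exists>u. cmod u = r \<and> \<delta> \<le> cmod (\<Phi> u - e)"
  proof (rule ccontr)
    assume *: "\<not> ?thesis"
    have "cmod (\<Phi> 0 - e) \<le> \<delta>"
    proof (rule maximum_modulus_frontier[of "\<lambda>z. \<Phi> z - e" "ball 0 r"])
      show "(\<lambda>z. \<Phi> z - e) holomorphic_on interior (ball 0 r)"
        by (intro holomorphic_intros holomorphic_on_subset[OF hol\<Phi>]) (use b in auto)
      show "continuous_on (closure (ball 0 r)) (\<lambda>z. \<Phi> z - e)"
        by (intro continuous_intros continuous_on_subset[OF cont\<Phi>]) (use b r in auto)
      show "cmod (\<Phi> z - e) \<le> \<delta>" if "z \<in> frontier (ball 0 r)" for z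
        using * that r by (force simp: frontier_ball)
    qed (use r in auto)
    then show False using d by (simp add: dist_norm)
  qed
  then obtain u where "cmod u = r" "\<delta> \<le> cmod (\<Phi> u - e)" by blast
  then show ?thesis using Arg2pi[of u] by (intro that[of "Arg2pi u"]) (auto simp: cis_conv_exp is_Arg_def dist_norm)
qed

lemma circle_derivative:
  assumes "0 < r" "r < 1"
  shows "((\<lambda>t. \<Phi> (of_real r * cis t)) has_vector_derivative (of_real r * (\<i> * cis t) * deriv \<Phi> (of_real r * cis t))) (at t)"
proof -
  have "of_real r * cis t \<in> ball 0 1" using assms by (simp add: norm_mult)
  then have "(\<Phi> has_field_derivative deriv \<Phi> (of_real r * cis t)) (at (of_real r * cis t))"
    using holomorphic_derivI[OF hol\<Phi> open_ball] by blast
  moreover have "((\<lambda>t. of_real r * cis t) has_vector_derivative of_real r * (\<i> * cis t)) (at t)"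
  proof -
    have "((\<lambda>z. of_real r * exp (\<i> * z)) has_field_derivative of_real r * (\<i> * exp (\<i> * of_real t))) (at (of_real t))"
      by (auto intro!: derivative_eq_intros)
    from has_vector_derivative_real_field[OF this] show ?thesis by (simp add: cis_conv_exp)
  qed
  ultimately show ?thesis using field_vector_diff_chain_at[of "\<lambda>t. of_real r * cis t" _ t \<Phi>] by (simp add: o_def)
qed

lemma length_circle_le:
  assumes L: "variation_le g L" and r: "0 < r" "r < 1"
  shows "r * integral {0..2*pi} (\<lambda>t. cmod (deriv \<Phi> (of_real r * cis t))) \<le> 6 * L"
proof -
  have sub: "of_real r * cis t \<in> ball 0 1" for t using r by (simp add: norm_mult)
  have dh: "deriv \<Phi> holomorphic_on ball 0 1" by (rule holomorphic_deriv[OF hol\<Phi> open_ball])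
  have "continuous_on UNIV (\<lambda>t. deriv \<Phi> (of_real r * cis t))"
    by (rule continuous_on_compose2[OF holomorphic_on_imp_continuous_on[OF dh]])
      (use sub in \<open>auto intro!: continuous_intros\<close>)
  then have "integral {0..2*pi} (\<lambda>t. cmod (of_real r * (\<i> * cis t) * deriv \<Phi> (of_real r * cis t))) \<le> 6 * L"
    using discrete_length_le[OF L, of _ "of_real r"] r
    by (intro length_integral_le[OF circle_derivative[OF r]] continuous_intros) auto
  also have "(\<lambda>t. cmod (of_real r * (\<i> * cis t) * deriv \<Phi> (of_real r * cis t))) = (\<lambda>t. r * cmod (deriv \<Phi> (of_real r * cis t)))"
    using r by (simp add: norm_mult)
  finally show ?thesis by simp
qed

text \<open>Around each zero in a finite set G, the image of a suitable circle travels a length of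
  at least \<open>\<rho>\<close>/2 where F is below the threshold \<open>\<tau>\<close>. Different
  zeros use disjoint times, and the weight w is 1 at all of them, so card G times
  \<open>\<rho>\<close>/2 is at most the integral of w times \<open>|\<Phi>'|\<close>. Uniform
  integrability bounds this by C times the integral of w plus an error, and Jensen's inequality
  makes the integral of w small. The order of choices is C, then \<open>\<tau>\<close>, then the
  admissible \<open>\<rho>\<close>, then G, and r last.\<close>

lemma boundary_zeros_null:
  assumes L: "variation_le g L" and cont: "continuous_on (D \<union> \<Gamma>) \<phi>" and hol: "\<phi> holomorphic_on D"
    and nz: "\<phi> (\<Phi> 0) \<noteq> 0" and E: "E \<subseteq> \<Gamma>" "\<And>x. x \<in> E \<Longrightarrow> \<phi> x = 0"
  shows "hausdorff1 E = 0"
proof -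
  have cpt: "compact (D \<union> \<Gamma>)" using D_props by (metis compact_closure)
  then have "bounded (\<phi> ` (D \<union> \<Gamma>))" by (intro compact_imp_bounded compact_continuous_image cont)
  then obtain b where b: "b > 0" "\<And>x. x \<in> D \<union> \<Gamma> \<Longrightarrow> cmod (\<phi> x) \<le> b" unfolding bounded_pos by auto
  define F where "F z = \<phi> (\<Phi> z) / of_real b" for z
  have Fhol: "F holomorphic_on ball 0 1"
    unfolding F_def using b(1)
    by (intro holomorphic_intros holomorphic_on_compose_gen[OF hol\<Phi> hol, unfolded o_def]) (use \<Phi>_in in auto)
  have F0: "F 0 \<noteq> 0" using nz b(1) by (simp add: F_def)
  have F1: "cmod (F z) \<le> 1" if "z \<in> ball 0 1" for z
    using b(2)[of "\<Phi> z"] \<Phi>_in[OF that] b(1) by (simp add: F_def norm_divide)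
  have "deriv \<Phi> z \<noteq> 0" if "z \<in> ball 0 1" for z
    by (rule holomorphic_injective_imp_regular[OF hol\<Phi> open_ball inj\<Phi> that])
  moreover have "deriv \<Phi> holomorphic_on ball 0 1" by (rule holomorphic_deriv[OF hol\<Phi> open_ball])
  \<comment> \<open>The derivative of an injective holomorphic function has no zeros, and the disc
    is simply connected.\<close>
  ultimately obtain q where q: "q holomorphic_on ball 0 1" "\<And>z. z \<in> ball 0 1 \<Longrightarrow> deriv \<Phi> z = (q z)\<^sup>2"
    using simply_connected_eq_holomorphic_sqrt[OF open_ball, THEN iffD1, OF convex_imp_simply_connected[OF convex_ball],
        THEN conjunct2, rule_format, of "deriv \<Phi>"] by blast
  have sub: "of_real r * cis t \<in> ball 0 1" if "0 < r" "r < 1" for r t using that by (simp add: norm_mult)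
  have q2: "cmod (deriv \<Phi> (of_real r * cis t)) = (cmod (q (of_real r * cis t)))\<^sup>2" if "0 < r" "r < 1" for r t
    using q(2)[OF sub[OF that]] by (simp add: norm_power)
  have qL: "r * integral {0..2*pi} (\<lambda>t. (cmod (q (of_real r * cis t)))\<^sup>2) \<le> 6 * L" if "0 < r" "r < 1" for r
    using length_circle_le[OF L that] q2[OF that] by simp
  have key: "\<exists>\<rho>0>0. \<forall>\<rho> G. 0 < \<rho> \<and> \<rho> < \<rho>0 \<and> finite G \<and> G \<subseteq> E \<and>
      (\<forall>x\<in>G. \<forall>y\<in>G. x \<noteq> y \<longrightarrow> cball x \<rho> \<inter> cball y \<rho> = {}) \<longrightarrow> real (card G) * \<rho> \<le> \<epsilon>" if "\<epsilon> > 0" for \<epsilon>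
  proof -
    have "\<epsilon> / 4 > 0" using that by simp
    obtain C where C: "C > 0" "\<forall>r w. 0 < r \<and> r < 1 \<and> continuous_on {0..2*pi} w \<and> (\<forall>t\<in>{0..2*pi}. 0 \<le> w t \<and> w t \<le> 1) \<longrightarrow>
        integral {0..2*pi} (\<lambda>t. w t * (cmod (q (of_real r * cis t)))\<^sup>2) \<le> C * integral {0..2*pi} w + \<epsilon> / 4"
    proof (rule square_uniformly_integrable[OF q(1) _ \<open>\<epsilon> / 4 > 0\<close>])
      show "r * integral {0..2*pi} (\<lambda>t. (cmod (q (of_real r * cis t)))\<^sup>2) \<le> 6 * L" if "0 < r" "r < 1" for r
        by (rule qL[OF that])
    qed (rule that)
    \<comment> \<open>By Jensen's inequality, m times the integral of w is at most 2 pi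
      \<open>|ln |F 0||\<close>; with this m the product of C and the integral of w is at most
      \<open>\<epsilon>\<close>/4. The 1 keeps m positive when F 0 has modulus 1.\<close>
    define m where "m = C * (2 * pi * \<bar>ln (cmod (F 0))\<bar>) / (\<epsilon> / 4) + 1"
    define \<tau> where "\<tau> = exp (- m)"
    have "m > 0" unfolding m_def using C(1) that by (intro add_nonneg_pos) auto
    then have \<tau>: "0 < \<tau>" "\<tau> < 1" "ln \<tau> = - m" by (auto simp: \<tau>_def)
    have "uniformly_continuous_on (D \<union> \<Gamma>) \<phi>" by (rule compact_uniformly_continuous[OF cont cpt])
    moreover have "\<tau> * b > 0" using \<tau> b by simp
    ultimately obtain d where d: "d > 0" "\<forall>x\<in>D \<union> \<Gamma>. \<forall>y\<in>D \<union> \<Gamma>. dist y x < d \<longrightarrow> dist (\<phi> y) (\<phi> x) < \<tau> * b"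
      unfolding uniformly_continuous_on_def by blast
    have P0: "\<Phi> 0 \<in> D" by (rule \<Phi>_in) simp
    have "infdist (\<Phi> 0) \<Gamma> > 0"
      by (rule infdist_pos_not_in_closed[OF compact_imp_closed[OF D_props(8)] D_props(9)]) (use P0 D_props(6) in blast)
    \<comment> \<open>The bound d makes the function small on each ball; the distance from
      \<open>\<Phi> 0\<close> to \<open>\<Gamma>\<close> keeps the centre out of the balls, so that
      the image of the circle has to leave them.\<close>
    show ?thesis
    proof (intro exI[of _ "min d (infdist (\<Phi> 0) \<Gamma>)"] conjI allI impI; (elim conjE)?)
      show "0 < min d (infdist (\<Phi> 0) \<Gamma>)" using d \<open>infdist (\<Phi> 0) \<Gamma> > 0\<close> by simp
      fix \<rho> :: real and G :: "complex set"
      assume \<rho>: "0 < \<rho>" "\<rho> < min d (infdist (\<Phi> 0) \<Gamma>)" and G: "finite G" "G \<subseteq> E"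
        and disj: "\<forall>x\<in>G. \<forall>y\<in>G. x \<noteq> y \<longrightarrow> cball x \<rho> \<inter> cball y \<rho> = {}"
      have "\<exists>z. cmod z < 1 \<and> dist (\<Phi> z) e < \<rho> / 2" if "e \<in> G" for e
      proof -
        have "e \<in> closure D" using that G E D_props(7) by blast
        moreover have "\<rho> / 2 > 0" using \<rho> by simp
        ultimately obtain w where w: "w \<in> D" "dist w e < \<rho> / 2" unfolding closure_approachable by blast
        then show ?thesis using \<Psi>_in \<Phi>\<Psi> by (intro exI[of _ "\<Psi> w"]) auto
      qed
      then obtain z where z: "\<And>e. e \<in> G \<Longrightarrow> cmod (z e) < 1 \<and> dist (\<Phi> (z e)) e < \<rho> / 2" by metis
      \<comment> \<open>The inserted 0 provides for an empty G and makes r positive.\<close>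
      define R where "R = Max (insert 0 ((\<lambda>e. cmod (z e)) ` G))"
      have "R < 1" unfolding R_def using G(1) z by (subst Max_less_iff) auto
      then obtain r where r: "R < r" "r < 1" using dense by blast
      have Rge: "x \<le> R" if "x \<in> insert 0 ((\<lambda>e. cmod (z e)) ` G)" for x
        unfolding R_def by (rule Max_ge) (use G that in auto)
      have r0: "0 < r" using Rge[of 0] r by simp
      have zr: "cmod (z e) < r" if "e \<in> G" for e using Rge[of "cmod (z e)"] r that by force
      define p where "p t = \<Phi> (of_real r * cis t)" for t
      define p' where "p' t = of_real r * (\<i> * cis t) * deriv \<Phi> (of_real r * cis t)" for t
      have pd: "(p has_vector_derivative p' t) (at t)" for t
        unfolding p_def p'_def by (rule circle_derivative[OF r0 r(2)])
      have pcont: "continuous_on S p" for S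
        using pd by (intro continuous_at_imp_continuous_on ballI has_vector_derivative_continuous)
      \<comment> \<open>A continuous weight with values in [0, 1], equal to 1 exactly where
        \<open>|F|\<close> is at most \<open>\<tau>\<close>; it is the integrand of
        \<open>jensen_truncated\<close> divided by the negative number ln \<open>\<tau>\<close> = -
        m.\<close>
      define w where "w t = ln (max (cmod (F (of_real r * cis t))) \<tau>) / ln \<tau>" for t
      have Fcont: "continuous_on S (\<lambda>t. F (of_real r * cis t))" for S
        by (rule continuous_on_compose2[OF holomorphic_on_imp_continuous_on[OF Fhol]])
          (use sub[OF r0 r(2)] in \<open>auto intro!: continuous_intros\<close>)
      have wcont: "continuous_on S w" for S
        unfolding w_def using \<tau> by (intro continuous_intros Fcont) auto
      have w01: "0 \<le> w t \<and> w t \<le> 1" for t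
      proof -
        have "ln \<tau> \<le> ln (max (cmod (F (of_real r * cis t))) \<tau>)" using \<tau> by (subst ln_le_cancel_iff) auto
        moreover have "ln (max (cmod (F (of_real r * cis t))) \<tau>) \<le> 0"
          using \<tau> F1[OF sub[OF r0 r(2)]] by (intro ln_le_zero_iff[THEN iffD2]) auto
        ultimately show ?thesis using \<tau> \<open>m > 0\<close> by (simp add: w_def divide_nonpos_nonpos field_simps)
      qed
      have w1: "w t = 1" if "cmod (F (of_real r * cis t)) \<le> \<tau>" for t
        using that \<tau> \<open>m > 0\<close> by (simp add: w_def max_def)
      have Iw: "C * integral {0..2*pi} w \<le> \<epsilon> / 4"
      proof -
        have "2 * pi * ln (cmod (F 0)) \<le> integral {0..2*pi} (\<lambda>t. ln (max (cmod (F (of_real r * cis t))) \<tau>))"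
          by (rule jensen_truncated[OF Fhol F0 r0 r(2) \<tau>(1)])
        also have "\<dots> = integral {0..2*pi} (\<lambda>t. (- m) * w t)"
          using \<tau>(3) \<open>m > 0\<close> by (intro integral_cong) (simp add: w_def)
        also have "\<dots> = (- m) * integral {0..2*pi} w" by simp
        finally have "m * integral {0..2*pi} w \<le> 2 * pi * \<bar>ln (cmod (F 0))\<bar>"
          using F0 F1[of 0] by simp
        then have "C * (m * integral {0..2*pi} w) \<le> C * (2 * pi * \<bar>ln (cmod (F 0))\<bar>)"
          using C(1) by (intro mult_left_mono) auto
        also have "\<dots> = (m - 1) * (\<epsilon> / 4)" using \<open>\<epsilon> / 4 > 0\<close> by (simp add: m_def)
        also have "\<dots> \<le> m * (\<epsilon> / 4)" using \<open>\<epsilon> / 4 > 0\<close> by (intro mult_right_mono) auto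
        finally have "m * (C * integral {0..2*pi} w) \<le> m * (\<epsilon> / 4)" by (simp only: mult_ac)
        then show ?thesis using \<open>m > 0\<close> by simp
      qed
      define f where "f t = w t * (cmod (q (of_real r * cis t)))\<^sup>2" for t
      have qcont: "continuous_on S (\<lambda>t. q (of_real r * cis t))" for S
        by (rule continuous_on_compose2[OF holomorphic_on_imp_continuous_on[OF q(1)]])
          (use sub[OF r0 r(2)] in \<open>auto intro!: continuous_intros\<close>)
      have fcont: "continuous_on S f" for S unfolding f_def by (intro continuous_intros wcont qcont)
      have If: "integral {0..2*pi} f \<le> \<epsilon> / 2"
      proof -
        have "integral {0..2*pi} f \<le> C * integral {0..2*pi} w + \<epsilon> / 4"
          unfolding f_def using C(2) r0 r(2) wcont w01 by blast
        then show ?thesis using Iw by simp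
      qed
      have "\<exists>\<alpha> \<beta>. 0 \<le> \<alpha> \<and> \<alpha> \<le> \<beta> \<and> \<beta> \<le> 2*pi \<and> (\<forall>t\<in>{\<alpha>..\<beta>}. dist (p t) e \<le> \<rho>) \<and> \<rho> / 2 \<le> dist (p \<alpha>) (p \<beta>)"
        if e: "e \<in> G" for e
      proof -
        have e\<Gamma>: "e \<in> \<Gamma>" using e G E by blast
        obtain \<theta>0 where \<theta>0: "\<theta>0 \<in> {0..2*pi}" "dist (p \<theta>0) e < \<rho> / 2"
          unfolding p_def
          by (rule circle_point_near[OF e\<Gamma> zr[OF e] r(2) conjunct2[OF z[OF e]]], rule that, assumption)
            (simp only: p_def)
        have far: "\<rho> < dist (\<Phi> 0) e" using \<rho> infdist_le[OF e\<Gamma>, of "\<Phi> 0"] by simp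
        obtain \<theta>1 where \<theta>1: "\<theta>1 \<in> {0..2*pi}" "\<rho> \<le> dist (p \<theta>1) e"
          by (rule circle_point_far[OF r0 r(2) far], rule that, assumption) (simp only: p_def)
        have "continuous_on {0..2*pi} (\<lambda>t. dist (p t) e)" by (intro continuous_intros pcont)
        moreover have "dist (p \<theta>0) e < \<rho>" using \<theta>0 \<rho> by simp
        ultimately obtain \<alpha> \<beta> where ab: "0 \<le> \<alpha>" "\<alpha> \<le> \<beta>" "\<beta> \<le> 2*pi" "\<forall>t\<in>{\<alpha>..\<beta>}. dist (p t) e \<le> \<rho>"
          "\<bar>dist (p \<alpha>) e - dist (p \<beta>) e\<bar> = \<rho> - dist (p \<theta>0) e"
          using crossing_interval[of 0 "2*pi" "\<lambda>t. dist (p t) e" \<theta>0 \<rho> \<theta>1] \<theta>0(1) \<theta>1 by (metis (no_types, lifting))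
        have "\<bar>dist (p \<alpha>) e - dist (p \<beta>) e\<bar> \<le> dist (p \<alpha>) (p \<beta>)"
          by (metis abs_dist_diff_le dist_commute)
        then show ?thesis using ab \<theta>0(2) by (intro exI[of _ \<alpha>] exI[of _ \<beta>]) auto
      qed
      then obtain l u where lu: "\<And>e. e \<in> G \<Longrightarrow> 0 \<le> l e \<and> l e \<le> u e \<and> u e \<le> 2*pi \<and>
          (\<forall>t\<in>{l e..u e}. dist (p t) e \<le> \<rho>) \<and> \<rho> / 2 \<le> dist (p (l e)) (p (u e))" by metis
      have step: "\<rho> / 2 \<le> integral {l e..u e} f" if e: "e \<in> G" for e
      proof -
        have "(p' has_integral p (u e) - p (l e)) {l e..u e}"
          by (rule fundamental_theorem_of_calculus) (use lu[OF e] pd in \<open>auto intro: has_vector_derivative_at_within\<close>)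
        moreover have "norm (integral {l e..u e} p') \<le> integral {l e..u e} f"
        proof (rule integral_norm_bound_integral)
          show "p' integrable_on {l e..u e}" using calculation by blast
          show "f integrable_on {l e..u e}" by (intro integrable_continuous_interval fcont)
          fix t assume t: "t \<in> {l e..u e}"
          have pD: "p t \<in> D" unfolding p_def by (intro \<Phi>_in sub r0 r(2))
          have "dist (p t) e < d" using lu[OF e] t \<rho>(2) by force
          then have "dist (\<phi> (p t)) (\<phi> e) < \<tau> * b" using d(2) pD e G(2) E(1) by blast
          then have "cmod (\<phi> (p t)) < \<tau> * b" using E(2) e G(2) by (auto simp: dist_norm)
          then have "cmod (F (of_real r * cis t)) \<le> \<tau>" using b(1) by (simp add: F_def p_def norm_divide field_simps)
          then have "f t = cmod (deriv \<Phi> (of_real r * cis t))" using w1 q2[OF r0 r(2)] by (simp add: f_def)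
          moreover have "norm (p' t) = r * cmod (deriv \<Phi> (of_real r * cis t))" using r0 by (simp add: p'_def norm_mult)
          ultimately show "norm (p' t) \<le> f t" using r(2) r0 by (simp add: mult_left_le_one_le)
        qed
        ultimately have "norm (p (u e) - p (l e)) \<le> integral {l e..u e} f" by (metis integral_unique)
        then show ?thesis using lu[OF e] by (simp add: dist_norm norm_minus_commute)
      qed
      have "(\<Sum>e\<in>G. integral {l e..u e} f) \<le> integral {0..2*pi} f"
      proof (rule sum_integral_disjoint_le[OF G(1) fcont])
        show "0 \<le> f t" for t using w01[of t] by (simp add: f_def)
        show "{l e..u e} \<subseteq> {0..2*pi}" if "e \<in> G" for e using lu[OF that] by auto
        fix x y assume xy: "x \<in> G" "y \<in> G" "x \<noteq> y"
        show "{l x..u x} \<inter> {l y..u y} = {}"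
        proof (rule ccontr)
          assume "\<not> ?thesis"
          then obtain t where "t \<in> {l x..u x}" "t \<in> {l y..u y}" by blast
          then have "p t \<in> cball x \<rho>" "p t \<in> cball y \<rho>" using lu[OF xy(1)] lu[OF xy(2)] by (auto simp: dist_commute)
          then show False using disj xy by blast
        qed
      qed
      moreover have "(\<Sum>e\<in>G. \<rho> / 2) \<le> (\<Sum>e\<in>G. integral {l e..u e} f)" by (intro sum_mono step)
      ultimately show "real (card G) * \<rho> \<le> \<epsilon>" using If by simp
    qed
  qed
  show ?thesis
  proof (rule hausdorff1_null_if_ball_covers)
    fix \<delta> \<epsilon> :: real assume "\<delta> > 0" "\<epsilon> > 0"
    \<comment> \<open>The covering lemma enlarges the radii five times, hence the fifths here and in
      the choice of \<open>\<rho>\<close>.\<close>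
    then have "\<epsilon> / 5 > 0" by simp
    from key[OF this] obtain \<rho>0 where \<rho>0: "\<rho>0 > 0" "\<forall>\<rho> G. 0 < \<rho> \<and> \<rho> < \<rho>0 \<and> finite G \<and> G \<subseteq> E \<and>
      (\<forall>x\<in>G. \<forall>y\<in>G. x \<noteq> y \<longrightarrow> cball x \<rho> \<inter> cball y \<rho> = {}) \<longrightarrow> real (card G) * \<rho> \<le> \<epsilon> / 5" by blast
    define \<rho> where "\<rho> = min (\<rho>0 / 2) (\<delta> / 5)"
    have \<rho>: "0 < \<rho>" "\<rho> < \<rho>0" "5 * \<rho> \<le> \<delta>" using \<rho>0(1) \<open>\<delta> > 0\<close> by (auto simp: \<rho>_def)
    have cover: "E \<subseteq> (\<Union>x\<in>E. cball x \<rho>)" using \<rho>(1) by force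
    obtain K where K: "countable K" "K \<subseteq> E" "pairwise (\<lambda>x y. disjnt (cball x \<rho>) (cball y \<rho>)) K"
      "E \<subseteq> (\<Union>x\<in>K. cball x (5 * \<rho>))"
    proof (rule Vitali_covering_lemma_cballs[OF cover, where B = \<rho>])
      show "0 < \<rho> \<and> \<rho> \<le> \<rho>" using \<rho>(1) by simp
    qed (rule that)
    have card_le: "real (card G) * \<rho> \<le> \<epsilon> / 5" if "finite G" "G \<subseteq> K" for G
    proof -
      have "\<forall>x\<in>G. \<forall>y\<in>G. x \<noteq> y \<longrightarrow> cball x \<rho> \<inter> cball y \<rho> = {}"
        using K(3) that(2) unfolding pairwise_def disjnt_def by blast
      then show ?thesis using \<rho>0(2) \<rho> that K(2) by blast
    qed
    \<comment> \<open>The bound on the number of disjoint balls holds for every finite part of K and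
      therefore limits K itself.\<close>
    have "finite K"
    proof (rule ccontr)
      assume "infinite K"
      obtain n :: nat where n: "\<epsilon> / 5 / \<rho> < n" using reals_Archimedean2 by blast
      obtain G where G: "finite G" "card G = n" "G \<subseteq> K" using infinite_arbitrarily_large[OF \<open>infinite K\<close>] by blast
      have "\<epsilon> / 5 < n * \<rho>" using n \<rho>(1) by (simp add: pos_divide_less_eq)
      then show False using card_le[OF G(1,3)] G(2) by simp
    qed
    then have "real (card K) * \<rho> \<le> \<epsilon> / 5" by (intro card_le) auto
    then show "\<exists>F \<rho>. finite F \<and> 0 < \<rho> \<and> \<rho> \<le> \<delta> \<and> E \<subseteq> (\<Union>x\<in>F. cball x \<rho>) \<and> real (card F) * \<rho> \<le> \<epsilon>"
      using \<open>finite K\<close> K(4) \<rho> by (intro exI[of _ K] exI[of _ "5 * \<rho>"]) auto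
  qed
qed

end

theorem zero_if_zero_on_boundary_set:
  assumes "simple_path g" "pathfinish g = pathstart g" "variation_le g L"
    and "continuous_on (inside (path_image g) \<union> path_image g) \<phi>" "\<phi> holomorphic_on inside (path_image g)"
    and "E \<subseteq> path_image g" "\<And>x. x \<in> E \<Longrightarrow> \<phi> x = 0" "hausdorff1 E > 0" "w \<in> inside (path_image g)"
  shows "\<phi> w = 0"
proof (rule ccontr)
  assume "\<phi> w \<noteq> 0"
  obtain \<Phi> \<Psi> where "jordan_conformal g \<Phi> \<Psi>" "\<Phi> 0 = w"
    by (rule riemann_map_at[OF assms(1,2,9)])
  then have "hausdorff1 E = 0"
    using \<open>\<phi> w \<noteq> 0\<close> assms by (intro jordan_conformal.boundary_zeros_null[of g \<Phi> \<Psi> L \<phi>]) auto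
  then show False using assms(8) by simp
qed

section \<open>Jordan domains on the sphere\<close>

lemma jordan_curve_props:
  assumes "jordan_curve \<Gamma>"
  shows "inside \<Gamma> \<noteq> {}" "open (inside \<Gamma>)" "connected (inside \<Gamma>)" "bounded (inside \<Gamma>)"
    "outside \<Gamma> \<noteq> {}" "open (outside \<Gamma>)" "connected (outside \<Gamma>)" "\<not> bounded (outside \<Gamma>)"
    "inside \<Gamma> \<inter> outside \<Gamma> = {}" "inside \<Gamma> \<union> outside \<Gamma> = - \<Gamma>"
    "closure (inside \<Gamma>) = inside \<Gamma> \<union> \<Gamma>" "closure (outside \<Gamma>) = outside \<Gamma> \<union> \<Gamma>"
    "frontier (inside \<Gamma>) = \<Gamma>" "compact \<Gamma>"
proof -
  obtain g where g: "simple_path g" "pathfinish g = pathstart g" "path_image g = \<Gamma>"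
    using assms by (auto simp: jordan_curve_def)
  note J = Jordan_inside_outside[OF g(1,2), unfolded g(3)]
  then show "inside \<Gamma> \<noteq> {}" "open (inside \<Gamma>)" "connected (inside \<Gamma>)" "bounded (inside \<Gamma>)"
    "outside \<Gamma> \<noteq> {}" "open (outside \<Gamma>)" "connected (outside \<Gamma>)" "\<not> bounded (outside \<Gamma>)"
    "inside \<Gamma> \<inter> outside \<Gamma> = {}" "inside \<Gamma> \<union> outside \<Gamma> = - \<Gamma>" "frontier (inside \<Gamma>) = \<Gamma>"
    by simp_all
  show "closure (inside \<Gamma>) = inside \<Gamma> \<union> \<Gamma>" "closure (outside \<Gamma>) = outside \<Gamma> \<union> \<Gamma>"
    using J closure_Un_frontier[of "inside \<Gamma>"] closure_Un_frontier[of "outside \<Gamma>"] by simp_all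
  show "compact \<Gamma>" using g by (metis compact_simple_path_image)
qed

lemma topspace_sphere: "topspace riemann_sphere = UNIV"
  using UNIV_option_conv by auto

lemma Some_vimage_sets [simp]: "Some -` Some ` A = A" "Some -` insert None (Some ` A) = A"
  by auto

lemma openin_sphere_iff:
  "openin riemann_sphere V \<longleftrightarrow> open (Some -` V) \<and> (None \<in> V \<longrightarrow> compact (- (Some -` V)))"
proof
  assume "openin riemann_sphere V"
  then consider U where "open U" "V = Some ` U" | C where "compact C" "closed C" "V = insert None (Some ` (- C))"
    by (auto simp: openin_Alexandroff_compactification Compl_eq_Diff_UNIV)
  then show "open (Some -` V) \<and> (None \<in> V \<longrightarrow> compact (- (Some -` V)))"
    by cases (auto simp: open_Compl)
next
  assume *: "open (Some -` V) \<and> (None \<in> V \<longrightarrow> compact (- (Some -` V)))"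
  show "openin riemann_sphere V"
  proof (cases "None \<in> V")
    case True
    have "V = insert None (Some ` (UNIV - (- (Some -` V))))"
    proof (rule set_eqI)
      fix q show "q \<in> V \<longleftrightarrow> q \<in> insert None (Some ` (UNIV - (- (Some -` V))))"
        using True by (cases q) auto
    qed
    moreover have "compactin euclidean (- (Some -` V))" "closedin euclidean (- (Some -` V))"
      using * True by (auto simp: compact_imp_closed)
    ultimately show ?thesis unfolding openin_Alexandroff_compactification by (metis topspace_euclidean)
  next
    case False
    have "V = Some ` (Some -` V)"
    proof (rule set_eqI)
      fix q show "q \<in> V \<longleftrightarrow> q \<in> Some ` (Some -` V)" using False by (cases q) auto
    qed
    then show ?thesis using * unfolding openin_Alexandroff_compactification by (metis open_openin)
  qed
qed

lemma sphere_closure_Some: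
  assumes "bounded S"
  shows "riemann_sphere closure_of (Some ` S) = Some ` closure S"
proof
  have "closedin riemann_sphere (Some ` closure S)"
    unfolding closedin_def topspace_sphere
  proof
    have "Some -` (UNIV - Some ` closure S) = - closure S" by auto
    then show "openin riemann_sphere (UNIV - Some ` closure S)"
      using assms by (auto simp: openin_sphere_iff)
  qed simp
  then show "riemann_sphere closure_of (Some ` S) \<subseteq> Some ` closure S"
    by (intro closure_of_minimal image_mono closure_subset)
  show "Some ` closure S \<subseteq> riemann_sphere closure_of (Some ` S)"
    using continuous_map_image_closure_subset[OF continuous_map_Some[of euclidean], of S] by simp
qed

lemma sphere_closure_unbounded:
  assumes "\<not> bounded S"
  shows "riemann_sphere closure_of (Some ` S) = insert None (Some ` closure S)"
proof
  have "closedin riemann_sphere (insert None (Some ` closure S))"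
    unfolding closedin_def topspace_sphere
  proof
    have "Some -` (UNIV - insert None (Some ` closure S)) = - closure S" by auto
    then show "openin riemann_sphere (UNIV - insert None (Some ` closure S))"
      by (auto simp: openin_sphere_iff)
  qed simp
  moreover have "Some ` S \<subseteq> insert None (Some ` closure S)" using closure_subset[of S] by blast
  ultimately show "riemann_sphere closure_of (Some ` S) \<subseteq> insert None (Some ` closure S)"
    by (intro closure_of_minimal)
  have "None \<in> riemann_sphere closure_of (Some ` S)"
    unfolding in_closure_of topspace_sphere
  proof (intro conjI allI impI; (elim conjE)?)
    fix T assume T: "None \<in> T" "openin riemann_sphere T"
    then have "bounded (- (Some -` T))" by (auto simp: openin_sphere_iff compact_imp_bounded)
    then have "\<not> S \<subseteq> - (Some -` T)" using assms bounded_subset by blast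
    then show "\<exists>y. y \<in> Some ` S \<and> y \<in> T" by blast
  qed simp
  then show "insert None (Some ` closure S) \<subseteq> riemann_sphere closure_of (Some ` S)"
    using continuous_map_image_closure_subset[OF continuous_map_Some[of euclidean], of S] by simp
qed

lemma connected_component_of_clopen:
  assumes "connectedin X A" "openin X A" "closedin X A" "x \<in> A"
  shows "connected_component_of_set X x = A"
proof
  show "A \<subseteq> connected_component_of_set X x" by (rule connected_component_of_maximal[OF assms(1,4)])
  have "x \<in> connected_component_of_set X x" using \<open>A \<subseteq> connected_component_of_set X x\<close> assms(4) by blast
  then show "connected_component_of_set X x \<subseteq> A"
    using connectedin_clopen_cases[OF connectedin_connected_component_of[of X x] assms(3,2)] assms(4)
    by (auto simp: disjnt_iff)
qed

text \<open>The two sets are disjoint, open, connected and fill the complement of the curve. So both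
  are open and closed in it, hence are its components.\<close>

lemma jordan_components:
  assumes "jordan_curve \<Gamma>"
  shows "inner_component \<Gamma> = Some ` inside \<Gamma>"
    and "outer_component \<Gamma> = insert None (Some ` outside \<Gamma>)"
proof -
  note J = jordan_curve_props[OF assms]
  define X where "X = subtopology riemann_sphere (- Some ` \<Gamma>)"
  define A where "A = Some ` inside \<Gamma>"
  define B where "B = insert None (Some ` outside \<Gamma>)"
  have top: "topspace X = - Some ` \<Gamma>" by (simp only: X_def topspace_subtopology topspace_sphere Int_UNIV_left)
  have AB: "A \<union> B = - Some ` \<Gamma>" "A \<inter> B = {}"
  proof -
    show "A \<union> B = - Some ` \<Gamma>"
    proof (rule set_eqI)
      have mem: "x \<in> \<Gamma> \<longleftrightarrow> x \<notin> inside \<Gamma> \<and> x \<notin> outside \<Gamma>" for x using J(10) by blast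
      fix q show "q \<in> A \<union> B \<longleftrightarrow> q \<in> - Some ` \<Gamma>"
        by (cases q) (auto simp: A_def B_def mem image_iff)
    qed
    show "A \<inter> B = {}" using J(9) unfolding A_def B_def by blast
  qed
  have oA: "openin X A"
  proof -
    have "openin riemann_sphere A" using J(2) by (auto simp: openin_sphere_iff A_def)
    moreover have "A = (- Some ` \<Gamma>) \<inter> A" using AB by blast
    ultimately show ?thesis unfolding X_def by (metis openin_subtopology_Int2)
  qed
  have oB: "openin X B"
  proof -
    have "- outside \<Gamma> = inside \<Gamma> \<union> \<Gamma>" using J(9,10) outside_no_overlap[of \<Gamma>] by blast
    then have "- outside \<Gamma> = closure (inside \<Gamma>)" using J(11) by simp
    then have "compact (- outside \<Gamma>)" using J(4) by simp
    then have "openin riemann_sphere B" using J(6) by (auto simp: openin_sphere_iff B_def)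
    moreover have "B = (- Some ` \<Gamma>) \<inter> B" using AB by blast
    ultimately show ?thesis unfolding X_def by (metis openin_subtopology_Int2)
  qed
  have cl: "closedin X A" "closedin X B"
  proof -
    have "topspace X - B = A" "topspace X - A = B" using AB top by auto
    then show "closedin X A" "closedin X B" using oA oB closedin_diff[OF closedin_topspace] by metis+
  qed
  have cA: "connectedin X A"
  proof -
    have "connectedin riemann_sphere A"
      unfolding A_def by (rule connectedin_continuous_map_image[OF continuous_map_Some]) (simp add: J)
    then show ?thesis using AB unfolding X_def connectedin_subtopology by blast
  qed
  have cB: "connectedin X B"
  proof -
    have "connectedin riemann_sphere (Some ` outside \<Gamma>)"
      by (rule connectedin_continuous_map_image[OF continuous_map_Some]) (simp add: J)
    \<comment> \<open>The outside is unbounded, so infinity belongs to its closure, and adding a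
      point of the closure preserves connectedness.\<close>
    then have "connectedin riemann_sphere B"
      by (rule connectedin_intermediate_closure_of)
        (use sphere_closure_unbounded[OF J(8)] closure_subset[of "outside \<Gamma>"] in \<open>auto simp: B_def\<close>)
    then show ?thesis using AB unfolding X_def connectedin_subtopology by blast
  qed
  have compA: "connected_component_of_set X x = A" if "x \<in> A" for x
    by (rule connected_component_of_clopen[OF cA oA cl(1) that])
  have compB: "connected_component_of_set X x = B" if "x \<in> B" for x
    by (rule connected_component_of_clopen[OF cB oB cl(2) that])
  have "None \<in> B" by (simp add: B_def)
  then show "outer_component \<Gamma> = insert None (Some ` outside \<Gamma>)"
    unfolding outer_component_def X_def[symmetric] B_def[symmetric] by (rule compB)
  have "A \<noteq> {}" using J(1) by (simp add: A_def)
  have "inner_component \<Gamma> = A"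
    unfolding inner_component_def X_def[symmetric]
  proof (rule the_equality)
    show "A \<in> connected_components_of X \<and> None \<notin> A"
    proof
      obtain x where x: "x \<in> A" using \<open>A \<noteq> {}\<close> by blast
      then have "x \<in> topspace X" using AB top by blast
      then show "A \<in> connected_components_of X"
        using compA[OF x] unfolding connected_components_of_def by (intro image_eqI[of _ _ x]) auto
    qed (simp add: A_def)
    fix C assume C: "C \<in> connected_components_of X \<and> None \<notin> C"
    then obtain x where x: "x \<in> topspace X" "C = connected_component_of_set X x"
      unfolding connected_components_of_def by blast
    then have "x \<in> A \<or> x \<in> B" using AB top by blast
    then show "C = A"
    proof
      assume "x \<in> B"
      then have "C = B" using compB x by simp
      then show ?thesis using C \<open>None \<in> B\<close> by simp
    qed (use compA x in simp)
  qed
  then show "inner_component \<Gamma> = Some ` inside \<Gamma>" by (simp add: A_def)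
qed

lemma nested_compact_eq:
  assumes "jordan_curve \<Gamma>i" "jordan_curve \<Gamma>e"
  shows "nested_compact \<Gamma>i \<Gamma>e = insert None (Some ` ((inside \<Gamma>i \<union> \<Gamma>i) \<union> (outside \<Gamma>e \<union> \<Gamma>e)))"
proof -
  note Ji = jordan_curve_props[OF assms(1)] and Je = jordan_curve_props[OF assms(2)]
  have sub: "None \<in> riemann_sphere closure_of (Some ` outside \<Gamma>e)"
    unfolding sphere_closure_unbounded[OF Je(8)] by simp
  have "riemann_sphere closure_of (insert None (Some ` outside \<Gamma>e)) =
      riemann_sphere closure_of {None} \<union> riemann_sphere closure_of (Some ` outside \<Gamma>e)"
    using closure_of_Un[of riemann_sphere "{None}" "Some ` outside \<Gamma>e"] by simp
  moreover have "riemann_sphere closure_of {None} \<subseteq> riemann_sphere closure_of (Some ` outside \<Gamma>e)"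
    by (rule closure_of_minimal) (use sub in auto)
  ultimately show ?thesis
    unfolding nested_compact_def jordan_components[OF assms(1)] jordan_components[OF assms(2)]
      sphere_closure_Some[OF Ji(4)] sphere_closure_unbounded[OF Je(8)] Ji(11) Je(12)
    by (auto simp: sphere_closure_unbounded[OF Je(8)] Je(12))
qed

section \<open>Zeros of positive length in closed Jordan domains, and inversion\<close>

lemma rectifiable_jordan_curveE:
  assumes "rectifiable_jordan_curve \<Gamma>"
  obtains g L where "simple_path g" "pathfinish g = pathstart g" "path_image g = \<Gamma>" "variation_le g L"
  using assms unfolding rectifiable_jordan_curve_def rectifiable_path_def variation_le_def by blast

lemma rectifiable_imp_jordan_curve: "rectifiable_jordan_curve \<Gamma> \<Longrightarrow> jordan_curve \<Gamma>"
  by (auto simp: rectifiable_jordan_curve_def jordan_curve_def)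

text \<open>A set of positive length is uncountable, so it has infinitely many points in some
  compact part of S, and these accumulate inside S; the identity theorem applies.\<close>

lemma holomorphic_zero_if_positive_length:
  assumes "open S" "connected S" "\<phi> holomorphic_on S" "Z \<subseteq> S" "\<And>x. x \<in> Z \<Longrightarrow> \<phi> x = 0" "hausdorff1 Z > 0" "w \<in> S"
  shows "\<phi> w = 0"
proof -
  obtain C :: "nat \<Rightarrow> complex set" where C: "\<And>n. compact (C n)" "\<And>n. C n \<subseteq> S" "\<Union>(range C) = S"
    using open_Union_compact_subsets[OF assms(1)] by metis
  have "\<exists>n. infinite (Z \<inter> C n)"
  proof (rule ccontr)
    assume "\<not> ?thesis"
    then have "countable (\<Union>n. Z \<inter> C n)" by (intro countable_UN) (auto intro: countable_finite)
    moreover have "(\<Union>n. Z \<inter> C n) = Z" using C(3) assms(4) by blast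
    ultimately show False using hausdorff1_null_countable[of Z] assms(6) by simp
  qed
  then obtain n where "infinite (Z \<inter> C n)" by blast
  then obtain x where x: "x \<in> C n" "x islimpt (Z \<inter> C n)"
    using C(1)[of n] unfolding compact_eq_Bolzano_Weierstrass by blast
  then have "x islimpt Z" by (meson inf_le1 islimpt_subset)
  then show ?thesis
    using analytic_continuation[OF assms(3,1,2,4)] x(1) C(2)[of n] assms(5,7) by blast
qed

text \<open>One of the two parts of Z, on the curve or inside it, has positive length. The first is
  handled by the boundary theorem, the second by the identity theorem.\<close>

lemma zero_on_closure_inside:
  assumes \<Gamma>: "rectifiable_jordan_curve \<Gamma>" and cont: "continuous_on (inside \<Gamma> \<union> \<Gamma>) \<phi>"
    and hol: "\<phi> holomorphic_on inside \<Gamma>"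
    and Z: "Z \<subseteq> inside \<Gamma> \<union> \<Gamma>" "\<And>x. x \<in> Z \<Longrightarrow> \<phi> x = 0" "hausdorff1 Z > 0" and w: "w \<in> inside \<Gamma> \<union> \<Gamma>"
  shows "\<phi> w = 0"
proof -
  note J = jordan_curve_props[OF rectifiable_imp_jordan_curve[OF \<Gamma>]]
  obtain g L where g: "simple_path g" "pathfinish g = pathstart g" "path_image g = \<Gamma>" "variation_le g L"
    by (rule rectifiable_jordan_curveE[OF \<Gamma>])
  have zero: "\<phi> x = 0" if "x \<in> inside \<Gamma>" for x
  proof (cases "hausdorff1 (Z \<inter> \<Gamma>) > 0")
    case True
    then show ?thesis
      using zero_if_zero_on_boundary_set[OF g(1,2,4), unfolded g(3), OF cont hol _ _ True that] Z(2) by blast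
  next
    case False
    then have "hausdorff1 (Z \<inter> inside \<Gamma>) \<noteq> 0"
      using hausdorff1_null_Un[of "Z \<inter> \<Gamma>" "Z \<inter> inside \<Gamma>"] Z(1,3) by (metis Int_Un_distrib Un_commute inf.absorb1 not_gr_zero)
    then show ?thesis
      using holomorphic_zero_if_positive_length[OF J(2,3) hol, of "Z \<inter> inside \<Gamma>" x] Z(2) that by (simp add: zero_less_iff_neq_zero)
  qed
  show ?thesis
    by (rule continuous_constant_on_closure[of "inside \<Gamma>" \<phi>]) (use cont zero w J(11) in auto)
qed

text \<open>Under the inversion at w, the outside of \<open>\<Gamma>\<close> with 0 added as the
  image of infinity becomes a connected set T, and the inside without w becomes a connected set U.
  Together they fill the complement of \<open>\<Gamma>'\<close>. Since U is unbounded, it lies in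
  the outside of \<open>\<Gamma>'\<close>, which identifies T as the inside.\<close>

lemma inversion_inside:
  assumes \<Gamma>: "jordan_curve \<Gamma>" "jordan_curve \<Gamma>'" and w: "w \<in> inside \<Gamma>" and \<Gamma>': "\<Gamma>' = (\<lambda>c. 1 / (c - w)) ` \<Gamma>"
  shows "inside \<Gamma>' = insert 0 ((\<lambda>c. 1 / (c - w)) ` outside \<Gamma>)"
proof -
  note J = jordan_curve_props[OF \<Gamma>(1)] and J' = jordan_curve_props[OF \<Gamma>(2)]
  define j where "j c = 1 / (c - w)" for c
  define T where "T = insert 0 (j ` outside \<Gamma>)"
  define U where "U = j ` (inside \<Gamma> - {w})"
  have w_out: "w \<notin> outside \<Gamma>" "w \<notin> \<Gamma>" using w J(9) J(10) by blast+
  have jinj: "c = c'" if "j c = j c'" "c \<noteq> w" "c' \<noteq> w" for c c' using that by (auto simp: j_def divide_simps)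
  have j0: "j c \<noteq> 0" if "c \<noteq> w" for c using that by (simp add: j_def)
  have jc: "continuous_on S j" if "w \<notin> S" for S unfolding j_def using that by (auto intro!: continuous_intros)
  have cover: "T \<union> U \<union> \<Gamma>' = UNIV"
  proof -
    have "\<zeta> \<in> T \<union> U \<union> \<Gamma>'" if "\<zeta> \<noteq> 0" for \<zeta>
    proof -
      have "\<zeta> = j (w + 1 / \<zeta>)" "w + 1 / \<zeta> \<noteq> w" using that by (auto simp: j_def)
      moreover have "w + 1/\<zeta> \<in> inside \<Gamma> \<or> w + 1/\<zeta> \<in> outside \<Gamma> \<or> w + 1/\<zeta> \<in> \<Gamma>" using J(10) by blast
      ultimately show ?thesis unfolding T_def U_def \<Gamma>' j_def[symmetric] by blast
    qed
    then show ?thesis by (auto simp: T_def)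
  qed
  have disj: "T \<inter> \<Gamma>' = {}" "U \<inter> \<Gamma>' = {}"
  proof -
    have disj_j: "j ` S \<inter> j ` \<Gamma> = {}" if "S \<inter> \<Gamma> = {}" "w \<notin> S" for S
    proof (rule equals0I)
      fix \<zeta> assume "\<zeta> \<in> j ` S \<inter> j ` \<Gamma>"
      then obtain c c' where c: "c \<in> S" "c' \<in> \<Gamma>" "j c = j c'" by fastforce
      have "c \<noteq> w" "c' \<noteq> w" using c(1,2) that(2) w_out(2) by blast+
      then have "c = c'" using jinj[OF c(3)] by blast
      then show False using c that by blast
    qed
    have "0 \<notin> j ` \<Gamma>" using j0 w_out(2) by force
    moreover have "outside \<Gamma> \<inter> \<Gamma> = {}" "(inside \<Gamma> - {w}) \<inter> \<Gamma> = {}" using J(10) by blast+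
    ultimately show "T \<inter> \<Gamma>' = {}" "U \<inter> \<Gamma>' = {}"
      using disj_j[of "outside \<Gamma>"] disj_j[of "inside \<Gamma> - {w}"] w_out(1)
      unfolding T_def U_def \<Gamma>' j_def[symmetric] by auto
  qed
  have "connected (j ` outside \<Gamma>)"
    by (rule connected_continuous_image[OF jc[OF w_out(1)] J(7)])
  moreover have "0 \<in> closure (j ` outside \<Gamma>)"
    unfolding closure_approachable
  proof (intro allI impI)
    fix e :: real assume "e > 0"
    have "\<not> outside \<Gamma> \<subseteq> cball w (1/e)" using J(8) bounded_subset[OF bounded_cball] by blast
    then obtain c where c: "c \<in> outside \<Gamma>" "c \<notin> cball w (1/e)" by blast
    then have "1/e < cmod (c - w)" by (simp add: dist_norm norm_minus_commute)
    moreover from this have "0 < cmod (c - w)" using \<open>e > 0\<close> less_trans[of 0 "1/e" "cmod (c - w)"] by simp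
    ultimately have "cmod (j c) < e" using \<open>e > 0\<close> by (simp add: j_def norm_divide pos_divide_less_eq mult.commute)
    then show "\<exists>y\<in>j ` outside \<Gamma>. dist y 0 < e" using c(1) by auto
  qed
  ultimately have Tc: "connected T"
    unfolding T_def using closure_subset[of "j ` outside \<Gamma>"]
    by (elim connected_intermediate_closure) blast+
  have "connected (inside \<Gamma> - {w})" by (rule connected_open_delete[OF J(2,3)]) simp
  then have Uc: "connected U" unfolding U_def by (rule connected_continuous_image[OF jc, rotated]) simp
  have "\<not> bounded U"
  proof
    assume "bounded U"
    then obtain b where b: "b > 0" "\<And>\<zeta>. \<zeta> \<in> U \<Longrightarrow> cmod \<zeta> \<le> b" unfolding bounded_pos by blast
    obtain e where e: "e > 0" "ball w e \<subseteq> inside \<Gamma>" using J(2) w openE by blast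
    \<comment> \<open>A point at distance s from w is mapped to modulus 1/s, at least twice the
      supposed bound b.\<close>
    define s where "s = min (e/2) (1 / (2 * b))"
    have s: "s > 0" "s < e" "s \<le> 1 / (2 * b)" using e(1) b(1) by (auto simp: s_def)
    have "w + of_real s \<in> inside \<Gamma> - {w}" using e(2) s by (auto simp: dist_norm)
    then have "j (w + of_real s) \<in> U" unfolding U_def by blast
    then have "1 / s \<le> b" using b(2)[of "j (w + of_real s)"] s(1) by (simp add: j_def norm_divide)
    then show False using s(1,3) b(1) by (simp add: field_simps)
  qed
  then have "U \<subseteq> outside \<Gamma>'" by (intro connected_unbounded_subset_outside Uc disj)
  then have "inside \<Gamma>' \<subseteq> T" using cover J'(9,10) by blast
  moreover have "T \<subseteq> inside \<Gamma>'"
    using connected_Int_frontier[OF Tc, of "inside \<Gamma>'"] J'(1,13) disj(1) \<open>inside \<Gamma>' \<subseteq> T\<close> by blast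
  ultimately show ?thesis unfolding T_def j_def[symmetric] by blast
qed

text \<open>With d the distance from w to \<open>\<Gamma>\<close>, the inversion is Lipschitz on the
  curve with constant 1 / d^2, so it multiplies the variation by at most this factor.\<close>

lemma inversion_rectifiable:
  assumes "rectifiable_jordan_curve \<Gamma>" "w \<notin> \<Gamma>"
  shows "rectifiable_jordan_curve ((\<lambda>c. 1 / (c - w)) ` \<Gamma>)"
proof -
  define j where "j c = 1 / (c - w)" for c
  obtain g L where g: "simple_path g" "pathfinish g = pathstart g" "path_image g = \<Gamma>" "variation_le g L"
    by (rule rectifiable_jordan_curveE[OF assms(1)])
  have "closed \<Gamma>" "\<Gamma> \<noteq> {}" using g by (auto simp: closed_simple_path_image)
  then have "infdist w \<Gamma> > 0" using assms(2) by (simp add: infdist_pos_not_in_closed)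
  define d where "d = infdist w \<Gamma>"
  have d: "d > 0" "\<And>c. c \<in> \<Gamma> \<Longrightarrow> d \<le> cmod (c - w)"
    using \<open>infdist w \<Gamma> > 0\<close> infdist_le[of _ \<Gamma> w] by (auto simp: d_def dist_norm norm_minus_commute)
  have lip: "dist (j a) (j b) \<le> dist a b / d\<^sup>2" if "a \<in> \<Gamma>" "b \<in> \<Gamma>" for a b
  proof -
    have ab: "a \<noteq> w" "b \<noteq> w" using that assms(2) by auto
    have "j a - j b = (b - a) / ((a - w) * (b - w))" using ab by (simp add: j_def field_simps)
    then have "dist (j a) (j b) = dist a b / (cmod (a - w) * cmod (b - w))"
      by (simp add: dist_norm norm_divide norm_mult norm_minus_commute)
    also have "\<dots> \<le> dist a b / d\<^sup>2"
      unfolding power2_eq_square using d that ab by (intro divide_left_mono mult_mono mult_pos_pos) auto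
    finally show ?thesis .
  qed
  have cj: "continuous_on \<Gamma> j" unfolding j_def using assms(2) by (auto intro!: continuous_intros)
  have ij: "inj_on j \<Gamma>" unfolding j_def inj_on_def using assms(2) by (auto simp: divide_simps)
  have pg: "path (j \<circ> g)" using g(1) cj by (intro path_continuous_image) (auto simp: g(3) simple_path_imp_path)
  have "simple_path (j \<circ> g)"
    unfolding simple_path_def loop_free_def
  proof (intro conjI ballI impI pg)
    fix s t :: real assume st: "s \<in> {0..1}" "t \<in> {0..1}" "(j \<circ> g) s = (j \<circ> g) t"
    have "g s \<in> \<Gamma>" "g t \<in> \<Gamma>" using st(1,2) g(3) by (auto simp: path_image_def)
    then have "g s = g t" using inj_onD[OF ij, of "g s" "g t"] st(3) by simp
    then show "s = t \<or> s = 0 \<and> t = 1 \<or> s = 1 \<and> t = 0"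
      using g(1) st(1,2) unfolding simple_path_def loop_free_def by blast
  qed
  moreover have "pathfinish (j \<circ> g) = pathstart (j \<circ> g)" using g(2) by (simp add: pathfinish_compose pathstart_compose)
  moreover have "path_image (j \<circ> g) = (\<lambda>c. 1 / (c - w)) ` \<Gamma>" by (simp add: path_image_compose g(3) j_def)
  moreover have "rectifiable_path (j \<circ> g)"
    unfolding rectifiable_path_def
  proof (intro conjI pg exI[of _ "L / d\<^sup>2"] allI impI; (elim conjE)?)
    fix n and t :: "nat \<Rightarrow> real" assume t: "\<forall>i\<le>n. t i \<in> {0..1}" "\<forall>i<n. t i \<le> t (Suc i)"
    have "g (t i) \<in> \<Gamma>" if "i \<le> n" for i using t(1) that g(3) by (auto simp: path_image_def)
    then have "(\<Sum>i<n. dist ((j \<circ> g) (t i)) ((j \<circ> g) (t (Suc i)))) \<le> (\<Sum>i<n. dist (g (t i)) (g (t (Suc i))) / d\<^sup>2)"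
      by (intro sum_mono) (simp add: lip)
    also have "\<dots> \<le> L / d\<^sup>2"
      unfolding sum_divide_distrib[symmetric] using variation_leD[OF g(4), of n t] t by (intro divide_right_mono) auto
    finally show "(\<Sum>i<n. dist ((j \<circ> g) (t i)) ((j \<circ> g) (t (Suc i)))) \<le> L / d\<^sup>2" .
  qed
  ultimately show ?thesis unfolding rectifiable_jordan_curve_def by blast
qed

text \<open>Null sets are pulled back by the inverse map, which is Lipschitz only on bounded parts
  of Z: on the ball of radius n + 1 about w the constant is (n + 1)^2. Countably many balls exhaust
  Z.\<close>

lemma hausdorff1_inversion_pos:
  fixes w :: complex
  assumes "hausdorff1 Z > 0" "w \<notin> Z"
  shows "hausdorff1 ((\<lambda>c. 1 / (c - w)) ` Z) > 0"
proof (rule ccontr)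
  assume "\<not> ?thesis"
  then have null: "hausdorff1 ((\<lambda>c. 1 / (c - w)) ` Z) = 0" by simp
  have "hausdorff1 (Z \<inter> cball w (Suc n)) = 0" for n
  proof -
    define A where "A = (\<lambda>c. 1 / (c - w)) ` (Z \<inter> cball w (Suc n))"
    have "hausdorff1 A = 0" by (rule hausdorff1_null_subset[OF null]) (auto simp: A_def)
    moreover have "((Suc n)\<^sup>2)-lipschitz_on A (\<lambda>\<zeta>. w + 1 / \<zeta>)"
    proof (rule lipschitz_onI)
      have A: "\<zeta> \<noteq> 0 \<and> 1 / cmod \<zeta> \<le> Suc n" if "\<zeta> \<in> A" for \<zeta>
        using that assms(2) by (auto simp: A_def norm_divide dist_norm norm_minus_commute)
      fix \<zeta> \<xi> assume \<zeta>\<xi>: "\<zeta> \<in> A" "\<xi> \<in> A"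
      have "w + 1 / \<zeta> - (w + 1 / \<xi>) = (\<xi> - \<zeta>) * (1 / \<zeta>) * (1 / \<xi>)" using A[OF \<zeta>\<xi>(1)] A[OF \<zeta>\<xi>(2)] by (simp add: field_simps)
      then have "dist (w + 1 / \<zeta>) (w + 1 / \<xi>) = dist \<zeta> \<xi> * (1 / cmod \<zeta>) * (1 / cmod \<xi>)"
        by (simp add: dist_norm norm_mult norm_divide norm_minus_commute)
      also have "\<dots> \<le> dist \<zeta> \<xi> * Suc n * Suc n"
        using A[OF \<zeta>\<xi>(1)] A[OF \<zeta>\<xi>(2)] by (intro mult_mono mult_nonneg_nonneg) auto
      finally show "dist (w + 1 / \<zeta>) (w + 1 / \<xi>) \<le> (Suc n)\<^sup>2 * dist \<zeta> \<xi>"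
        by (simp only: power2_eq_square mult_ac of_nat_mult)
    qed simp
    ultimately have "hausdorff1 ((\<lambda>\<zeta>. w + 1 / \<zeta>) ` A) = 0" by (rule hausdorff1_null_lipschitz_image)
    moreover have "(\<lambda>\<zeta>. w + 1 / \<zeta>) ` A = Z \<inter> cball w (Suc n)"
    proof -
      have "w + 1 / (1 / (c - w)) = c" if "c \<in> Z \<inter> cball w (Suc n)" for c using that assms(2) by simp
      then show ?thesis unfolding A_def image_image by simp
    qed
    ultimately show ?thesis by simp
  qed
  then have "hausdorff1 (\<Union>n. Z \<inter> cball w (Suc n)) = 0" by (rule hausdorff1_null_UN)
  moreover have "(\<Union>n. Z \<inter> cball w (Suc n)) = Z"
  proof -
    have "\<exists>n. dist w c \<le> Suc n" for c
      using reals_Archimedean2[of "dist w c"] by (meson less_imp_le of_nat_le_iff order_trans lessI)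
    then show ?thesis by auto
  qed
  ultimately show False using assms(1) by simp
qed

text \<open>In the coordinate \<open>\<zeta>\<close> = 1 / (x - w), with w inside the curve, the
  exterior domain becomes an ordinary Jordan domain and infinity becomes 0. Continuity at 0 removes
  the singularity there, and \<open>zero_on_closure_inside\<close> applies.\<close>

lemma zero_on_closure_outside:
  fixes \<psi> :: "complex option \<Rightarrow> complex"
  assumes \<Gamma>: "rectifiable_jordan_curve \<Gamma>" and cont: "continuous_on (outside \<Gamma> \<union> \<Gamma>) (\<psi> \<circ> Some)"
    and hol: "(\<psi> \<circ> Some) holomorphic_on outside \<Gamma>" and inf: "isCont (\<psi> \<circ> inv_chart) 0"
    and Z: "Z \<subseteq> outside \<Gamma> \<union> \<Gamma>" "\<And>x. x \<in> Z \<Longrightarrow> \<psi> (Some x) = 0" "hausdorff1 Z > 0"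
  shows "\<psi> None = 0" "\<And>x. x \<in> outside \<Gamma> \<union> \<Gamma> \<Longrightarrow> \<psi> (Some x) = 0"
proof -
  note J = jordan_curve_props[OF rectifiable_imp_jordan_curve[OF \<Gamma>]]
  obtain w where w: "w \<in> inside \<Gamma>" using J(1) by blast
  have wn: "w \<notin> \<Gamma>" "w \<notin> outside \<Gamma>" using w J(9) J(10) by blast+
  define j where "j c = 1 / (c - w)" for c
  define \<Gamma>' where "\<Gamma>' = j ` \<Gamma>"
  have \<Gamma>': "rectifiable_jordan_curve \<Gamma>'" unfolding \<Gamma>'_def j_def by (rule inversion_rectifiable[OF \<Gamma> wn(1)])
  note J' = jordan_curve_props[OF rectifiable_imp_jordan_curve[OF \<Gamma>']]
  have ins: "inside \<Gamma>' = insert 0 (j ` outside \<Gamma>)"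
    unfolding j_def
    by (rule inversion_inside[OF rectifiable_imp_jordan_curve[OF \<Gamma>] rectifiable_imp_jordan_curve[OF \<Gamma>'] w]) (simp add: \<Gamma>'_def j_def)
  have jj: "w + 1 / j c = c" if "c \<noteq> w" for c using that by (simp add: j_def)
  have jj': "j (w + 1 / \<zeta>) = \<zeta>" if "\<zeta> \<noteq> 0" for \<zeta> using that by (simp add: j_def)
  have jn0: "j c \<noteq> 0" if "c \<noteq> w" for c using that by (simp add: j_def)
  define \<phi> where "\<phi> \<zeta> = \<psi> (if \<zeta> = 0 then None else Some (w + 1 / \<zeta>))" for \<zeta>
  have \<phi>j: "\<phi> (j c) = \<psi> (Some c)" if "c \<noteq> w" for c using jj[OF that] jn0[OF that] by (simp add: \<phi>_def)
  have outer: "w + 1 / \<zeta> \<in> outside \<Gamma> \<union> \<Gamma>" if "\<zeta> \<in> (inside \<Gamma>' \<union> \<Gamma>') - {0}" for \<zeta>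
  proof -
    have "\<zeta> \<in> j ` (outside \<Gamma> \<union> \<Gamma>)" using that ins \<Gamma>'_def by blast
    then obtain c where c: "c \<in> outside \<Gamma> \<union> \<Gamma>" "\<zeta> = j c" by blast
    then have "c \<noteq> w" using wn by blast
    then show ?thesis using jj[of c] c by simp
  qed
  have outer': "w + 1 / \<zeta> \<in> outside \<Gamma>" if "\<zeta> \<in> inside \<Gamma>' - {0}" for \<zeta>
  proof -
    have "\<zeta> \<in> j ` outside \<Gamma>" using that ins by blast
    then obtain c where c: "c \<in> outside \<Gamma>" "\<zeta> = j c" by blast
    then have "c \<noteq> w" using wn by blast
    then show ?thesis using jj[of c] c by simp
  qed
  have cont': "continuous_on ((inside \<Gamma>' \<union> \<Gamma>') - {0}) \<phi>"
  proof -
    have "continuous_on ((inside \<Gamma>' \<union> \<Gamma>') - {0}) (\<lambda>\<zeta>. (\<psi> \<circ> Some) (w + 1 / \<zeta>))"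
      by (rule continuous_on_compose2[OF cont]) (use outer in \<open>auto intro!: continuous_intros\<close>)
    then show ?thesis by (rule continuous_on_eq) (auto simp: \<phi>_def)
  qed
  have hol': "\<phi> holomorphic_on inside \<Gamma>' - {0}"
  proof -
    have "(\<lambda>\<zeta>. (\<psi> \<circ> Some) (w + 1 / \<zeta>)) holomorphic_on inside \<Gamma>' - {0}"
      by (rule holomorphic_on_compose_gen[OF _ hol, unfolded o_def[of "\<psi> \<circ> Some"]])
        (use outer' in \<open>auto intro!: holomorphic_intros\<close>)
    then show ?thesis by (rule holomorphic_transform) (auto simp: \<phi>_def)
  qed
  have c0: "isCont \<phi> 0"
  proof -
    \<comment> \<open>The change of coordinate at infinity: x = w + 1/\<open>\<zeta>\<close> means
      1/x = \<open>\<xi> \<zeta>\<close>. It transfers continuity from \<open>inv_chart\<close> to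
      the inversion at w.\<close>
    define \<xi> where "\<xi> \<zeta> = \<zeta> / (1 + w * \<zeta>)" for \<zeta>
    have "isCont \<xi> 0" unfolding \<xi>_def by (intro continuous_intros) auto
    moreover have "\<xi> 0 = 0" by (simp add: \<xi>_def)
    then have "isCont (\<psi> \<circ> inv_chart) (\<xi> 0)" using inf by simp
    ultimately have c: "isCont (\<lambda>\<zeta>. (\<psi> \<circ> inv_chart) (\<xi> \<zeta>)) 0" by (rule isCont_o2)
    have "((\<lambda>\<zeta>. 1 + w * \<zeta>) \<longlongrightarrow> 1 + w * 0) (nhds 0)" by (intro tendsto_intros filterlim_ident)
    then have "\<forall>\<^sub>F \<zeta> in nhds 0. 1 + w * \<zeta> \<noteq> 0" by (rule tendsto_imp_eventually_ne) simp
    then have "\<forall>\<^sub>F \<zeta> in nhds 0. (\<psi> \<circ> inv_chart) (\<xi> \<zeta>) = \<phi> \<zeta>"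
    proof eventually_elim
      case (elim \<zeta>)
      then show ?case
        by (cases "\<zeta> = 0") (auto simp: \<phi>_def \<xi>_def inv_chart_def add_divide_distrib algebra_simps)
    qed
    then show ?thesis using c by (rule isCont_cong[THEN iffD1])
  qed
  have "continuous_on (inside \<Gamma>' \<union> \<Gamma>') \<phi>"
    unfolding continuous_on_eq_continuous_within
  proof
    fix x assume x: "x \<in> inside \<Gamma>' \<union> \<Gamma>'"
    show "continuous (at x within inside \<Gamma>' \<union> \<Gamma>') \<phi>"
    proof (cases "x = 0")
      case True
      then show ?thesis using c0 continuous_at_imp_continuous_at_within by blast
    next
      case False
      then have "continuous (at x within (inside \<Gamma>' \<union> \<Gamma>') - {0}) \<phi>"
        using cont' x by (auto simp: continuous_on_eq_continuous_within)
      moreover have "at x within (inside \<Gamma>' \<union> \<Gamma>') - {0} = at x within (inside \<Gamma>' \<union> \<Gamma>')"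
        using False by (intro at_within_nhd[of x "- {0}"]) auto
      ultimately show ?thesis by simp
    qed
  qed
  moreover then have "\<phi> holomorphic_on inside \<Gamma>'"
    by (intro no_isolated_singularity[OF _ hol' J'(2)]) (auto intro: continuous_on_subset)
  moreover have "j ` Z \<subseteq> inside \<Gamma>' \<union> \<Gamma>'" using Z(1) ins \<Gamma>'_def by blast
  moreover have "\<phi> \<zeta> = 0" if "\<zeta> \<in> j ` Z" for \<zeta>
  proof -
    from that obtain c where c: "c \<in> Z" "\<zeta> = j c" by blast
    then have "c \<noteq> w" using Z(1) wn by blast
    then show ?thesis using \<phi>j Z(2) c by simp
  qed
  moreover have "hausdorff1 (j ` Z) > 0"
    unfolding j_def by (rule hausdorff1_inversion_pos[OF Z(3)]) (use Z(1) wn in auto)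
  ultimately have zero: "\<phi> \<zeta> = 0" if "\<zeta> \<in> inside \<Gamma>' \<union> \<Gamma>'" for \<zeta>
    using zero_on_closure_inside[OF \<Gamma>'] that by blast
  show "\<psi> None = 0" using zero[of 0] by (simp add: ins \<phi>_def)
  show "\<psi> (Some x) = 0" if x: "x \<in> outside \<Gamma> \<union> \<Gamma>" for x
  proof -
    have "x \<noteq> w" using x wn by auto
    moreover have "j x \<in> inside \<Gamma>' \<union> \<Gamma>'" using x ins \<Gamma>'_def by blast
    ultimately show ?thesis using zero[of "j x"] \<phi>j[of x] by simp
  qed
qed

section \<open>Norming functionals\<close>

text \<open>An element of the unit ball of the dual of B, written as a function on the whole ambient
  type that is constrained on B only. The norm bound 1 makes scalar estimates uniform over all
  functionals.\<close>

definition contractive_functional ::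
  "(complex \<Rightarrow> 'b \<Rightarrow> 'b) \<Rightarrow> 'b::ab_group_add set \<Rightarrow> ('b \<Rightarrow> real) \<Rightarrow> ('b \<Rightarrow> complex) \<Rightarrow> bool" where
  "contractive_functional smul B N l \<longleftrightarrow>
     (\<forall>x\<in>B. \<forall>y\<in>B. l (x + y) = l x + l y) \<and> (\<forall>c. \<forall>x\<in>B. l (smul c x) = c * l x) \<and> (\<forall>x\<in>B. cmod (l x) \<le> N x)"

locale normed_carrier = vector_space smul
  for smul :: "complex \<Rightarrow> 'b \<Rightarrow> 'b::ab_group_add" +
  fixes B :: "'b set" and N :: "'b \<Rightarrow> real"
  assumes banach: "complex_banach smul B N"
begin

lemma sub: "subspace B" and N_nonneg: "x \<in> B \<Longrightarrow> N x \<ge> 0" and N_zero: "x \<in> B \<Longrightarrow> N x = 0 \<longleftrightarrow> x = 0"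
  and N_smul: "x \<in> B \<Longrightarrow> N (smul c x) = cmod c * N x"
  and N_add: "x \<in> B \<Longrightarrow> y \<in> B \<Longrightarrow> N (x + y) \<le> N x + N y"
  using banach by (auto simp: complex_banach_def)

lemmas B_add = subspace_add[OF sub] and B_scale = subspace_scale[OF sub] and B_0 = subspace_0[OF sub]
  and B_diff = subspace_diff[OF sub] and B_neg = subspace_neg[OF sub]

text \<open>Values off the carrier are fixed to 0, so that the pointwise order on functions of the
  whole type is the order on B and minimality can be stated as an equation of functions.\<close>

definition sublinear :: "('b \<Rightarrow> real) \<Rightarrow> bool" where
  "sublinear p \<longleftrightarrow> (\<forall>x. x \<notin> B \<longrightarrow> p x = 0) \<and> (\<forall>x\<in>B. \<forall>y\<in>B. p (x + y) \<le> p x + p y) \<and>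
     (\<forall>t. \<forall>x\<in>B. 0 \<le> t \<longrightarrow> p (smul (of_real t) x) = t * p x)"

lemma sublinearD:
  assumes "sublinear p"
  shows "x \<notin> B \<Longrightarrow> p x = 0" "x \<in> B \<Longrightarrow> y \<in> B \<Longrightarrow> p (x + y) \<le> p x + p y"
    "x \<in> B \<Longrightarrow> 0 \<le> t \<Longrightarrow> p (smul (of_real t) x) = t * p x" "p 0 = 0" "x \<in> B \<Longrightarrow> - p (- x) \<le> p x"
proof -
  show 1: "x \<notin> B \<Longrightarrow> p x = 0" "x \<in> B \<Longrightarrow> y \<in> B \<Longrightarrow> p (x + y) \<le> p x + p y"
    and 2: "x \<in> B \<Longrightarrow> 0 \<le> t \<Longrightarrow> p (smul (of_real t) x) = t * p x" for x y t
    using assms by (auto simp: sublinear_def)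
  show p0: "p 0 = 0" using 2[OF B_0, of 0] by simp
  show "x \<in> B \<Longrightarrow> - p (- x) \<le> p x" using 1(2)[of x "- x"] B_neg p0 by auto
qed

text \<open>The classical auxiliary function in the proof of the Hahn-Banach theorem through minimal
  sublinear functions: a sublinear minorant of p whose value at -y is at most - p y, as t = 1
  shows.\<close>

definition lower :: "('b \<Rightarrow> real) \<Rightarrow> 'b \<Rightarrow> 'b \<Rightarrow> real" where
  "lower p y x = (if x \<in> B then (INF t\<in>{0..}. p (x + smul (of_real t) y) - t * p y) else 0)"

lemma lower:
  assumes p: "sublinear p" and y: "y \<in> B"
  shows "x \<in> B \<Longrightarrow> 0 \<le> t \<Longrightarrow> lower p y x \<le> p (x + smul (of_real t) y) - t * p y"
    and "sublinear (lower p y)"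
proof -
  have bdd: "bdd_below ((\<lambda>t. p (x + smul (of_real t) y) - t * p y) ` {0..})" if x: "x \<in> B" for x
  proof (rule bdd_belowI[of _ "- p (- x)"], elim imageE)
    fix v t assume t: "v = p (x + smul (of_real t) y) - t * p y" "t \<in> {0::real..}"
    have "p ((x + smul (of_real t) y) + (- x)) \<le> p (x + smul (of_real t) y) + p (- x)"
      by (intro sublinearD(2)[OF p] B_add B_scale B_neg x y)
    moreover have "p ((x + smul (of_real t) y) + (- x)) = t * p y"
      using sublinearD(3)[OF p y, of t] t(2) by simp
    ultimately show "- p (- x) \<le> v" unfolding t(1) by linarith
  qed
  show le: "lower p y x \<le> p (x + smul (of_real t) y) - t * p y" if "x \<in> B" "0 \<le> t" for x t
    unfolding lower_def using that by (auto intro!: cINF_lower bdd)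
  have ge: "c \<le> lower p y x" if "x \<in> B" "\<And>t. 0 \<le> t \<Longrightarrow> c \<le> p (x + smul (of_real t) y) - t * p y" for c x
    unfolding lower_def using that by (auto intro!: cINF_greatest)
  \<comment> \<open>One inequality for all positive s is enough; the reverse follows by applying it
    with 1/s to the scaled vector.\<close>
  have hom_le: "lower p y (smul (of_real s) x) \<le> s * lower p y x" if s: "0 < s" and x: "x \<in> B" for s x
  proof -
    have "lower p y (smul (of_real s) x) / s \<le> lower p y x"
    proof (rule ge[OF x])
      fix t :: real assume t: "0 \<le> t"
      have "lower p y (smul (of_real s) x) \<le> p (smul (of_real s) x + smul (of_real (s * t)) y) - (s * t) * p y"
        by (rule le) (use x s t B_scale in auto)
      also have "smul (of_real s) x + smul (of_real (s * t)) y = smul (of_real s) (x + smul (of_real t) y)"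
        by (simp add: scale_right_distrib)
      also have "p \<dots> = s * p (x + smul (of_real t) y)"
        by (rule sublinearD(3)[OF p]) (use s in \<open>auto intro!: B_add B_scale x y\<close>)
      finally show "lower p y (smul (of_real s) x) / s \<le> p (x + smul (of_real t) y) - t * p y"
        using s by (simp add: field_simps)
    qed
    then show ?thesis using s by (simp add: field_simps)
  qed
  show "sublinear (lower p y)"
    unfolding sublinear_def
  proof (intro conjI allI impI ballI)
    show "lower p y x = 0" if "x \<notin> B" for x using that by (simp add: lower_def)
  next
    fix x z assume xz: "x \<in> B" "z \<in> B"
    have sum: "lower p y (x + z) \<le> (p (x + smul (of_real t) y) - t * p y) + (p (z + smul (of_real s) y) - s * p y)"
      if "0 \<le> t" "0 \<le> s" for t s
    proof -
      have "lower p y (x + z) \<le> p ((x + z) + smul (of_real (t + s)) y) - (t + s) * p y"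
        by (rule le) (use xz that B_add in auto)
      also have "(x + z) + smul (of_real (t + s)) y = (x + smul (of_real t) y) + (z + smul (of_real s) y)"
        by (simp add: scale_left_distrib algebra_simps)
      also have "p \<dots> \<le> p (x + smul (of_real t) y) + p (z + smul (of_real s) y)"
        by (intro sublinearD(2)[OF p] B_add B_scale xz y)
      finally show ?thesis by (simp add: algebra_simps)
    qed
    have "lower p y (x + z) - lower p y x \<le> lower p y z"
    proof (rule ge[OF xz(2)])
      fix s :: real assume s: "0 \<le> s"
      have "lower p y (x + z) - (p (z + smul (of_real s) y) - s * p y) \<le> lower p y x"
        by (rule ge[OF xz(1)]) (use sum s in \<open>fastforce simp: algebra_simps\<close>)
      then show "lower p y (x + z) - lower p y x \<le> p (z + smul (of_real s) y) - s * p y" by linarith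
    qed
    then show "lower p y (x + z) \<le> lower p y x + lower p y z" by linarith
  next
    fix s :: real and x assume x: "x \<in> B" and s: "0 \<le> s"
    show "lower p y (smul (of_real s) x) = s * lower p y x"
    proof (cases "s = 0")
      case True
      have "p (0 + smul (of_real t) y) - t * p y = 0" if "0 \<le> t" for t
        using sublinearD(3)[OF p y that] by simp
      then have "lower p y 0 = 0" using le[OF B_0, of 0] ge[OF B_0, of 0] by fastforce
      then show ?thesis using True by simp
    next
      case False
      then have s': "0 < s" using s by simp
      have "lower p y (smul (of_real (1/s)) (smul (of_real s) x)) \<le> 1/s * lower p y (smul (of_real s) x)"
        by (rule hom_le) (use s' x B_scale in auto)
      moreover have "smul (of_real (1/s)) (smul (of_real s) x) = x"
        using s' by (simp del: of_real_divide add: of_real_mult[symmetric])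
      ultimately have "s * lower p y x \<le> lower p y (smul (of_real s) x)" using s' by (simp add: field_simps)
      then show ?thesis using hom_le[OF s' x] by simp
    qed
  qed
qed

text \<open>A minimal sublinear function is linear, because it equals all the sublinear functions \<open>lower p y\<close>.\<close>

lemma minimal_sublinear_additive:
  assumes p: "sublinear p" and min: "\<And>p'. sublinear p' \<Longrightarrow> (\<And>x. p' x \<le> p x) \<Longrightarrow> p' = p"
    and xy: "x \<in> B" "y \<in> B"
  shows "p (x + y) = p x + p y"
proof -
  have "lower p y = p"
  proof (rule min[OF lower(2)[OF p xy(2)]])
    show "lower p y x \<le> p x" for x
    proof (cases "x \<in> B")
      case True
      then show ?thesis using lower(1)[OF p xy(2) True, of 0] by simp
    next
      case False
      then show ?thesis using sublinearD(1)[OF p False] by (simp add: lower_def)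
    qed
  qed
  then have "p x \<le> p (x + y) - p y" using lower(1)[OF p xy(2,1), of 1] by simp
  then show ?thesis using sublinearD(2)[OF p xy] by linarith
qed

text \<open>Zorn's lemma for the reversed pointwise order. The infimum of a chain is again
  subadditive because any two members of the chain have a smaller one that serves at both
  points.\<close>

lemma minimal_sublinear_exists:
  assumes p0: "sublinear p0"
  obtains p where "sublinear p" "\<And>x. p x \<le> p0 x" "\<And>p'. sublinear p' \<Longrightarrow> (\<And>x. p' x \<le> p x) \<Longrightarrow> p' = p"
proof -
  define A where "A = {p. sublinear p \<and> (\<forall>x. p x \<le> p0 x)}"
  define P where "P p q \<longleftrightarrow> (\<forall>x. q x \<le> p x)" for p q :: "'b \<Rightarrow> real"
  have "\<exists>m\<in>A. \<forall>a\<in>A. P m a \<longrightarrow> a = m"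
  proof (rule predicate_Zorn)
    show "partial_order_on A (relation_of P A)"
      by (rule partial_order_on_relation_ofI) (auto simp: P_def fun_eq_iff intro: order_trans antisym)
    fix C assume "C \<in> Chains (relation_of P A)"
    then have CA: "C \<subseteq> A" and ch: "\<And>p q. p \<in> C \<Longrightarrow> q \<in> C \<Longrightarrow> P p q \<or> P q p"
      unfolding Chains_def relation_of_def by blast+
    show "\<exists>u\<in>A. \<forall>a\<in>C. P a u"
    proof (cases "C = {}")
      case True
      then show ?thesis using p0 by (auto simp: A_def)
    next
      case False
      define u where "u x = (INF p\<in>C. p x)" for x
      have pC: "sublinear p" "p x \<le> p0 x" if "p \<in> C" for p x using CA that by (auto simp: A_def)
      have bdd: "bdd_below ((\<lambda>p. p x) ` C)" for x
      \<comment> \<open>On B, sublinearity gives p x at least - p (- x), hence at least - p0 (- x);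
        off B the value is 0.\<close>
      proof (rule bdd_belowI[of _ "min 0 (- p0 (- x))"], elim imageE)
        fix v p assume v: "v = p x" "p \<in> C"
        show "min 0 (- p0 (- x)) \<le> v"
          using sublinearD(1)[OF pC(1)[OF v(2)], of x] sublinearD(5)[OF pC(1)[OF v(2)], of x] pC(2)[OF v(2), of "- x"] v(1)
          by (cases "x \<in> B") auto
      qed
      have le: "u x \<le> p x" if "p \<in> C" for p x unfolding u_def by (rule cINF_lower[OF bdd that])
      have ge: "c \<le> u x" if "\<And>p. p \<in> C \<Longrightarrow> c \<le> p x" for c x
        unfolding u_def by (rule cINF_greatest[OF False that])
      have "sublinear u"
        unfolding sublinear_def
      proof (intro conjI allI impI ballI)
        show "u x = 0" if "x \<notin> B" for x
        proof -
          have "u x = (INF p\<in>C. 0)"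
            unfolding u_def by (rule INF_cong[OF refl]) (rule sublinearD(1)[OF pC(1) that])
          then show ?thesis using False by simp
        qed
      next
        fix x y assume xy: "x \<in> B" "y \<in> B"
        have s: "u (x + y) \<le> p x + q y" if pq: "p \<in> C" "q \<in> C" for p q
        proof -
          from ch[OF pq] obtain r where r: "r \<in> C" "r x \<le> p x" "r y \<le> q y"
            using pq by (auto simp: P_def)
          have "u (x + y) \<le> r (x + y)" by (rule le[OF r(1)])
          also have "\<dots> \<le> r x + r y" by (rule sublinearD(2)[OF pC(1)[OF r(1)] xy])
          finally show ?thesis using r by linarith
        qed
        have "u (x + y) - u x \<le> u y"
        proof (rule ge)
          fix q assume q: "q \<in> C"
          have "u (x + y) - q y \<le> u x" by (rule ge) (use s[OF _ q] in \<open>simp add: algebra_simps\<close>)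
          then show "u (x + y) - u x \<le> q y" by linarith
        qed
        then show "u (x + y) \<le> u x + u y" by linarith
      next
        fix t :: real and x assume x: "x \<in> B" and t: "0 \<le> t"
        have "u (smul (of_real t) x) = (INF p\<in>C. t * p x)"
          unfolding u_def by (rule INF_cong[OF refl]) (rule sublinearD(3)[OF pC(1) x t])
        also have "\<dots> = t * u x"
        proof (rule antisym)
          have bt: "bdd_below ((\<lambda>p. t * p x) ` C)"
            by (rule bdd_belowI[of _ "t * u x"]) (use le t in \<open>auto intro: mult_left_mono\<close>)
          show "t * u x \<le> (INF p\<in>C. t * p x)"
            by (rule cINF_greatest[OF False]) (use le t in \<open>auto intro: mult_left_mono\<close>)
          show "(INF p\<in>C. t * p x) \<le> t * u x"
          proof (cases "t = 0")
            case False
            then have "t > 0" using t by simp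
            have "(INF p\<in>C. t * p x) / t \<le> u x"
              by (rule ge) (use cINF_lower[OF bt] \<open>t > 0\<close> in \<open>simp add: field_simps\<close>)
            then show ?thesis using \<open>t > 0\<close> by (simp add: field_simps)
          qed (use \<open>C \<noteq> {}\<close> in simp)
        qed
        finally show "u (smul (of_real t) x) = t * u x" .
      qed
      moreover have "u x \<le> p0 x" for x
      proof -
        obtain p where "p \<in> C" using False by blast
        then show ?thesis using le[of p x] pC(2)[of p x] by simp
      qed
      ultimately show ?thesis using le by (intro bexI[of _ u]) (auto simp: A_def P_def)
    qed
  qed
  then obtain p where p: "p \<in> A" "\<And>a. a \<in> A \<Longrightarrow> P p a \<Longrightarrow> a = p" by blast
  show ?thesis
  proof (rule that[of p])
    show "sublinear p" "p x \<le> p0 x" for x using p(1) by (auto simp: A_def)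
    show "p' = p" if "sublinear p'" "\<And>x. p' x \<le> p x" for p'
      using that p(1) by (intro p(2)) (auto simp: A_def P_def intro: order_trans)
  qed
qed

text \<open>The minimal function is taken below \<open>lower p0 x0\<close> and not merely below the
  norm \<open>p0\<close>. This forces its value at - x0 down to - N x0, so the real linear function
  obtained attains the norm at x0.\<close>

lemma norming_functional:
  assumes x0: "x0 \<in> B"
  obtains l where "contractive_functional smul B N l" "cmod (l x0) = N x0"
proof -
  define p0 where "p0 x = (if x \<in> B then N x else 0)" for x
  have p0: "sublinear p0" unfolding sublinear_def p0_def using N_add N_smul B_add B_scale by auto
  obtain u where u: "sublinear u" "\<And>x. u x \<le> lower p0 x0 x"
      "\<And>p'. sublinear p' \<Longrightarrow> (\<And>x. p' x \<le> u x) \<Longrightarrow> p' = u"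
    using minimal_sublinear_exists[OF lower(2)[OF p0 x0]] by metis
  have add: "u (x + y) = u x + u y" if "x \<in> B" "y \<in> B" for x y
    by (rule minimal_sublinear_additive[OF u(1) u(3) that])
  have neg: "u (- x) = - u x" if "x \<in> B" for x
    using add[OF that B_neg[OF that]] sublinearD(4)[OF u(1)] by simp
  have scale: "u (smul (of_real t) x) = t * u x" if x: "x \<in> B" for t x
  proof (cases "0 \<le> t")
    case False
    have "u (smul (of_real (- t)) x) = - t * u x" using sublinearD(3)[OF u(1) x, of "- t"] False by simp
    moreover have "u (smul (of_real (- t)) x) = - u (smul (of_real t) x)"
      using neg[OF B_scale[OF x, of "of_real t"]] by (simp add: scale_minus_left)
    ultimately show ?thesis by simp
  qed (rule sublinearD(3)[OF u(1) x])
  have uN: "u x \<le> N x" if "x \<in> B" for x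
    using u(2)[of x] lower(1)[OF p0 x0 that, of 0] that by (simp add: p0_def)
  have "u (- x0) \<le> - N x0"
    using u(2)[of "- x0"] lower(1)[OF p0 x0 B_neg[OF x0], of 1] x0 sublinearD(4)[OF p0] by (simp add: p0_def)
  then have ux0: "N x0 \<le> u x0" using neg[OF x0] by simp
  \<comment> \<open>The complex linear function with real part u.\<close>
  define l where "l x = Complex (u x) (- u (smul \<i> x))" for x
  have l_add: "l (x + y) = l x + l y" if "x \<in> B" "y \<in> B" for x y
    using that add B_scale by (simp add: l_def scale_right_distrib complex_eq_iff)
  have l_scale: "l (smul c x) = c * l x" if x: "x \<in> B" for c x
  proof -
    have dec: "smul c' x = smul (of_real (Re c')) x + smul (of_real (Im c')) (smul \<i> x)" for c'
      by (simp add: scale_left_distrib[symmetric] complex_eq mult.commute)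
    have "u (smul c' x) = Re c' * u x + Im c' * u (smul \<i> x)" for c'
    proof -
      have "u (smul c' x) = u (smul (of_real (Re c')) x) + u (smul (of_real (Im c')) (smul \<i> x))"
        by (subst dec) (intro add B_scale x)
      then show ?thesis by (simp only: scale[OF x] scale[OF B_scale[OF x]])
    qed
    from this[of c] this[of "\<i> * c"] show ?thesis by (simp add: l_def complex_eq_iff algebra_simps)
  qed
  have bound: "cmod (l x) \<le> N x" if x: "x \<in> B" for x
  proof -
    \<comment> \<open>Rotating x makes its image under l real and nonnegative, where it coincides
      with the value of u, which is below the norm.\<close>
    define c where "c = cnj (sgn (l x))"
    have "c * l x = of_real (cmod (l x))"
    proof (cases "l x = 0")
      case False
      have "c * l x = (cnj (l x) * l x) / of_real (cmod (l x))" by (simp add: c_def sgn_eq)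
      also have "cnj (l x) * l x = of_real ((cmod (l x))\<^sup>2)" by (simp only: complex_norm_square mult.commute)
      finally show ?thesis using False by (simp add: power2_eq_square)
    qed simp
    then have "cmod (l x) = Re (l (smul c x))" using l_scale[OF x, of c] by simp
    also have "\<dots> = u (smul c x)" by (simp add: l_def)
    also have "\<dots> \<le> N (smul c x)" by (rule uN[OF B_scale[OF x]])
    also have "\<dots> = cmod c * N x" by (rule N_smul[OF x])
    also have "\<dots> \<le> 1 * N x" by (intro mult_right_mono N_nonneg[OF x]) (simp add: c_def norm_sgn)
    finally show ?thesis by simp
  qed
  show ?thesis
  proof (rule that[of l])
    show "contractive_functional smul B N l"
      unfolding contractive_functional_def using l_add l_scale bound by blast
    have "u x0 \<le> cmod (l x0)" using complex_Re_le_cmod[of "l x0"] by (simp add: l_def)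
    then show "cmod (l x0) = N x0" using bound[OF x0] ux0 by simp
  qed
qed

end

section \<open>Taylor expansions with values in a Banach space\<close>

text \<open>On a circle of radius \<open>\<rho>\<close> between R/2 and R, the quotient is at most 2
  M / \<open>\<rho>\<close>, hence at most 4 M / R; the maximum principle extends this over the
  removed singularity at z0.\<close>

lemma difference_quotient:
  assumes hol: "h holomorphic_on ball z0 R" and R: "R > 0" and M: "\<And>z. z \<in> ball z0 R \<Longrightarrow> cmod (h z) \<le> M"
  defines "k \<equiv> (\<lambda>z. if z = z0 then deriv h z0 else (h z - h z0) / (z - z0))"
  shows "k holomorphic_on ball z0 R" "\<And>z. z \<in> ball z0 R \<Longrightarrow> cmod (k z) \<le> 4 * M / R"
proof -
  show khol: "k holomorphic_on ball z0 R"
    unfolding k_def by (rule pole_lemma[OF hol]) (use R in \<open>simp add: interior_open\<close>)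
  fix z assume z: "z \<in> ball z0 R"
  define \<rho> where "\<rho> = (max (dist z0 z) (R/2) + R) / 2"
  have \<rho>: "dist z0 z < \<rho>" "R/2 \<le> \<rho>" "\<rho> < R" using z R by (auto simp: \<rho>_def)
  have \<rho>0: "0 < \<rho>" using \<rho>(2) R by linarith
  have sub: "cball z0 \<rho> \<subseteq> ball z0 R" using \<rho> by auto
  have M0: "M \<ge> 0" using M[OF z] norm_ge_zero order_trans by blast
  show "cmod (k z) \<le> 4 * M / R"
  proof (rule maximum_modulus_frontier[of k "ball z0 \<rho>"])
    show "k holomorphic_on interior (ball z0 \<rho>)"
      by (rule holomorphic_on_subset[OF khol]) (use sub in auto)
    show "continuous_on (closure (ball z0 \<rho>)) k"
      by (rule continuous_on_subset[OF holomorphic_on_imp_continuous_on[OF khol]]) (use sub \<rho>0 in auto)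
    fix w assume "w \<in> frontier (ball z0 \<rho>)"
    then have w: "cmod (w - z0) = \<rho>" using \<rho>0 by (simp add: frontier_ball dist_norm norm_minus_commute)
    then have "w \<in> ball z0 R" "w \<noteq> z0" using \<rho> \<rho>0 by (auto simp: dist_norm norm_minus_commute)
    then have "cmod (k w) = cmod (h w - h z0) / \<rho>" using w by (simp add: k_def norm_divide)
    also have "\<dots> \<le> (M + M) / \<rho>"
      using M[OF \<open>w \<in> ball z0 R\<close>] M[of z0] R \<rho>0
      by (intro divide_right_mono order_trans[OF norm_triangle_ineq4] add_mono) auto
    also have "\<dots> \<le> (M + M) / (R/2)" using \<rho>(2) M0 R \<rho>0 by (intro divide_left_mono) auto
    finally show "cmod (k w) \<le> 4 * M / R" by simp
  qed (use \<rho> in auto)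
qed

section \<open>Weak holomorphy tested by functionals, and division by z - z0\<close>

context normed_carrier
begin

lemma functionalD:
  assumes "contractive_functional smul B N l"
  shows "x \<in> B \<Longrightarrow> y \<in> B \<Longrightarrow> l (x + y) = l x + l y" "x \<in> B \<Longrightarrow> l (smul c x) = c * l x"
    "x \<in> B \<Longrightarrow> cmod (l x) \<le> N x" "l 0 = 0" "x \<in> B \<Longrightarrow> y \<in> B \<Longrightarrow> l (x - y) = l x - l y"
proof -
  show 1: "x \<in> B \<Longrightarrow> y \<in> B \<Longrightarrow> l (x + y) = l x + l y" and 2: "x \<in> B \<Longrightarrow> l (smul c x) = c * l x"
    and "x \<in> B \<Longrightarrow> cmod (l x) \<le> N x" for x y c
    using assms by (auto simp: contractive_functional_def)
  show "l 0 = 0" using 2[OF B_0, of 0] by simp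
  show "l (x - y) = l x - l y" if "x \<in> B" "y \<in> B"
    using 1[OF that(1) B_neg[OF that(2)]] 2[OF that(2), of "-1"] by (simp add: scale_minus_left)
qed

lemma N_le_if_functionals_le:
  assumes "x \<in> B" "\<And>l. contractive_functional smul B N l \<Longrightarrow> cmod (l x) \<le> c"
  shows "N x \<le> c"
  using norming_functional[OF assms(1)] assms(2) by metis

lemma N_complete:
  fixes x :: "nat \<Rightarrow> 'b"
  assumes x: "\<And>n. x n \<in> B" and cauchy: "\<And>e. e > 0 \<Longrightarrow> \<exists>n0. \<forall>m\<ge>n0. \<forall>n\<ge>n0. N (x m - x n) < e"
  obtains a where "a \<in> B" "(\<lambda>n. N (x n - a)) \<longlonglongrightarrow> 0"
proof -
  interpret Metric_space B "norm_dist B N" by (rule Metric_space_norm_dist[OF vector_space_axioms banach])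
  have "MCauchy x"
    unfolding MCauchy_def
  proof (intro conjI allI impI)
    show "range x \<subseteq> B" using x by blast
    fix e :: real assume "e > 0"
    then obtain n0 where "\<forall>m\<ge>n0. \<forall>n\<ge>n0. N (x m - x n) < e" using cauchy by blast
    then show "\<exists>n0. \<forall>m n. n0 \<le> m \<longrightarrow> n0 \<le> n \<longrightarrow> norm_dist B N (x m) (x n) < e"
      using x by (auto simp: norm_dist_def)
  qed
  moreover have "mcomplete" using banach by (simp add: complex_banach_def)
  ultimately obtain a where a: "limitin mtopology x a sequentially" unfolding mcomplete_def by blast
  then have aB: "a \<in> B" and ev: "\<And>e. e > 0 \<Longrightarrow> \<forall>\<^sub>F n in sequentially. x n \<in> B \<and> norm_dist B N (x n) a < e"
    unfolding limitin_metric by auto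
  have "(\<lambda>n. N (x n - a)) \<longlonglongrightarrow> 0"
  proof (rule tendstoI)
    fix e :: real assume "e > 0"
    from ev[OF this] show "\<forall>\<^sub>F n in sequentially. dist (N (x n - a)) 0 < e"
      by eventually_elim (use aB N_nonneg B_diff in \<open>auto simp: norm_dist_def\<close>)
  qed
  then show ?thesis using aB that by blast
qed

text \<open>The bound M is part of the notion because division by z - z0 is going to be iterated,
  and each division needs scalar estimates that are uniform over the functionals.\<close>

definition weakly_holomorphic :: "complex \<Rightarrow> real \<Rightarrow> (complex \<Rightarrow> 'b) \<Rightarrow> real \<Rightarrow> bool" where
  "weakly_holomorphic z0 R G M \<longleftrightarrow> (\<forall>z\<in>ball z0 R. G z \<in> B \<and> N (G z) \<le> M) \<and>
     (\<forall>l. contractive_functional smul B N l \<longrightarrow> (\<lambda>z. l (G z)) holomorphic_on ball z0 R)"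

text \<open>The quotient is extended to \<open>z0\<close> by completeness: the estimates for its scalar versions are uniform
  over all the functionals.\<close>

lemma weakly_holomorphic_divide:
  assumes G: "weakly_holomorphic z0 R G M" and R: "R > 0"
  obtains G1 where "weakly_holomorphic z0 R G1 (4 * M / R)" "\<forall>z\<in>ball z0 R. G z = G z0 + smul (z - z0) (G1 z)"
proof -
  have GB: "G z \<in> B" "N (G z) \<le> M" if "z \<in> ball z0 R" for z using G that by (auto simp: weakly_holomorphic_def)
  have z0: "z0 \<in> ball z0 R" using R by simp
  define Q where "Q z = smul (inverse (z - z0)) (G z - G z0)" for z
  have QB: "Q z \<in> B" if "z \<in> ball z0 R" for z unfolding Q_def by (intro B_scale B_diff GB that z0)
  define k where "k l z = (if z = z0 then deriv (\<lambda>z. l (G z)) z0 else (l (G z) - l (G z0)) / (z - z0))" for l z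
  have khol: "k l holomorphic_on ball z0 R" "\<And>z. z \<in> ball z0 R \<Longrightarrow> cmod (k l z) \<le> 4 * M / R"
    if l: "contractive_functional smul B N l" for l
  proof -
    have h: "(\<lambda>z. l (G z)) holomorphic_on ball z0 R" using G l by (auto simp: weakly_holomorphic_def)
    have b: "cmod (l (G z)) \<le> M" if "z \<in> ball z0 R" for z
      using functionalD(3)[OF l GB(1)[OF that]] GB(2)[OF that] by linarith
    have keq: "k l = (\<lambda>z. if z = z0 then deriv (\<lambda>z. l (G z)) z0 else (l (G z) - l (G z0)) / (z - z0))"
      by (simp add: fun_eq_iff k_def)
    show "k l holomorphic_on ball z0 R" "\<And>z. z \<in> ball z0 R \<Longrightarrow> cmod (k l z) \<le> 4 * M / R"
      unfolding keq using difference_quotient[OF h R b] by blast+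
  qed
  have lQ: "l (Q z) = k l z" if "contractive_functional smul B N l" "z \<in> ball z0 R" "z \<noteq> z0" for l z
    using that GB z0 B_diff by (simp add: Q_def k_def functionalD[OF that(1)] divide_inverse mult.commute)
  \<comment> \<open>The bound of \<open>difference_quotient\<close> applied a second time, to
    \<open>k l\<close>: it makes all the scalar quotients Lipschitz at z0 with one constant.\<close>
  define C where "C = 4 * (4 * M / R) / R"
  have klip: "cmod (k l z - k l z0) \<le> C * cmod (z - z0)" if l: "contractive_functional smul B N l" and z: "z \<in> ball z0 R" for l z
  proof (cases "z = z0")
    case False
    have "cmod ((if z = z0 then deriv (k l) z0 else (k l z - k l z0) / (z - z0))) \<le> C"
      unfolding C_def by (rule difference_quotient(2)[OF khol(1)[OF l] R khol(2)[OF l] z])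
    then show ?thesis using False by (simp add: norm_divide pos_divide_le_eq)
  qed simp
  have Qdiff: "N (Q z - Q w) \<le> C * (cmod (z - z0) + cmod (w - z0))"
    if z: "z \<in> ball z0 R" "z \<noteq> z0" and w: "w \<in> ball z0 R" "w \<noteq> z0" for z w
  proof (rule N_le_if_functionals_le)
    show "Q z - Q w \<in> B" by (intro B_diff QB z w)
    fix l assume l: "contractive_functional smul B N l"
    have "l (Q z - Q w) = (k l z - k l z0) - (k l w - k l z0)"
      using functionalD(5)[OF l QB[OF z(1)] QB[OF w(1)]] lQ[OF l z] lQ[OF l w] by simp
    then have "cmod (l (Q z - Q w)) \<le> cmod (k l z - k l z0) + cmod (k l w - k l z0)"
      by (simp only: norm_triangle_ineq4)
    then show "cmod (l (Q z - Q w)) \<le> C * (cmod (z - z0) + cmod (w - z0))"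
      using klip[OF l z(1)] klip[OF l w(1)] by (simp add: distrib_left)
  qed
  \<comment> \<open>Any sequence in the ball that tends to z0 without reaching it would serve; the 2
    keeps the first term off the boundary of the ball.\<close>
  define x where "x n = z0 + of_real (R / (n + 2))" for n :: nat
  have x: "x n \<in> ball z0 R" "x n \<noteq> z0" "cmod (x n - z0) = R / (n + 2)" for n
  proof -
    show c: "cmod (x n - z0) = R / (n + 2)" using R by (simp add: x_def del: of_real_divide)
    have "R / (n + 2) < R / 1" using R by (intro divide_strict_left_mono) auto
    then show "x n \<in> ball z0 R" using c by (simp add: dist_norm norm_minus_commute)
    show "x n \<noteq> z0" using c R by auto
  qed
  have xlim: "(\<lambda>n. cmod (x n - z0)) \<longlonglongrightarrow> 0"
    unfolding x(3) by real_asymp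
  have M0: "M \<ge> 0" using GB[OF z0] N_nonneg[OF GB(1)[OF z0]] by linarith
  then have C0: "C \<ge> 0" using R by (simp add: C_def)
  obtain a where a: "a \<in> B" "(\<lambda>n. N (Q (x n) - a)) \<longlonglongrightarrow> 0"
  proof (rule N_complete[of "\<lambda>n. Q (x n)"])
    show "Q (x n) \<in> B" for n by (rule QB[OF x(1)])
    fix e :: real assume "e > 0"
    have "(\<lambda>n. C * (2 * cmod (x n - z0))) \<longlonglongrightarrow> C * (2 * 0)" by (intro tendsto_intros xlim)
    then have "\<forall>\<^sub>F n in sequentially. C * (2 * cmod (x n - z0)) < e" using \<open>e > 0\<close> by (auto dest: order_tendstoD(2))
    then obtain n0 where n0: "C * (2 * cmod (x n0 - z0)) < e" using eventually_happens by force
    have "N (Q (x m) - Q (x n)) < e" if "m \<ge> n0" "n \<ge> n0" for m n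
    proof -
      have le: "cmod (x m - z0) \<le> cmod (x n0 - z0)" if "m \<ge> n0" for m
        unfolding x(3) using R that by (intro divide_left_mono) auto
      have "N (Q (x m) - Q (x n)) \<le> C * (cmod (x m - z0) + cmod (x n - z0))" by (intro Qdiff x)
      also have "\<dots> \<le> C * (2 * cmod (x n0 - z0))" using le[OF that(1)] le[OF that(2)] C0 by (intro mult_left_mono) auto
      finally show ?thesis using n0 by linarith
    qed
    then show "\<exists>n0. \<forall>m\<ge>n0. \<forall>n\<ge>n0. N (Q (x m) - Q (x n)) < e" by blast
  qed (rule that)
  have la: "l a = k l z0" if l: "contractive_functional smul B N l" for l
  proof -
    have "(\<lambda>n. cmod (k l (x n) - l a)) \<longlonglongrightarrow> 0"
    proof (rule tendsto_sandwich[OF _ _ tendsto_const a(2)])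
      show "\<forall>\<^sub>F n in sequentially. cmod (k l (x n) - l a) \<le> N (Q (x n) - a)"
        using functionalD(3)[OF l B_diff[OF QB[OF x(1)] a(1)]] functionalD(5)[OF l QB[OF x(1)] a(1)] lQ[OF l x(1,2)]
        by (auto intro!: always_eventually)
    qed simp
    then have "(\<lambda>n. k l (x n)) \<longlonglongrightarrow> l a" using tendsto_norm_zero_iff LIM_zero_iff by blast
    moreover have "(\<lambda>n. cmod (k l (x n) - k l z0)) \<longlonglongrightarrow> 0"
    proof (rule tendsto_sandwich[OF _ _ tendsto_const])
      show "(\<lambda>n. C * cmod (x n - z0)) \<longlonglongrightarrow> 0" using tendsto_mult_left[OF xlim, of C] by simp
      show "\<forall>\<^sub>F n in sequentially. cmod (k l (x n) - k l z0) \<le> C * cmod (x n - z0)"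
        using klip[OF l x(1)] by (auto intro!: always_eventually)
    qed simp
    then have "(\<lambda>n. k l (x n)) \<longlonglongrightarrow> k l z0" using tendsto_norm_zero_iff LIM_zero_iff by blast
    ultimately show ?thesis by (rule LIMSEQ_unique)
  qed
  define G1 where "G1 z = (if z = z0 then a else Q z)" for z
  have lG1: "l (G1 z) = k l z" if "contractive_functional smul B N l" "z \<in> ball z0 R" for l z
    using la lQ that by (simp add: G1_def)
  have G1B: "G1 z \<in> B" if "z \<in> ball z0 R" for z using a(1) QB that by (simp add: G1_def)
  show ?thesis
  proof (rule that[of G1])
    show "weakly_holomorphic z0 R G1 (4 * M / R)"
      unfolding weakly_holomorphic_def
    proof (intro conjI ballI allI impI)
      fix z assume z: "z \<in> ball z0 R"
      show "G1 z \<in> B" by (rule G1B[OF z])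
      show "N (G1 z) \<le> 4 * M / R"
        by (rule N_le_if_functionals_le[OF G1B[OF z]]) (use lG1 khol(2) z in simp)
    next
      fix l assume l: "contractive_functional smul B N l"
      show "(\<lambda>z. l (G1 z)) holomorphic_on ball z0 R"
        by (rule holomorphic_transform[OF khol(1)[OF l]]) (use lG1[OF l] in simp)
    qed
    show "\<forall>z\<in>ball z0 R. G z = G z0 + smul (z - z0) (G1 z)"
      by (simp add: G1_def Q_def)
  qed
qed

text \<open>Division by z - z0 is repeated, and the n-th coefficient is the value at z0 of the n-th
  quotient. Dependent choice runs over pairs of a quotient and its bound; the bound of quotient m +
  1 is the constant of the remainder after the terms up to m.\<close>

lemma weakly_holomorphic_taylor:
  assumes G: "weakly_holomorphic z0 R G M" and R: "R > 0"
  obtains a where "\<And>n. a n \<in> B"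
    "\<And>m. \<exists>C. \<forall>z\<in>ball z0 R. N (G z - (\<Sum>n\<le>m. smul ((z - z0) ^ n) (a n))) \<le> C * cmod (z - z0) ^ Suc m"
proof -
  have "\<exists>F. \<forall>n. (weakly_holomorphic z0 R (fst (F n)) (snd (F n)) \<and> (n = 0 \<longrightarrow> fst (F n) = G)) \<and>
      (\<forall>z\<in>ball z0 R. fst (F n) z = fst (F n) z0 + smul (z - z0) (fst (F (Suc n)) z))"
  proof (rule dependent_nat_choice)
    show "\<exists>x. weakly_holomorphic z0 R (fst x) (snd x) \<and> (0 = (0::nat) \<longrightarrow> fst x = G)"
      using G by (intro exI[of _ "(G, M)"]) simp
    fix x :: "(complex \<Rightarrow> 'b) \<times> real" and n :: nat
    assume "weakly_holomorphic z0 R (fst x) (snd x) \<and> (n = 0 \<longrightarrow> fst x = G)"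
    then obtain G1 where "weakly_holomorphic z0 R G1 (4 * snd x / R)" "\<forall>z\<in>ball z0 R. fst x z = fst x z0 + smul (z - z0) (G1 z)"
      using weakly_holomorphic_divide[OF _ R] by blast
    then show "\<exists>y. (weakly_holomorphic z0 R (fst y) (snd y) \<and> (Suc n = 0 \<longrightarrow> fst y = G)) \<and>
        (\<forall>z\<in>ball z0 R. fst x z = fst x z0 + smul (z - z0) (fst y z))"
      by (intro exI[of _ "(G1, 4 * snd x / R)"]) simp
  qed
  then obtain F where F: "\<And>n. weakly_holomorphic z0 R (fst (F n)) (snd (F n))" "fst (F 0) = G"
    "\<And>n z. z \<in> ball z0 R \<Longrightarrow> fst (F n) z = fst (F n) z0 + smul (z - z0) (fst (F (Suc n)) z)" by metis
  have FB: "fst (F n) z \<in> B" "N (fst (F n) z) \<le> snd (F n)" if "z \<in> ball z0 R" for n z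
    using F(1)[of n] that by (auto simp: weakly_holomorphic_def)
  define a where "a n = fst (F n) z0" for n
  have rem: "G z - (\<Sum>n\<le>m. smul ((z - z0) ^ n) (a n)) = smul ((z - z0) ^ Suc m) (fst (F (Suc m)) z)" if z: "z \<in> ball z0 R" for z m
  proof (induction m)
    case 0
    then show ?case using F(3)[OF z, of 0] by (simp add: F(2) a_def)
  next
    case (Suc m)
    have "G z - (\<Sum>n\<le>Suc m. smul ((z - z0) ^ n) (a n)) =
        (G z - (\<Sum>n\<le>m. smul ((z - z0) ^ n) (a n))) - smul ((z - z0) ^ Suc m) (a (Suc m))" by simp
    also have "\<dots> = smul ((z - z0) ^ Suc m) (fst (F (Suc m)) z - fst (F (Suc m)) z0)"
      unfolding Suc.IH by (simp add: a_def scale_right_diff_distrib)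
    also have "fst (F (Suc m)) z - fst (F (Suc m)) z0 = smul (z - z0) (fst (F (Suc (Suc m))) z)"
      using F(3)[OF z, of "Suc m"] by (metis add_diff_cancel_left')
    finally show ?case by (simp add: mult.commute)
  qed
  show ?thesis
  proof (rule that[of a])
    show "a n \<in> B" for n unfolding a_def by (rule FB(1)) (use R in simp)
    show "\<exists>C. \<forall>z\<in>ball z0 R. N (G z - (\<Sum>n\<le>m. smul ((z - z0) ^ n) (a n))) \<le> C * cmod (z - z0) ^ Suc m" for m
    proof (intro exI[of _ "snd (F (Suc m))"] ballI)
      fix z assume z: "z \<in> ball z0 R"
      have "N (G z - (\<Sum>n\<le>m. smul ((z - z0) ^ n) (a n))) = cmod (z - z0) ^ Suc m * N (fst (F (Suc m)) z)"
        unfolding rem[OF z] by (simp only: N_smul[OF FB(1)[OF z]] norm_power)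
      also have "\<dots> \<le> cmod (z - z0) ^ Suc m * snd (F (Suc m))" by (intro mult_left_mono FB z) simp
      finally show "N (G z - (\<Sum>n\<le>m. smul ((z - z0) ^ n) (a n))) \<le> snd (F (Suc m)) * cmod (z - z0) ^ Suc m"
        by (simp only: mult.commute)
    qed
  qed
qed

lemma C1hol_in_chart_B:
  assumes "C1hol_in_chart smul B N S g" "q \<in> S" shows "g q \<in> B"
proof -
  interpret Metric_space B "norm_dist B N" by (rule Metric_space_norm_dist[OF vector_space_axioms banach])
  show ?thesis using assms unfolding C1hol_in_chart_def continuous_map_def by auto
qed

text \<open>The two-point condition with its first point at q itself: ordinary differentiability
  relative to S, the form used from here on.\<close>

lemma C1hol_in_chart_deriv:
  assumes "C1hol_in_chart smul B N S g"
  obtains g' where "\<And>q. q \<in> S \<Longrightarrow> g' q \<in> B"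
    "\<And>q \<epsilon>. q \<in> S \<Longrightarrow> \<epsilon> > 0 \<Longrightarrow> \<exists>\<delta>>0. \<forall>p\<in>S. cmod (p - q) \<le> \<delta> \<longrightarrow> N (g p - g q - smul (p - q) (g' q)) \<le> \<epsilon> * cmod (p - q)"
proof -
  interpret Metric_space B "norm_dist B N" by (rule Metric_space_norm_dist[OF vector_space_axioms banach])
  obtain g' where g': "continuous_map (top_of_set S) mtopology g'"
    "\<forall>q\<in>S. \<forall>\<epsilon>>0. \<exists>\<delta>>0. \<forall>q1\<in>S. \<forall>q2\<in>S. cmod (q1 - q) \<le> \<delta> \<and> cmod (q2 - q) \<le> \<delta> \<longrightarrow>
       N (g q2 - g q1 - smul (q2 - q1) (g' q)) \<le> \<epsilon> * cmod (q2 - q1)"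
    using assms unfolding C1hol_in_chart_def by blast
  show ?thesis
  proof (rule that[of g'])
    show "g' q \<in> B" if "q \<in> S" for q using g'(1) that unfolding continuous_map_def by auto
    fix q and \<epsilon> :: real assume q: "q \<in> S" "\<epsilon> > 0"
    then obtain \<delta> where \<delta>: "\<delta> > 0" "\<forall>q1\<in>S. \<forall>q2\<in>S. cmod (q1 - q) \<le> \<delta> \<and> cmod (q2 - q) \<le> \<delta> \<longrightarrow>
       N (g q2 - g q1 - smul (q2 - q1) (g' q)) \<le> \<epsilon> * cmod (q2 - q1)" using g'(2) by blast
    have "\<forall>p\<in>S. cmod (p - q) \<le> \<delta> \<longrightarrow> N (g p - g q - smul (p - q) (g' q)) \<le> \<epsilon> * cmod (p - q)"
      using \<delta>(2) q(1) \<delta>(1) by simp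
    then show "\<exists>\<delta>>0. \<forall>p\<in>S. cmod (p - q) \<le> \<delta> \<longrightarrow> N (g p - g q - smul (p - q) (g' q)) \<le> \<epsilon> * cmod (p - q)"
      using \<delta>(1) by blast
  qed
qed

lemma C1hol_functional:
  assumes g: "C1hol_in_chart smul B N S g" and l: "contractive_functional smul B N l"
  shows "continuous_on S (\<lambda>q. l (g q))" "\<And>U. open U \<Longrightarrow> U \<subseteq> S \<Longrightarrow> (\<lambda>q. l (g q)) holomorphic_on U"
proof -
  obtain g' where g': "\<And>q. q \<in> S \<Longrightarrow> g' q \<in> B"
    "\<And>q \<epsilon>. q \<in> S \<Longrightarrow> \<epsilon> > 0 \<Longrightarrow> \<exists>\<delta>>0. \<forall>p\<in>S. cmod (p - q) \<le> \<delta> \<longrightarrow> N (g p - g q - smul (p - q) (g' q)) \<le> \<epsilon> * cmod (p - q)"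
    using C1hol_in_chart_deriv[OF g] by metis
  have der: "((\<lambda>q. l (g q)) has_field_derivative l (g' q)) (at q within S)" if q: "q \<in> S" for q
    unfolding has_field_derivative_def has_derivative_within_alt
  proof (intro conjI allI impI bounded_linear_mult_right)
    fix e :: real assume "e > 0"
    then obtain \<delta> where \<delta>: "\<delta> > 0" "\<forall>p\<in>S. cmod (p - q) \<le> \<delta> \<longrightarrow> N (g p - g q - smul (p - q) (g' q)) \<le> e * cmod (p - q)"
      using g'(2)[OF q] by blast
    show "\<exists>d>0. \<forall>y\<in>S. norm (y - q) < d \<longrightarrow> norm (l (g y) - l (g q) - l (g' q) * (y - q)) \<le> e * norm (y - q)"
    proof (intro exI[of _ \<delta>] conjI ballI impI \<delta>(1))
      fix y assume y: "y \<in> S" "norm (y - q) < \<delta>"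
      have B: "g y \<in> B" "g q \<in> B" "g' q \<in> B" using C1hol_in_chart_B[OF g] g'(1) y q by auto
      have "l (g y - g q - smul (y - q) (g' q)) = l (g y) - l (g q) - l (g' q) * (y - q)"
        using B by (simp add: functionalD[OF l] B_diff B_scale mult.commute)
      moreover have "cmod (l (g y - g q - smul (y - q) (g' q))) \<le> N (g y - g q - smul (y - q) (g' q))"
        by (intro functionalD(3)[OF l] B_diff B_scale B)
      ultimately show "norm (l (g y) - l (g q) - l (g' q) * (y - q)) \<le> e * norm (y - q)"
        using \<delta>(2) y by force
    qed
  qed
  show "continuous_on S (\<lambda>q. l (g q))"
    unfolding continuous_on_eq_continuous_within using der DERIV_continuous by blast
  show "(\<lambda>q. l (g q)) holomorphic_on U" if "open U" "U \<subseteq> S" for U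
    unfolding holomorphic_on_def field_differentiable_def using der DERIV_subset that by blast
qed

text \<open>Differentiability at the centre, with \<open>\<epsilon>\<close> = 1, already bounds the
  norm near z by 1 + N (g z) + N (g' z) when the radius is at most 1.\<close>

lemma C1hol_weakly_holomorphic:
  assumes g: "C1hol_in_chart smul B N S g" and R: "R > 0" "ball z R \<subseteq> S"
  obtains r M where "0 < r" "r \<le> R" "weakly_holomorphic z r g M"
proof -
  obtain g' where g': "\<And>q. q \<in> S \<Longrightarrow> g' q \<in> B"
    "\<And>q \<epsilon>. q \<in> S \<Longrightarrow> \<epsilon> > 0 \<Longrightarrow> \<exists>\<delta>>0. \<forall>p\<in>S. cmod (p - q) \<le> \<delta> \<longrightarrow> N (g p - g q - smul (p - q) (g' q)) \<le> \<epsilon> * cmod (p - q)"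
    using C1hol_in_chart_deriv[OF g] by metis
  have zS: "z \<in> S" using R by auto
  obtain \<delta> where \<delta>: "\<delta> > 0" "\<forall>p\<in>S. cmod (p - z) \<le> \<delta> \<longrightarrow> N (g p - g z - smul (p - z) (g' z)) \<le> 1 * cmod (p - z)"
    using g'(2)[OF zS, of 1] by auto
  define r where "r = min (min \<delta> R) 1"
  have r: "0 < r" "r \<le> \<delta>" "r \<le> R" "r \<le> 1" using \<delta>(1) R(1) by (auto simp: r_def)
  show ?thesis
  proof (rule that[OF r(1,3)])
    show "weakly_holomorphic z r g (1 + N (g z) + N (g' z))"
      unfolding weakly_holomorphic_def
    proof (intro conjI ballI allI impI)
      fix p assume p: "p \<in> ball z r"
      then have pS: "p \<in> S" and pz: "cmod (p - z) \<le> \<delta>" "cmod (p - z) \<le> 1"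
        using r R(2) by (auto simp: dist_norm norm_minus_commute)
      have B: "g p \<in> B" "g z \<in> B" "g' z \<in> B" using C1hol_in_chart_B[OF g] g'(1) pS zS by auto
      show "g p \<in> B" by fact
      have "N (g p) = N ((g p - g z - smul (p - z) (g' z)) + (g z + smul (p - z) (g' z)))" by simp
      also have "\<dots> \<le> N (g p - g z - smul (p - z) (g' z)) + N (g z + smul (p - z) (g' z))"
        by (intro N_add B_diff B_add B_scale B)
      also have "\<dots> \<le> 1 + (N (g z) + N (g' z))"
      proof (rule add_mono)
        show "N (g p - g z - smul (p - z) (g' z)) \<le> 1" using \<delta>(2) pS pz by force
        have "N (g z + smul (p - z) (g' z)) \<le> N (g z) + cmod (p - z) * N (g' z)"
          using N_add[OF B(2) B_scale[OF B(3)]] N_smul[OF B(3)] by simp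
        also have "\<dots> \<le> N (g z) + 1 * N (g' z)" using pz N_nonneg[OF B(3)] by (intro add_left_mono mult_right_mono)
        finally show "N (g z + smul (p - z) (g' z)) \<le> N (g z) + N (g' z)" by simp
      qed
      finally show "N (g p) \<le> 1 + N (g z) + N (g' z)" by simp
    next
      fix l assume "contractive_functional smul B N l"
      then show "(\<lambda>q. l (g q)) holomorphic_on ball z r"
        by (rule C1hol_functional(2)[OF g]) (use r R(2) in auto)
    qed
  qed
qed

text \<open>Here S0 and g0 stand for one compact set of the sequence in a chart and the restriction
  to it, S and g for the union and the full function. Far from z, values of g may lie outside B, but
  the limit only sees a ball inside S0.\<close>

lemma asymptotic_expansion_exists:
  assumes g0: "C1hol_in_chart smul B N S0 g0" and R: "R > 0" "ball z R \<subseteq> S0" and S: "S0 \<subseteq> S"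
    and eq: "\<And>q. q \<in> S0 \<Longrightarrow> g q = g0 q"
  shows "\<exists>a. asymptotic_expansion_in_chart smul B N S g z a"
proof -
  interpret Metric_space B "norm_dist B N" by (rule Metric_space_norm_dist[OF vector_space_axioms banach])
  obtain r M where r: "0 < r" "r \<le> R" "weakly_holomorphic z r g0 M"
    by (rule C1hol_weakly_holomorphic[OF g0 R])
  obtain a where a: "\<And>n. a n \<in> B"
    "\<And>m. \<exists>C. \<forall>q\<in>ball z r. N (g0 q - (\<Sum>n\<le>m. smul ((q - z) ^ n) (a n))) \<le> C * cmod (q - z) ^ Suc m"
    using weakly_holomorphic_taylor[OF r(3,1)] by metis
  have br: "ball z r \<subseteq> S0" using r(2) R(2) by auto
  have "asymptotic_expansion_in_chart smul B N S g z a"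
    unfolding asymptotic_expansion_in_chart_def
  proof (intro conjI allI a(1))
    have zb: "z \<in> ball z r" using r(1) by simp
    then show "z \<in> S" using br S by blast
    have "z islimpt ball z r" using r(1) by (simp add: islimpt_ball)
    then show "z islimpt S" using br S by (meson islimpt_subset)
    fix m
    obtain C where C: "\<And>q. q \<in> ball z r \<Longrightarrow> N (g0 q - (\<Sum>n\<le>m. smul ((q - z) ^ n) (a n))) \<le> C * cmod (q - z) ^ Suc m"
      using a(2) by blast
    have sumB: "(\<Sum>n\<le>m. smul ((q - z) ^ n) (a n)) \<in> B" for q
      by (intro subspace_sum[OF sub] B_scale a(1))
    show "limitin mtopology (\<lambda>q. smul (inverse ((q - z) ^ m)) (g q - (\<Sum>n\<le>m. smul ((q - z) ^ n) (a n)))) 0 (at z within S)"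
      unfolding limitin_metric
    proof (intro conjI allI impI B_0)
      fix \<epsilon> :: real assume "\<epsilon> > 0"
      \<comment> \<open>The absolute value and the 1 allow for a constant C that is zero or
        negative.\<close>
      define \<rho> where "\<rho> = min r (\<epsilon> / (\<bar>C\<bar> + 1))"
      have \<rho>: "\<rho> > 0" "\<rho> \<le> r" "\<rho> \<le> \<epsilon> / (\<bar>C\<bar> + 1)" using r(1) \<open>\<epsilon> > 0\<close> by (auto simp: \<rho>_def)
      show "\<forall>\<^sub>F q in at z within S. smul (inverse ((q - z) ^ m)) (g q - (\<Sum>n\<le>m. smul ((q - z) ^ n) (a n))) \<in> B \<and>
        norm_dist B N (smul (inverse ((q - z) ^ m)) (g q - (\<Sum>n\<le>m. smul ((q - z) ^ n) (a n)))) 0 < \<epsilon>"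
        unfolding eventually_at
      proof (intro exI[of _ \<rho>] conjI ballI impI \<rho>(1); (elim conjE)?)
        fix q assume q: "q \<in> S" "q \<noteq> z" "dist q z < \<rho>"
        then have qb: "q \<in> ball z r" using \<rho>(2) by (simp add: dist_commute)
        have gq: "g q = g0 q" "g0 q \<in> B" using eq br qb C1hol_in_chart_B[OF g0] by auto
        let ?d = "g q - (\<Sum>n\<le>m. smul ((q - z) ^ n) (a n))"
        have dB: "?d \<in> B" using gq sumB B_diff by simp
        then show sB: "smul (inverse ((q - z) ^ m)) ?d \<in> B" by (rule B_scale)
        have qz: "cmod (q - z) > 0" using q(2) by simp
        have "N (smul (inverse ((q - z) ^ m)) ?d) = inverse (cmod (q - z) ^ m) * N ?d"
          by (simp add: N_smul[OF dB] norm_inverse norm_power)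
        also have "\<dots> \<le> inverse (cmod (q - z) ^ m) * (C * cmod (q - z) ^ Suc m)"
          using C[OF qb] gq by (intro mult_left_mono) auto
        also have "\<dots> = C * cmod (q - z)" using qz by simp
        also have "\<dots> \<le> \<bar>C\<bar> * cmod (q - z)" by (intro mult_right_mono) auto
        also have "\<dots> < (\<bar>C\<bar> + 1) * \<rho>" using q(3) qz by (intro mult_strict_mono') (auto simp: dist_norm)
        also have "\<dots> \<le> (\<bar>C\<bar> + 1) * (\<epsilon> / (\<bar>C\<bar> + 1))" using \<rho>(3) by (intro mult_left_mono) auto
        also have "\<dots> = \<epsilon>" by simp
        finally show "norm_dist B N (smul (inverse ((q - z) ^ m)) ?d) 0 < \<epsilon>"
          using sB B_0 by (simp add: norm_dist_def)
      qed
    qed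
  qed
  then show ?thesis by blast
qed

text \<open>After composition with a functional, a nonconstant h would be (p - z)^n times a function
  without zeros near z, so h divided by (p - z)^n could not tend to 0. The functionals then detect
  that the vector itself is 0.\<close>

lemma zero_if_zero_expansion:
  assumes exp: "asymptotic_expansion_in_chart smul B N S g z (\<lambda>_. 0)"
    and g0: "C1hol_in_chart smul B N S0 g0" and R: "R > 0" "ball z R \<subseteq> S0" and S: "S0 \<subseteq> S"
    and eq: "\<And>q. q \<in> S0 \<Longrightarrow> g q = g0 q" and q: "q \<in> ball z R"
  shows "g q = 0"
proof -
  interpret Metric_space B "norm_dist B N" by (rule Metric_space_norm_dist[OF vector_space_axioms banach])
  have B: "g0 p \<in> B" if "p \<in> ball z R" for p using C1hol_in_chart_B[OF g0] that R(2) by blast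
  have zero: "l (g0 q) = 0" if l: "contractive_functional smul B N l" for l
  proof -
    define h where "h p = l (g0 p)" for p
    have hol: "h holomorphic_on ball z R" unfolding h_def by (rule C1hol_functional(2)[OF g0 l open_ball R(2)])
    have lim: "((\<lambda>p. h p / (p - z) ^ m) \<longlongrightarrow> 0) (at z)" for m
    proof (rule tendstoI)
      fix \<epsilon> :: real assume "\<epsilon> > 0"
      have "limitin mtopology (\<lambda>p. smul (inverse ((p - z) ^ m)) (g p - (\<Sum>n\<le>m. smul ((p - z) ^ n) 0))) 0 (at z within S)"
        using exp unfolding asymptotic_expansion_in_chart_def by blast
      then have "\<forall>\<^sub>F p in at z within S. norm_dist B N (smul (inverse ((p - z) ^ m)) (g p)) 0 < \<epsilon>"
        unfolding limitin_metric using \<open>\<epsilon> > 0\<close> by (auto elim!: eventually_mono)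
      then obtain d where d: "d > 0" "\<forall>p\<in>S. p \<noteq> z \<and> dist p z < d \<longrightarrow> norm_dist B N (smul (inverse ((p - z) ^ m)) (g p)) 0 < \<epsilon>"
        unfolding eventually_at by blast
      show "\<forall>\<^sub>F p in at z. dist (h p / (p - z) ^ m) 0 < \<epsilon>"
        unfolding eventually_at
      proof (intro exI[of _ "min d R"] conjI ballI impI; (elim conjE)?)
        show "0 < min d R" using d R by simp
        fix p assume p: "p \<noteq> z" "dist p z < min d R"
        then have pb: "p \<in> ball z R" by (simp add: dist_commute)
        then have gp: "g p = g0 p" "p \<in> S" using eq R(2) S by auto
        have sB: "smul (inverse ((p - z) ^ m)) (g0 p) \<in> B" by (intro B_scale B pb)
        have "cmod (h p / (p - z) ^ m) = cmod (l (smul (inverse ((p - z) ^ m)) (g0 p)))"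
          using functionalD(2)[OF l B[OF pb]] by (simp add: h_def divide_inverse mult.commute)
        also have "\<dots> \<le> N (smul (inverse ((p - z) ^ m)) (g0 p))" by (rule functionalD(3)[OF l sB])
        also have "\<dots> < \<epsilon>" using d(2) p gp sB B_0 by (auto simp: norm_dist_def)
        finally show "dist (h p / (p - z) ^ m) 0 < \<epsilon>" by simp
      qed
    qed
    have zb: "z \<in> ball z R" using R(1) by simp
    have "isCont h z" using hol zb by (metis continuous_on_eq_continuous_at holomorphic_on_imp_continuous_on open_ball)
    then have hz: "h z = 0" using lim[of 0] by (auto simp: isCont_def intro: LIM_unique)
    have "h constant_on ball z R"
    proof (rule ccontr)
      assume nc: "\<not> h constant_on ball z R"
      obtain k r n where k: "0 < n" "0 < r" "ball z r \<subseteq> ball z R" "k holomorphic_on ball z r"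
        "\<And>w. w \<in> ball z r \<Longrightarrow> h w = (w - z) ^ n * k w" "\<And>w. w \<in> ball z r \<Longrightarrow> k w \<noteq> 0"
        by (rule holomorphic_factor_zero_nonconstant[OF hol open_ball connected_ball zb hz nc]) blast
      have zr: "z \<in> ball z r" using k(2) by simp
      have "isCont k z" using k(4) zr by (metis continuous_on_eq_continuous_at holomorphic_on_imp_continuous_on open_ball)
      then have "(k \<longlongrightarrow> k z) (at z)" by (simp add: isCont_def)
      moreover have "(k \<longlongrightarrow> 0) (at z)"
      proof (rule Lim_transform_within[OF lim[of n] k(2)])
        fix w assume "0 < dist w z" "dist w z < r"
        then show "h w / (w - z) ^ n = k w" using k(5)[of w] by (simp add: dist_commute)
      qed
      ultimately show False using k(6)[OF zr] LIM_unique by blast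
    qed
    then show ?thesis using hz q zb unfolding constant_on_def h_def by metis
  qed
  have "N (g0 q) \<le> 0" by (rule N_le_if_functionals_le[OF B[OF q]]) (simp add: zero)
  then have "g0 q = 0" using N_nonneg[OF B[OF q]] N_zero[OF B[OF q]] by simp
  then show ?thesis using eq q R(2) by auto
qed

end

section \<open>Quasianalyticity of monogenic functions\<close>

lemma inv_chart_ball:
  assumes "bounded (- (Some -` V))" "None \<in> V"
  obtains r where "r > 0" "ball 0 r \<subseteq> inv_chart -` V"
proof -
  obtain b where b: "b > 0" "\<And>x. x \<in> - (Some -` V) \<Longrightarrow> cmod x \<le> b"
    using assms(1) unfolding bounded_pos by blast
  have "inv_chart \<xi> \<in> V" if "cmod \<xi> < 1 / b" for \<xi>
  proof (cases "\<xi> = 0")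
    case False
    then have "cmod (1 / \<xi>) > b" using that b(1) by (simp add: norm_divide field_simps)
    then have "Some (1 / \<xi>) \<in> V" using b(2)[of "1 / \<xi>"] by fastforce
    then show ?thesis using False by (simp add: inv_chart_def)
  qed (use assms(2) in \<open>simp add: inv_chart_def\<close>)
  then have "ball 0 (1 / b) \<subseteq> inv_chart -` V" by auto
  then show ?thesis using that[of "1 / b"] b(1) by simp
qed

lemma sphere_hausdorff1_inv_chart_ball_pos:
  assumes "r > 0"
  shows "sphere_hausdorff1 (inv_chart ` ball 0 r) > 0"
proof -
  have "- cball 0 (1 / r) \<subseteq> Some -` inv_chart ` ball 0 r"
  proof
    fix c :: complex assume "c \<in> - cball 0 (1 / r)"
    then have c: "1 / r < cmod c" by simp
    then have "c \<noteq> 0" using assms by auto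
    then have "cmod (1 / c) < r" using c assms by (simp add: norm_divide field_simps)
    moreover have "Some c = inv_chart (1 / c)" using \<open>c \<noteq> 0\<close> by (simp add: inv_chart_def)
    ultimately show "c \<in> Some -` inv_chart ` ball 0 r" by auto
  qed
  moreover have "hausdorff1 (- cball (0::complex) (1 / r)) > 0"
  proof (rule hausdorff1_open_pos)
    have "of_real (1 / r + 1) \<in> - cball (0::complex) (1 / r)" using assms by (simp del: of_real_add of_real_divide)
    then show "- cball (0::complex) (1 / r) \<noteq> {}" by blast
  qed auto
  ultimately show ?thesis
    unfolding sphere_hausdorff1_def using hausdorff1_null_subset by (metis not_gr_zero)
qed

context normed_carrier
begin

text \<open>Assuming f q0 to be nonzero, a single functional that norms f q0 reduces everything to
  one scalar function \<open>\<psi>\<close>. Whichever of the two closed domains carries zeros of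
  positive length, \<open>\<psi>\<close> vanishes on it, hence on the common part of the curves,
  which is again a set of positive length for the other domain.\<close>

lemma C1hol_uniqueness:
  assumes nested: "nested_pair \<Gamma>i \<Gamma>e" and f: "f \<in> C1hol smul (nested_compact \<Gamma>i \<Gamma>e) B N"
    and Z: "Z \<subseteq> nested_compact \<Gamma>i \<Gamma>e" "\<And>q. q \<in> Z \<Longrightarrow> f q = 0" "sphere_hausdorff1 Z > 0"
    and q0: "q0 \<in> nested_compact \<Gamma>i \<Gamma>e"
  shows "f q0 = 0"
proof (rule ccontr)
  assume nz: "f q0 \<noteq> 0"
  define K where "K = nested_compact \<Gamma>i \<Gamma>e"
  have rect: "rectifiable_jordan_curve \<Gamma>i" "rectifiable_jordan_curve \<Gamma>e"
    and common: "hausdorff1 (\<Gamma>i \<inter> \<Gamma>e) > 0" using nested by (auto simp: nested_pair_def)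
  note Ji = jordan_curve_props[OF rectifiable_imp_jordan_curve[OF rect(1)]]
    and Je = jordan_curve_props[OF rectifiable_imp_jordan_curve[OF rect(2)]]
  define S where "S = (inside \<Gamma>i \<union> \<Gamma>i) \<union> (outside \<Gamma>e \<union> \<Gamma>e)"
  have K: "K = insert None (Some ` S)"
    unfolding K_def S_def by (rule nested_compact_eq[OF rect[THEN rectifiable_imp_jordan_curve]])
  have g: "C1hol_in_chart smul B N S (f \<circ> Some)" "C1hol_in_chart smul B N (inv_chart -` K) (f \<circ> inv_chart)"
    using f K unfolding C1hol_def K_def[symmetric] by simp_all
  have fB: "f q \<in> B" if "q \<in> K" for q
  proof (cases q)
    case None
    then show ?thesis using C1hol_in_chart_B[OF g(2), of 0] that by (simp add: inv_chart_def)
  next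
    case (Some x)
    then show ?thesis using C1hol_in_chart_B[OF g(1), of x] that K by auto
  qed
  have q0K: "q0 \<in> K" using q0 by (simp add: K_def)
  obtain l where l: "contractive_functional smul B N l" "cmod (l (f q0)) = N (f q0)"
    by (rule norming_functional[OF fB[OF q0K]])
  define \<psi> where "\<psi> q = l (f q)" for q
  have \<psi>0: "\<psi> q = 0" if "f q = 0" for q using functionalD(4)[OF l(1)] that by (simp add: \<psi>_def)
  have cont: "continuous_on S (\<psi> \<circ> Some)" and hol: "\<And>U. open U \<Longrightarrow> U \<subseteq> S \<Longrightarrow> (\<psi> \<circ> Some) holomorphic_on U"
    using C1hol_functional[OF g(1) l(1)] by (simp_all add: o_def \<psi>_def)
  \<comment> \<open>What K omits lies inside \<open>\<Gamma>e\<close> and is bounded, so K contains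
    a full neighbourhood of infinity, and continuity relative to K becomes continuity there.\<close>
  have inf: "isCont (\<psi> \<circ> inv_chart) 0"
  proof -
    have "- (Some -` K) = - S" by (simp add: K)
    also have "\<dots> \<subseteq> inside \<Gamma>e" using Je(10) unfolding S_def by blast
    finally have "- (Some -` K) \<subseteq> inside \<Gamma>e" .
    then have "bounded (- (Some -` K))" using Je(4) bounded_subset by blast
    then obtain r where r: "r > 0" "ball 0 r \<subseteq> inv_chart -` K"
      by (rule inv_chart_ball) (simp add: K)
    have "continuous_on (inv_chart -` K) (\<psi> \<circ> inv_chart)"
      using C1hol_functional(1)[OF g(2) l(1)] by (simp add: o_def \<psi>_def)
    then have "continuous_on (ball 0 r) (\<psi> \<circ> inv_chart)" using r(2) continuous_on_subset by blast
    then show ?thesis using r(1) by (simp add: continuous_on_eq_continuous_at o_def)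
  qed
  have inner: "\<forall>x\<in>inside \<Gamma>i \<union> \<Gamma>i. \<psi> (Some x) = 0"
    if "A \<subseteq> inside \<Gamma>i \<union> \<Gamma>i" "\<forall>x\<in>A. \<psi> (Some x) = 0" "hausdorff1 A > 0" for A
  proof
    fix x assume x: "x \<in> inside \<Gamma>i \<union> \<Gamma>i"
    have "continuous_on (inside \<Gamma>i \<union> \<Gamma>i) (\<psi> \<circ> Some)"
      by (rule continuous_on_subset[OF cont]) (auto simp: S_def)
    moreover have "(\<psi> \<circ> Some) holomorphic_on inside \<Gamma>i" by (rule hol[OF Ji(2)]) (auto simp: S_def)
    ultimately have "(\<psi> \<circ> Some) x = 0"
      by (rule zero_on_closure_inside[OF rect(1) _ _ that(1) _ that(3) x]) (use that(2) in simp)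
    then show "\<psi> (Some x) = 0" by simp
  qed
  have outer: "\<psi> None = 0 \<and> (\<forall>x\<in>outside \<Gamma>e \<union> \<Gamma>e. \<psi> (Some x) = 0)"
    if "A \<subseteq> outside \<Gamma>e \<union> \<Gamma>e" "\<forall>x\<in>A. \<psi> (Some x) = 0" "hausdorff1 A > 0" for A
  proof -
    have c: "continuous_on (outside \<Gamma>e \<union> \<Gamma>e) (\<psi> \<circ> Some)"
      by (rule continuous_on_subset[OF cont]) (auto simp: S_def)
    have h: "(\<psi> \<circ> Some) holomorphic_on outside \<Gamma>e" by (rule hol[OF Je(6)]) (auto simp: S_def)
    show ?thesis using zero_on_closure_outside[OF rect(2) c h inf that(1) _ that(3)] that(2) by simp
  qed
  have both: "\<psi> None = 0 \<and> (\<forall>x\<in>S. \<psi> (Some x) = 0)"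
  proof (cases "hausdorff1 (Some -` Z \<inter> (inside \<Gamma>i \<union> \<Gamma>i)) > 0")
    case True
    then have 1: "\<forall>x\<in>inside \<Gamma>i \<union> \<Gamma>i. \<psi> (Some x) = 0"
      by (intro inner[of "Some -` Z \<inter> (inside \<Gamma>i \<union> \<Gamma>i)"]) (use Z(2) \<psi>0 in auto)
    moreover have "\<psi> None = 0 \<and> (\<forall>x\<in>outside \<Gamma>e \<union> \<Gamma>e. \<psi> (Some x) = 0)"
      by (rule outer[OF _ _ common]) (use 1 in auto)
    ultimately show ?thesis unfolding S_def by blast
  next
    case False
    have "hausdorff1 (Some -` Z \<inter> (outside \<Gamma>e \<union> \<Gamma>e)) > 0"
    proof (rule ccontr)
      assume "\<not> ?thesis"
      then have "hausdorff1 (Some -` Z \<inter> (outside \<Gamma>e \<union> \<Gamma>e)) = 0" by simp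
      moreover have "hausdorff1 (Some -` Z \<inter> (inside \<Gamma>i \<union> \<Gamma>i)) = 0" using False by simp
      ultimately have "hausdorff1 ((Some -` Z \<inter> (inside \<Gamma>i \<union> \<Gamma>i)) \<union> (Some -` Z \<inter> (outside \<Gamma>e \<union> \<Gamma>e))) = 0"
        by (intro hausdorff1_null_Un)
      moreover have "Some -` Z \<subseteq> S" using Z(1) K unfolding K_def[symmetric] by auto
      then have "(Some -` Z \<inter> (inside \<Gamma>i \<union> \<Gamma>i)) \<union> (Some -` Z \<inter> (outside \<Gamma>e \<union> \<Gamma>e)) = Some -` Z"
        unfolding S_def by blast
      ultimately show False using Z(3) by (simp add: sphere_hausdorff1_def)
    qed
    then have 1: "\<psi> None = 0 \<and> (\<forall>x\<in>outside \<Gamma>e \<union> \<Gamma>e. \<psi> (Some x) = 0)"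
      by (intro outer[of "Some -` Z \<inter> (outside \<Gamma>e \<union> \<Gamma>e)"]) (use Z(2) \<psi>0 in auto)
    moreover have "\<forall>x\<in>inside \<Gamma>i \<union> \<Gamma>i. \<psi> (Some x) = 0"
      by (rule inner[OF _ _ common]) (use 1 in auto)
    ultimately show ?thesis unfolding S_def by blast
  qed
  then have "\<psi> q0 = 0" using q0K unfolding K by auto
  then show False using l(2) N_zero[OF fB[OF q0K]] nz by (simp add: \<psi>_def)
qed

end

text \<open>A countable union of null sets is null, so some \<open>K j0\<close> already contains a
  part of Z of positive length. A single later compact set contains this part and q, and
  \<open>C1hol_uniqueness\<close> applies there.\<close>

lemma H1_quasianalytic_monogenic:
  fixes smul :: "complex \<Rightarrow> 'b \<Rightarrow> 'b::ab_group_add"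
  assumes carrier: "\<And>j. normed_carrier smul (B j) (N j)"
    and nested: "\<And>j. nested_pair (\<Gamma>i j) (\<Gamma>e j)"
    and K: "\<And>j. K j = nested_compact (\<Gamma>i j) (\<Gamma>e j)" "\<And>j. K j \<subseteq> K (Suc j)"
    and f: "f \<in> monogenic smul K B N"
    and Z: "Z \<subseteq> (\<Union>j. K j)" "\<And>q. q \<in> Z \<Longrightarrow> f q = 0" "sphere_hausdorff1 Z > 0" and q: "q \<in> (\<Union>j. K j)"
  shows "f q = 0"
proof -
  obtain j0 where j0: "sphere_hausdorff1 (Z \<inter> K j0) > 0"
  proof (rule ccontr)
    assume neg: "\<not> thesis"
    have "hausdorff1 (Some -` (Z \<inter> K j)) = 0" for j
      using neg that[of j] unfolding sphere_hausdorff1_def by (metis not_gr_zero)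
    then have "hausdorff1 (\<Union>j. Some -` (Z \<inter> K j)) = 0" by (rule hausdorff1_null_UN)
    moreover have "(\<Union>j. Some -` (Z \<inter> K j)) = Some -` Z" using Z(1) by blast
    ultimately show False using Z(3) by (simp add: sphere_hausdorff1_def)
  qed
  obtain j1 where j1: "q \<in> K j1" using q by blast
  define J where "J = max j0 j1"
  interpret normed_carrier smul "B J" "N J" by (rule carrier)
  have sub: "K j0 \<subseteq> K J" "K j1 \<subseteq> K J"
    by (intro lift_Suc_mono_le[of K, OF K(2)]; simp add: J_def)+
  have "restrict f (K J) \<in> C1hol smul (K J) (B J) (N J)" using f by (simp add: monogenic_def)
  then have "restrict f (K J) q = 0"
    unfolding K(1)[of J]
    by (rule C1hol_uniqueness[OF nested, where Z = "Z \<inter> K j0"])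
      (use Z(2) j0 j1 sub K(1)[of J] in auto)
  then show ?thesis using j1 sub by auto
qed

text \<open>A zero expansion makes the function vanish on a ball in the chart. The ball has positive
  length on the sphere, also when it is centred at infinity, so the first kind of quasianalyticity
  yields the second.\<close>

lemma quasianalytic_monogenic_at_interior:
  fixes smul :: "complex \<Rightarrow> 'b \<Rightarrow> 'b::ab_group_add"
  assumes carrier: "\<And>j. normed_carrier smul (B j) (N j)"
    and nested: "\<And>j. nested_pair (\<Gamma>i j) (\<Gamma>e j)"
    and K: "\<And>j. K j = nested_compact (\<Gamma>i j) (\<Gamma>e j)" "\<And>j. K j \<subseteq> K (Suc j)"
    and q0: "q0 \<in> riemann_sphere interior_of K j"
  shows "quasianalytic_at smul (B j) (N j) (\<Union>j. K j) (monogenic smul K B N) q0"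
proof -
  interpret normed_carrier smul "B j" "N j" by (rule carrier)
  \<comment> \<open>The chart around q0, and z the coordinate of q0 in it, so that finite points and
    infinity are treated together.\<close>
  define c where "c = (if q0 = None then inv_chart else Some)"
  define z where "z = (case q0 of Some x \<Rightarrow> x | None \<Rightarrow> 0)"
  have expansion_iff: "has_asymptotic_expansion smul (B j) (N j) (\<Union>j. K j) f q0 a \<longleftrightarrow>
      asymptotic_expansion_in_chart smul (B j) (N j) (c -` (\<Union>j. K j)) (f \<circ> c) z a" for f a
    unfolding has_asymptotic_expansion_def c_def z_def by (cases q0) simp_all
  obtain R where R: "R > 0" "ball z R \<subseteq> c -` K j" "sphere_hausdorff1 (c ` ball z R) > 0"
  proof -
    obtain V where V: "openin riemann_sphere V" "q0 \<in> V" "V \<subseteq> K j" using q0 unfolding interior_of_def by blast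
    show ?thesis
    proof (cases q0)
      case None
      then have "bounded (- (Some -` V))" using V(1,2) by (simp add: openin_sphere_iff compact_imp_bounded)
      moreover have "None \<in> V" using V(2) None by simp
      ultimately obtain r where "r > 0" "ball 0 r \<subseteq> inv_chart -` V" by (rule inv_chart_ball)
      then show ?thesis using that[of r] V(3) sphere_hausdorff1_inv_chart_ball_pos[of r] None by (auto simp: c_def z_def)
    next
      case (Some x)
      have "open (Some -` V)" "x \<in> Some -` V" using V(1,2) Some by (simp_all add: openin_sphere_iff)
      then obtain r where r: "r > 0" "ball x r \<subseteq> Some -` V" using openE by blast
      moreover have "sphere_hausdorff1 (Some ` ball x r) > 0"
        unfolding sphere_hausdorff1_def using r(1) by (simp add: hausdorff1_open_pos)
      ultimately show ?thesis using that[of r] V(3) Some by (auto simp: c_def z_def)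
    qed
  qed
  have sub: "c -` K j \<subseteq> c -` (\<Union>j. K j)" by blast
  have g: "C1hol_in_chart smul (B j) (N j) (c -` K j) (restrict f (K j) \<circ> c)" if "f \<in> monogenic smul K B N" for f
    using that by (auto simp: monogenic_def C1hol_def c_def)
  have eq: "(f \<circ> c) x = (restrict f (K j) \<circ> c) x" if "x \<in> c -` K j" for f :: "complex option \<Rightarrow> 'b" and x
    using that by simp
  show ?thesis
    unfolding quasianalytic_at_def expansion_iff
  proof (intro conjI ballI impI)
    fix f assume f: "f \<in> monogenic smul K B N"
    show "\<exists>a. asymptotic_expansion_in_chart smul (B j) (N j) (c -` (\<Union>j. K j)) (f \<circ> c) z a"
      by (rule asymptotic_expansion_exists[OF g[OF f] R(1,2) sub eq])
    fix q assume zero: "asymptotic_expansion_in_chart smul (B j) (N j) (c -` (\<Union>j. K j)) (f \<circ> c) z (\<lambda>_. 0)"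
      and q: "q \<in> (\<Union>j. K j)"
    have "(f \<circ> c) x = 0" if "x \<in> ball z R" for x
      by (rule zero_if_zero_expansion[OF zero g[OF f] R(1,2) sub eq that])
    then have "f p = 0" if "p \<in> c ` ball z R" for p using that by auto
    moreover have "c ` ball z R \<subseteq> (\<Union>j. K j)" using R(2) by blast
    ultimately show "f q = 0"
      using H1_quasianalytic_monogenic[OF carrier nested K f _ _ R(3) q] by blast
  qed
qed

theorem corollaryA:
  fixes smul :: "complex \<Rightarrow> 'b \<Rightarrow> 'b::ab_group_add"
    and B :: "nat \<Rightarrow> 'b set"
    and N :: "nat \<Rightarrow> 'b \<Rightarrow> real"
    and \<Gamma>i \<Gamma>e :: "nat \<Rightarrow> complex set"
    and K :: "nat \<Rightarrow> complex option set"
  assumes "vector_space smul"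
    and "\<And>j. complex_banach smul (B j) (N j)"
    and "\<And>j. B j \<subseteq> B (Suc j)"
    and "\<And>j. continuous_map (norm_topology (B j) (N j))
                (norm_topology (B (Suc j)) (N (Suc j))) (\<lambda>x. x)"
    and "\<And>j. nested_pair (\<Gamma>i j) (\<Gamma>e j)"
    and "\<And>j. K j = nested_compact (\<Gamma>i j) (\<Gamma>e j)"
    and "\<And>j. K j \<subseteq> K (Suc j)"
  shows "H1_quasianalytic (\<Union>j. K j) (monogenic smul K B N) (\<Union>j. K j)
       \<and> (\<forall>j. \<forall>q0 \<in> riemann_sphere interior_of K j.
            quasianalytic_at smul (B j) (N j) (\<Union>j. K j) (monogenic smul K B N) q0)"
proof -
  have carrier: "normed_carrier smul (B j) (N j)" for j
    by (intro normed_carrier.intro normed_carrier_axioms.intro assms(1,2))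
  have "H1_quasianalytic (\<Union>j. K j) (monogenic smul K B N) (\<Union>j. K j)"
    unfolding H1_quasianalytic_def uniqueness_set_def
  proof (intro allI impI conjI ballI)
    fix \<gamma> f q assume \<gamma>: "\<gamma> \<subseteq> (\<Union>j. K j) \<and> 0 < sphere_hausdorff1 \<gamma>" and f: "f \<in> monogenic smul K B N"
      and zero: "\<forall>q\<in>\<gamma>. f q = 0" and q: "q \<in> (\<Union>j. K j)"
    show "f q = 0"
      by (rule H1_quasianalytic_monogenic[OF carrier assms(5-7) f _ _ _ q, of \<gamma>]) (use \<gamma> zero in auto)
  qed simp
  moreover have "quasianalytic_at smul (B j) (N j) (\<Union>j. K j) (monogenic smul K B N) q0"
    if "q0 \<in> riemann_sphere interior_of K j" for j q0
    using carrier assms(5-7) that by (rule quasianalytic_monogenic_at_interior)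
  ultimately show ?thesis by blast
qed

end
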